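(* Let $\mathbb{K}\subset\mathbb{C}$ be any field, $\mathbf{f}=(f_1,\dots,f_N)\in\mathbb{K}[x_1,\dots,x_n]^N$, and let $\xi\in\mathbb{C}^n$ be an isolated solution of $\mathbf{f}$. Let $Q\subset\mathbb{C}[\mathbf{x}]$ be the primary component at $\xi$ of the ideal generated by $f_1,\dots,f_N$, and let $B=\{(\mathbf{x}-\xi)^{\alpha_0},\dots,(\mathbf{x}-\xi)^{\alpha_{\delta-1}}\}$ be a basis of $\mathbb{C}[\mathbf{x}]/Q$ which is part of an orthogonal primal-dual basis pair. Let $E=\{\alpha_0,\dots,\alpha_{\delta-1}\}\subset\mathbb{N}^n$, let $\mathtt{M}_i(\mu)$, $i=1,\dots,n$, be the parametric multiplication matrices corresponding to $E$, and let $\mathcal{N}_{\mathbf{z},\mu}$ be the parametric normal form. Let $\nu=(\nu_{\alpha,\beta})$ be the coefficients of the dual basis of $B$ corresponding to the variables $\mu=(\mu_{\alpha,\beta})$. Then $(\mathbf{z},\mu)=(\xi,\nu)$ is an isolated root with multiplicity one of the polynomial system in $\mathbb{K}[\mathbf{z},\mu]$: $$\begin{cases}\mathcal{N}_{\mathbf{z},\mu}(f_k)=0&\text{for }k=1,\dots,N,\\ \mathtt{M}_i(\mu)\cdot\mathtt{M}_j(\mu)-\mathtt{M}_j(\mu)\cdot\mathtt{M}_i(\mu)=0&\text{for }i,j=1,\dots,n.\end{cases}$$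
   Context: Functionals. For $\beta\in\mathbb{N}^n$, $\partial_\xi^\beta(p)=\frac{\partial^{|\beta|}p}{\partial x_1^{\beta_1}\cdots\partial x_n^{\beta_n}}(\xi)$; $\mathbb{C}[\partial_\xi]$ is the space of finite linear combinations of the $\partial_\xi^\beta$, and the order $\operatorname{ord}(\Lambda)$ of $\Lambda$ is the maximal $|\beta|$ such that $\partial_\xi^\beta$ occurs in $\Lambda$ with non-zero coefficient. Let $\mathscr{D}=Q^\perp\subset\mathbb{C}[\partial_\xi]$ be the space of functionals vanishing on $Q$, $\mathscr{D}_t$ its elements of order $\le t$, $\delta=\dim\mathscr{D}=\dim\mathbb{C}[\mathbf{x}]/Q$ the multiplicity, and $o$ the maximal order of elements of $\mathscr{D}$. Orthogonal primal-dual basis pair. $B$ (primal basis) is a basis of $\mathbb{C}[\mathbf{x}]/Q$ with $\alpha_0=0$ and $B$ connected to $1$ (for each $\alpha_k\ne0$ in $E$ there are $\alpha_j\in E$ and $i\in\{1,\dots,n\}$ with $\alpha_k=\alpha_j+\mathbf{e}_i$, $\mathbf{e}_i$ the $i$-th standard unit vector), such that the unique basis $\Lambda_0,\dots,\Lambda_{\delta-1}$ of $\mathscr{D}$ dual to $B$ (i.e. $\Lambda_i((\mathbf{x}-\xi)^{\alpha_j})=\delta_{ij}$, Kronecker delta) has the form $\Lambda_0=1_\xi$ (evaluation at $\xi$) and $$\Lambda_i=\frac{1}{\alpha_i!}\partial_\xi^{\alpha_i}+\sum_{|\beta|\le|\alpha_i|,\ \beta\notin E}\nu_{\alpha_i,\beta}\frac{1}{\beta!}\partial_\xi^\beta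 ,$$ with $0=\operatorname{ord}(\Lambda_0)\le\dots\le\operatorname{ord}(\Lambda_{\delta-1})$ and $\mathscr{D}_t=\operatorname{span}\{\Lambda_j:\operatorname{ord}(\Lambda_j)\le t\}$ for $0\le t\le o$. (One sets $\nu_{\alpha_i,\beta}=0$ for $\beta\notin E$, $|\beta|>|\alpha_i|$.) Parametric multiplication matrices. For $i=1,\dots,n$, $\mathtt{M}_i(\mu)$ is the $\delta\times\delta$ matrix whose transpose $\mathtt{M}_i^t(\mu)$, with rows and columns indexed by $0,\dots,\delta-1$, has entry in row $k$, column $l$ equal to $0$ if $k\ge l$, and for $k<l$ equal to $$\mu_{\alpha_l,\alpha_k+\mathbf{e}_i}=\begin{cases}1&\text{if }\alpha_l=\alpha_k+\mathbf{e}_i,\\ 0&\text{if }\alpha_k+\mathbf{e}_i\in E,\ \alpha_l\ne\alpha_k+\mathbf{e}_i,\\ \text{the variable }\mu_{\alpha_l,\alpha_k+\mathbf{e}_i}&\text{if }\alpha_k+\mathbf{e}_i\notin E.\end{cases}$$ $\mu$ denotes the collection of all variables occurring in these matrices. Put $\mathtt{M}(\mu)^\gamma=\mathtt{M}_1(\mu)^{\gamma_1}\cdots\mathtt{M}_n(\mu)^{\gamma_n}$ (in this order). Parametric normal form. With new variables $\mathbf{z}=(z_1,\dots,z_n)$, $\mathcal{N}_{\mathbf{z},\mu}:\mathbb{K}[\mathbf{x}]\to\mathbb{K}[\mathbf{z},\mu]^\delta$ is $\mathcal{N}_{\mathbf{z},\mu}(p)=\sum_{\gamma\in\mathbb{N}^n}\frac{1}{\gamma!}\,\partial_{\mathbf{z}}^\gamma(p)\,\mathtt{M}(\mu)^\gamma[1]$,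 where $\partial_{\mathbf{z}}^\gamma(p)$ is the $\gamma$-th partial derivative of $p$ evaluated at $\mathbf{z}$ and $[1]=(1,0,\dots,0)^t$. *)

theory Defs
  imports
    "HOL-Analysis.Function_Topology"
    "HOL-Analysis.Isolated"
    "HOL-Algebra.Ideal"
    "HOL-Algebra.Subrings"
    "HOL-Library.Poly_Mapping"
    "Jordan_Normal_Form.Matrix"
begin

section \<open>Ideals and primary components\<close>

definition radical :: "('a, 'b) ring_scheme \<Rightarrow> 'a set \<Rightarrow> 'a set" where
  "radical R I = {a \<in> carrier R. \<exists>k::nat. a [^]\<^bsub>R\<^esub> k \<in> I}"

definition primary_ideal :: "('a, 'b) ring_scheme \<Rightarrow> 'a set \<Rightarrow> bool" where
  "primary_ideal R Q \<longleftrightarrow> ideal Q R \<and> Q \<noteq> carrier R \<and>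
     (\<forall>a\<in>carrier R. \<forall>b\<in>carrier R. a \<otimes>\<^bsub>R\<^esub> b \<in> Q \<longrightarrow> a \<in> Q \<or> b \<in> radical R Q)"

text \<open>The intersection with the carrier matters only for the empty decomposition (of the unit ideal).\<close>

definition minimal_primary_decomposition ::
    "('a, 'b) ring_scheme \<Rightarrow> 'a set \<Rightarrow> 'a set set \<Rightarrow> bool" where
  "minimal_primary_decomposition R I \<Q> \<longleftrightarrow>
     finite \<Q> \<and> (\<forall>Q\<in>\<Q>. primary_ideal R Q) \<and> I = carrier R \<inter> \<Inter>\<Q> \<and>
     inj_on (radical R) \<Q> \<and> (\<forall>Q\<in>\<Q>. I \<noteq> carrier R \<inter> \<Inter>(\<Q> - {Q}))"

text \<open>
  The component belonging to the prime \<open>P\<close>, when \<open>P\<close> is minimal among the radicals of the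
  components (an isolated component, so that it does not depend on the decomposition).
\<close>

definition isolated_primary_component ::
    "('a, 'b) ring_scheme \<Rightarrow> 'a set \<Rightarrow> 'a set \<Rightarrow> 'a set \<Rightarrow> bool" where
  "isolated_primary_component R I P Q \<longleftrightarrow>
     (\<exists>\<Q>. minimal_primary_decomposition R I \<Q> \<and> Q \<in> \<Q> \<and> radical R Q = P \<and>
        (\<forall>Q'\<in>\<Q>. radical R Q' \<subseteq> P \<longrightarrow> Q' = Q))"


section \<open>Multivariate polynomials over the complex numbers\<close>

type_synonym 'v monomial = "'v \<Rightarrow>\<^sub>0 nat"
type_synonym 'v cpoly = "'v monomial \<Rightarrow>\<^sub>0 complex"

definition monomials :: "'v set \<Rightarrow> 'v monomial set" where
  "monomials V = {m. Poly_Mapping.keys m \<subseteq> V}"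

text \<open>\<open>K[V]\<close>, as a set of complex polynomials in the variables \<open>V\<close>.\<close>

definition polys :: "complex set \<Rightarrow> 'v set \<Rightarrow> 'v cpoly set" where
  "polys K V = {p. Poly_Mapping.keys p \<subseteq> monomials V \<and> (\<forall>m. Poly_Mapping.lookup p m \<in> K)}"

definition poly_ring :: "'v set \<Rightarrow> 'v cpoly ring" where
  "poly_ring V = \<lparr>carrier = polys UNIV V, monoid.mult = (*), one = 1, zero = 0, add = (+)\<rparr>"

definition complex_ring :: "complex ring" where
  "complex_ring = \<lparr>carrier = UNIV, monoid.mult = (*), one = 1, zero = 0, add = (+)\<rparr>"

definition Const :: "complex \<Rightarrow> 'v cpoly" where
  "Const c = Poly_Mapping.single 0 c"

definition Var :: "'v \<Rightarrow> 'v cpoly" where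
  "Var v = Poly_Mapping.single (Poly_Mapping.single v 1) 1"

text \<open>Substitution of \<open>a\<close> for the variables, with \<open>h\<close> applied to the coefficients.\<close>

definition subst :: "(complex \<Rightarrow> 'r) \<Rightarrow> ('v \<Rightarrow> 'r) \<Rightarrow> 'v cpoly \<Rightarrow> 'r::comm_ring_1" where
  "subst h a p = (\<Sum>m\<in>Poly_Mapping.keys p.
     h (Poly_Mapping.lookup p m) * (\<Prod>v\<in>Poly_Mapping.keys m. a v ^ Poly_Mapping.lookup m v))"

definition eval :: "('v \<Rightarrow> complex) \<Rightarrow> 'v cpoly \<Rightarrow> complex" where
  "eval = subst id"

definition smult :: "complex \<Rightarrow> 'v cpoly \<Rightarrow> 'v cpoly" where
  "smult c = Poly_Mapping.map ((*) c)"

lemma lookup_smult [simp]: "Poly_Mapping.lookup (smult c p) m = c * Poly_Mapping.lookup p m"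
  by (simp add: smult_def Poly_Mapping.map.rep_eq when_def)

global_interpretation cpoly: vector_space "smult :: complex \<Rightarrow> 'v cpoly \<Rightarrow> 'v cpoly"
  by unfold_locales (auto intro!: poly_mapping_eqI simp: lookup_add algebra_simps)

text \<open>The classes of \<open>b 0, \<dots>, b (d - 1)\<close> form a basis of the vector space \<open>\<complex>[V]/Q\<close>.\<close>

definition quotient_basis :: "'v set \<Rightarrow> 'v cpoly set \<Rightarrow> nat \<Rightarrow> (nat \<Rightarrow> 'v cpoly) \<Rightarrow> bool" where
  "quotient_basis V Q d b \<longleftrightarrow>
     (\<forall>j<d. b j \<in> polys UNIV V) \<and>
     (\<forall>c. (\<Sum>j<d. smult (c j) (b j)) \<in> Q \<longrightarrow> (\<forall>j<d. c j = 0)) \<and>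
     (\<forall>p\<in>polys UNIV V. \<exists>c. p - (\<Sum>j<d. smult (c j) (b j)) \<in> Q)"

definition quotient_dim :: "'v set \<Rightarrow> 'v cpoly set \<Rightarrow> nat \<Rightarrow> bool" where
  "quotient_dim V Q d \<longleftrightarrow> (\<exists>b. quotient_basis V Q d b)"


section \<open>Isolated roots and their multiplicity\<close>

text \<open>Points of \<open>\<complex>\<^sup>V\<close> are functions in \<open>V \<rightarrow>\<^sub>E UNIV\<close>, with the product topology.\<close>

definition isolated_root :: "'v set \<Rightarrow> 'v cpoly set \<Rightarrow> ('v \<Rightarrow> complex) \<Rightarrow> bool" where
  "isolated_root V F a \<longleftrightarrow> a isolated_in {b \<in> V \<rightarrow>\<^sub>E UNIV. \<forall>p\<in>F. eval b p = 0}"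

definition max_ideal_at :: "'v set \<Rightarrow> ('v \<Rightarrow> complex) \<Rightarrow> 'v cpoly set" where
  "max_ideal_at V a = {p \<in> polys UNIV V. eval a p = 0}"

definition primary_component_at ::
    "'v set \<Rightarrow> 'v cpoly set \<Rightarrow> ('v \<Rightarrow> complex) \<Rightarrow> 'v cpoly set \<Rightarrow> bool" where
  "primary_component_at V F a Q \<longleftrightarrow>
     isolated_primary_component (poly_ring V) (Idl\<^bsub>poly_ring V\<^esub> F) (max_ideal_at V a) Q"

definition root_multiplicity :: "'v set \<Rightarrow> 'v cpoly set \<Rightarrow> ('v \<Rightarrow> complex) \<Rightarrow> nat \<Rightarrow> bool" where
  "root_multiplicity V F a d \<longleftrightarrow> (\<exists>Q. primary_component_at V F a Q \<and> quotient_dim V Q d)"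


section \<open>Differential functionals\<close>

definition mdeg :: "'v monomial \<Rightarrow> nat" where
  "mdeg m = (\<Sum>v\<in>Poly_Mapping.keys m. Poly_Mapping.lookup m v)"

definition mfact :: "'v monomial \<Rightarrow> complex" where
  "mfact m = (\<Prod>v\<in>Poly_Mapping.keys m. fact (Poly_Mapping.lookup m v))"

definition pdiff :: "'v \<Rightarrow> 'v cpoly \<Rightarrow> 'v cpoly" where
  "pdiff v p = (\<Sum>m\<in>Poly_Mapping.keys p. Poly_Mapping.single (m - Poly_Mapping.single v 1)
     (of_nat (Poly_Mapping.lookup m v) * Poly_Mapping.lookup p m))"

definition pdiffs :: "nat monomial \<Rightarrow> nat cpoly \<Rightarrow> nat cpoly" where
  "pdiffs \<beta> p = fold (\<lambda>i. pdiff i ^^ Poly_Mapping.lookup \<beta> i)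
     (sorted_list_of_set (Poly_Mapping.keys \<beta>)) p"

text \<open>
  A functional in \<open>\<complex>[\<partial>\<^sub>\<xi>]\<close> in \<open>n\<close> variables is represented by its coefficients in terms of the
  \<open>\<partial>\<^sub>\<xi>\<^sup>\<beta>\<close>, i.e. by an element of \<open>polys UNIV {..<n}\<close> in which the monomial \<open>\<beta>\<close> stands for \<open>\<partial>\<^sub>\<xi>\<^sup>\<beta>\<close>.
\<close>

definition apply_functional :: "(nat \<Rightarrow> complex) \<Rightarrow> nat cpoly \<Rightarrow> nat cpoly \<Rightarrow> complex" where
  "apply_functional \<xi> \<Lambda> p =
     (\<Sum>\<beta>\<in>Poly_Mapping.keys \<Lambda>. Poly_Mapping.lookup \<Lambda> \<beta> * eval \<xi> (pdiffs \<beta> p))"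

definition ord_functional :: "nat cpoly \<Rightarrow> nat" where
  "ord_functional \<Lambda> = Max (insert 0 (mdeg ` Poly_Mapping.keys \<Lambda>))"

definition dual_space :: "nat \<Rightarrow> (nat \<Rightarrow> complex) \<Rightarrow> nat cpoly set \<Rightarrow> nat cpoly set" where
  "dual_space n \<xi> Q = {\<Lambda> \<in> polys UNIV {..<n}. \<forall>q\<in>Q. apply_functional \<xi> \<Lambda> q = 0}"

definition shifted_monomial :: "nat \<Rightarrow> (nat \<Rightarrow> complex) \<Rightarrow> nat monomial \<Rightarrow> nat cpoly" where
  "shifted_monomial n \<xi> \<alpha> = (\<Prod>i<n. (Var i - Const (\<xi> i)) ^ Poly_Mapping.lookup \<alpha> i)"


section \<open>Orthogonal primal-dual basis pairs\<close>

definition connected_to_1 :: "nat \<Rightarrow> nat monomial set \<Rightarrow> bool" where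
  "connected_to_1 n E \<longleftrightarrow>
     (\<forall>\<alpha>\<in>E. \<alpha> \<noteq> 0 \<longrightarrow> (\<exists>\<alpha>'\<in>E. \<exists>i<n. \<alpha> = \<alpha>' + Poly_Mapping.single i 1))"

text \<open>
  \<open>\<alpha>\<close> gives the exponents of the primal basis, \<open>\<Lambda>\<close> is the dual basis and \<open>\<nu>\<close> its coefficients.
\<close>

definition orthogonal_pair ::
    "nat \<Rightarrow> (nat \<Rightarrow> complex) \<Rightarrow> nat cpoly set \<Rightarrow> nat \<Rightarrow> (nat \<Rightarrow> nat monomial) \<Rightarrow>
     (nat \<Rightarrow> nat cpoly) \<Rightarrow> (nat monomial \<Rightarrow> nat monomial \<Rightarrow> complex) \<Rightarrow> bool" where
  "orthogonal_pair n \<xi> Q \<delta> \<alpha> \<Lambda> \<nu> \<longleftrightarrow>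
     (let E = \<alpha> ` {..<\<delta>}; \<D> = dual_space n \<xi> Q in
       0 < \<delta> \<and> E \<subseteq> monomials {..<n} \<and>
       quotient_basis {..<n} Q \<delta> (\<lambda>j. shifted_monomial n \<xi> (\<alpha> j)) \<and>
       \<alpha> 0 = 0 \<and> connected_to_1 n E \<and>
       inj_on \<Lambda> {..<\<delta>} \<and> cpoly.independent (\<Lambda> ` {..<\<delta>}) \<and> cpoly.span (\<Lambda> ` {..<\<delta>}) = \<D> \<and>
       (\<forall>i<\<delta>. \<forall>j<\<delta>. apply_functional \<xi> (\<Lambda> i) (shifted_monomial n \<xi> (\<alpha> j)) = (if i = j then 1 else 0)) \<and>
       \<Lambda> 0 = Poly_Mapping.single 0 1 \<and>
       (\<forall>i<\<delta>. \<Lambda> i = Poly_Mapping.single (\<alpha> i) (1 / mfact (\<alpha> i)) +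
          (\<Sum>\<beta> | \<beta> \<in> monomials {..<n} \<and> mdeg \<beta> \<le> mdeg (\<alpha> i) \<and> \<beta> \<notin> E.
             Poly_Mapping.single \<beta> (\<nu> (\<alpha> i) \<beta> / mfact \<beta>))) \<and>
       (\<forall>i<\<delta>. \<forall>\<beta>\<in>monomials {..<n}. \<beta> \<notin> E \<and> mdeg \<beta> > mdeg (\<alpha> i) \<longrightarrow> \<nu> (\<alpha> i) \<beta> = 0) \<and>
       ord_functional (\<Lambda> 0) = 0 \<and>
       (\<forall>i j. i \<le> j \<and> j < \<delta> \<longrightarrow> ord_functional (\<Lambda> i) \<le> ord_functional (\<Lambda> j)) \<and>
       (\<forall>t \<le> Max (ord_functional ` \<D>).
          {\<Lambda>'\<in>\<D>. ord_functional \<Lambda>' \<le> t} =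
          cpoly.span {\<Lambda> j | j. j < \<delta> \<and> ord_functional (\<Lambda> j) \<le> t}))"


section \<open>The parametric system\<close>

text \<open>The variables \<open>z\<^sub>i\<close> and \<open>\<mu>\<^bsub>\<alpha>,\<beta>\<^esub>\<close>.\<close>

datatype pvar = Z nat | Mu "nat monomial" "nat monomial"

definition param_vars :: "nat \<Rightarrow> nat \<Rightarrow> (nat \<Rightarrow> nat monomial) \<Rightarrow> pvar set" where
  "param_vars n \<delta> \<alpha> = Z ` {..<n} \<union>
     {Mu (\<alpha> l) (\<alpha> k + Poly_Mapping.single i 1) | k l i.
        k < l \<and> l < \<delta> \<and> i < n \<and> \<alpha> k + Poly_Mapping.single i 1 \<notin> \<alpha> ` {..<\<delta>}}"

definition mult_matrix :: "nat \<Rightarrow> (nat \<Rightarrow> nat monomial) \<Rightarrow> nat \<Rightarrow> pvar cpoly mat" where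
  "mult_matrix \<delta> \<alpha> i = transpose_mat (mat \<delta> \<delta> (\<lambda>(k, l).
     let \<beta> = \<alpha> k + Poly_Mapping.single i 1 in
     if k \<ge> l then 0
     else if \<alpha> l = \<beta> then 1
     else if \<beta> \<in> \<alpha> ` {..<\<delta>} then 0
     else Var (Mu (\<alpha> l) \<beta>)))"

definition mult_matrix_power ::
    "nat \<Rightarrow> nat \<Rightarrow> (nat \<Rightarrow> nat monomial) \<Rightarrow> nat monomial \<Rightarrow> pvar cpoly mat" where
  "mult_matrix_power n \<delta> \<alpha> \<gamma> =
     foldr (\<lambda>i A. (mult_matrix \<delta> \<alpha> i ^\<^sub>m Poly_Mapping.lookup \<gamma> i) * A) [0..<n] (1\<^sub>m \<delta>)"

text \<open>The sum is restricted to its finitely many non-zero terms.\<close>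

definition param_normal_form ::
    "nat \<Rightarrow> nat \<Rightarrow> (nat \<Rightarrow> nat monomial) \<Rightarrow> nat cpoly \<Rightarrow> pvar cpoly vec" where
  "param_normal_form n \<delta> \<alpha> p = vec \<delta> (\<lambda>j.
     \<Sum>\<gamma> | \<gamma> \<in> monomials {..<n} \<and> pdiffs \<gamma> p \<noteq> 0.
       smult (1 / mfact \<gamma>) (subst Const (\<lambda>i. Var (Z i)) (pdiffs \<gamma> p)) *
       (mult_matrix_power n \<delta> \<alpha> \<gamma> *\<^sub>v unit_vec \<delta> 0) $ j)"

definition param_system ::
    "nat \<Rightarrow> nat \<Rightarrow> (nat \<Rightarrow> nat monomial) \<Rightarrow> nat \<Rightarrow> (nat \<Rightarrow> nat cpoly) \<Rightarrow> pvar cpoly set" where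
  "param_system n \<delta> \<alpha> N f =
     {param_normal_form n \<delta> \<alpha> (f k) $ j | k j. k < N \<and> j < \<delta>} \<union>
     {(mult_matrix \<delta> \<alpha> i * mult_matrix \<delta> \<alpha> j - mult_matrix \<delta> \<alpha> j * mult_matrix \<delta> \<alpha> i) $$ (r, c)
        | i j r c. i < n \<and> j < n \<and> r < \<delta> \<and> c < \<delta>}"

definition param_point ::
    "nat \<Rightarrow> nat \<Rightarrow> (nat \<Rightarrow> nat monomial) \<Rightarrow> (nat \<Rightarrow> complex) \<Rightarrow>
     (nat monomial \<Rightarrow> nat monomial \<Rightarrow> complex) \<Rightarrow> pvar \<Rightarrow> complex" where
  "param_point n \<delta> \<alpha> \<xi> \<nu> = restrict (case_pvar \<xi> \<nu>) (param_vars n \<delta> \<alpha>)"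

end

theory Submission
  imports Defs "HOL-Algebra.Ring_Divisibility"
begin

text \<open>
  Write \<open>a = (\<xi>, \<nu>)\<close> for the point, \<open>I\<close> for the ideal of the system and \<open>m\<close> for the maximal ideal
  of \<open>a\<close>.  Whenever the indeterminates \<open>(z, \<mu>)\<close> are specialised to a commutative ring \<open>R\<close> in such a
  way that the matrices \<open>M\<^sub>i\<close> commute, the free module over \<open>R\<close> of rank \<open>\<delta>\<close> is a module over the
  polynomials, \<open>x\<^sub>i\<close> acting as \<open>z\<^sub>i + M\<^sub>i\<close>, and the normal form \<open>N(p)\<close> is \<open>p\<close> applied to the first unit
  vector (\<open>nf_Var_mult\<close>, a consequence of the Leibniz rule).

  \<^emph>\<open>The point is a root.\<close>  At \<open>a\<close> the matrix \<open>M\<^sub>i\<close> is the matrix \<open>A\<^sub>i\<close> of multiplication by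
  \<open>x\<^sub>i - \<xi>\<^sub>i\<close> on \<open>\<complex>[x]/Q\<close> in the basis \<open>B\<close>: the entries of the latter are the values of the dual basis at
  the products \<open>(x\<^sub>i - \<xi>\<^sub>i) b\<^sub>k\<close>, and the orders of the dual basis force the triangular shape
  (\<open>A_eq\<close>).  So the matrices commute, and \<open>N(p)\<close> is the coordinate vector of \<open>p\<close> modulo \<open>Q\<close>
  (\<open>normal_form_at_pt\<close>), which is zero for the given polynomials.

  \<^emph>\<open>There are no tangent vectors.\<close>  A tangent vector \<open>t\<close> is a root \<open>a + \<epsilon> t\<close> over the dual numbers.
  There the matrices are \<open>A\<^sub>i + \<epsilon> A'\<^sub>i\<close> and the normal form is \<open>N + \<epsilon> N'\<close>.  It kills the ideal of
  the \<open>f\<^sub>k\<close>.  It even kills \<open>Q\<close>, since \<open>s Q\<close> lies in that ideal for some \<open>s\<close> with \<open>s(\<xi>) \<noteq> 0\<close> and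
  \<open>s\<close> acts on the module as an invertible triangular matrix (\<open>tg_nf_Q\<close>).  Hence \<open>N'\<close> is given by a
  matrix \<open>T\<close> on \<open>\<complex>[x]/Q\<close>, and the \<open>\<epsilon>\<close>-part of the multiplication rule reads
  \<open>T A\<^sub>i = t\<^sub>i + A\<^sub>i T + A'\<^sub>i\<close>, where \<open>t\<^sub>i\<close> is the component of \<open>t\<close> at \<open>z\<^sub>i\<close> (\<open>T_equation\<close>).  Taking
  traces gives \<open>\<delta> t\<^sub>i = 0\<close>, because \<open>A'\<^sub>i\<close> is strictly triangular (\<open>t_Z\<close>).  The first column of \<open>T\<close> is
  zero, and connectedness of \<open>B\<close> to \<open>1\<close> carries this over to the other columns (\<open>T_0\<close>).  Then
  \<open>A'\<^sub>i = 0\<close>, which says that the components of \<open>t\<close> at the \<open>\<mu>\<close> vanish as well.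

  \<^emph>\<open>A root without tangent vectors is isolated and simple.\<close>  The absence of tangent vectors means
  \<open>m = I + m\<^sup>2\<close>, so by Nakayama's lemma there is an \<open>s\<close> with \<open>s(a) \<noteq> 0\<close> and \<open>s m \<subseteq> I\<close>
  (\<open>exists_denominator\<close>).  Where \<open>s\<close> does not vanish, \<open>a\<close> is the only root.  For the multiplicity a
  minimal primary decomposition of \<open>I\<close> is needed; it exists because the polynomials in finitely
  many variables form a Noetherian ring.  A component contained in \<open>m\<close> contains \<open>m\<close>, again because
  of \<open>s\<close>, so that \<open>m\<close> itself is the component at \<open>a\<close>, and its codimension is \<open>1\<close>.
\<close>


section \<open>Monomials\<close>

lemma keys_add_nat:
  "Poly_Mapping.keys (m + m' :: 'v monomial) = Poly_Mapping.keys m \<union> Poly_Mapping.keys m'"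
  by (auto simp: in_keys_iff lookup_add)

lemma mdeg_superset:
  assumes "finite S" "Poly_Mapping.keys m \<subseteq> S"
  shows "mdeg m = (\<Sum>v\<in>S. Poly_Mapping.lookup m v)"
  unfolding mdeg_def
  by (rule sum.mono_neutral_left) (use assms in \<open>auto simp: in_keys_iff\<close>)

lemma mdeg_add: "mdeg (m + m') = mdeg m + mdeg m'"
proof -
  let ?S = "Poly_Mapping.keys m \<union> Poly_Mapping.keys m'"
  have "mdeg (m + m') = (\<Sum>v\<in>?S. Poly_Mapping.lookup (m + m') v)"
    by (rule mdeg_superset) (simp_all add: keys_add_nat)
  also have "\<dots> = (\<Sum>v\<in>?S. Poly_Mapping.lookup m v) + (\<Sum>v\<in>?S. Poly_Mapping.lookup m' v)"
    by (simp add: lookup_add sum.distrib)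
  also have "\<dots> = mdeg m + mdeg m'"
    by (subst (1 2) mdeg_superset[of ?S]) simp_all
  finally show ?thesis .
qed

lemma mdeg_single [simp]: "mdeg (Poly_Mapping.single v k) = k"
  by (cases "k = 0") (simp_all add: mdeg_def)

lemma lookup_le_mdeg: "Poly_Mapping.lookup m v \<le> mdeg m"
proof (cases "v \<in> Poly_Mapping.keys m")
  case True
  then show ?thesis unfolding mdeg_def by (intro member_le_sum) simp_all
qed (simp add: in_keys_iff)

lemma minus_single_add:
  "Poly_Mapping.lookup m v \<noteq> 0 \<Longrightarrow> m - Poly_Mapping.single v 1 + Poly_Mapping.single v (1::nat) = m"
  by (rule poly_mapping_eqI) (auto simp: lookup_add lookup_minus lookup_single when_def)

lemma monomial_induct [consumes 1, case_names 0 add_single]: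
  assumes "m \<in> monomials V" "P 0"
    "\<And>m v. m \<in> monomials V \<Longrightarrow> v \<in> V \<Longrightarrow> P m \<Longrightarrow> P (m + Poly_Mapping.single v 1)"
  shows "P m"
  using assms(1)
proof (induction "mdeg m" arbitrary: m)
  case 0
  then have "m = 0"
    using lookup_le_mdeg[of m] by (intro poly_mapping_eqI) simp
  with assms(2) show ?case by simp
next
  case (Suc d)
  then have "m \<noteq> 0" by (auto simp: mdeg_def)
  then obtain v where v: "v \<in> Poly_Mapping.keys m" by fastforce
  define m' where "m' = m - Poly_Mapping.single v 1"
  have m: "m' + Poly_Mapping.single v 1 = m"
    using v unfolding m'_def by (intro minus_single_add) (simp add: in_keys_iff)
  have "v \<in> V" using v Suc.prems by (auto simp: monomials_def)
  moreover have "m' \<in> monomials V"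
    using Suc.prems by (auto simp: monomials_def keys_add_nat simp flip: m)
  moreover have "d = mdeg m'" using Suc.hyps(2) mdeg_add[of m' "Poly_Mapping.single v 1"] unfolding m by simp
  ultimately show ?case using assms(3)[of m' v] Suc.hyps(1)[of m'] unfolding m by simp
qed

section \<open>Polynomial rings and substitutions\<close>

definition meval :: "('v \<Rightarrow> 'r) \<Rightarrow> 'v monomial \<Rightarrow> 'r::comm_ring_1" where
  "meval a m = (\<Prod>v\<in>Poly_Mapping.keys m. a v ^ Poly_Mapping.lookup m v)"

lemma meval_superset:
  assumes "finite S" "Poly_Mapping.keys m \<subseteq> S"
  shows "meval a m = (\<Prod>v\<in>S. a v ^ Poly_Mapping.lookup m v)"
  unfolding meval_def
  by (rule prod.mono_neutral_left) (use assms in \<open>auto simp: in_keys_iff\<close>)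

lemma meval_add: "meval a (m + m') = meval a m * meval a m'"
proof -
  let ?S = "Poly_Mapping.keys m \<union> Poly_Mapping.keys m'"
  have S: "finite ?S" by simp
  show ?thesis
    unfolding meval_superset[OF S, of m] meval_superset[OF S, of m', simplified]
      meval_superset[OF S, of "m + m'", unfolded keys_add_nat, simplified]
    by (subst meval_superset[OF S]) (auto simp: lookup_add power_add prod.distrib)
qed

lemma meval_single [simp]: "meval a (Poly_Mapping.single v k) = a v ^ k"
  by (cases "k = 0") (auto simp: meval_def)

lemma meval_0 [simp]: "meval a 0 = 1"
  by (simp add: meval_def)

lemma poly_mapping_sum_single:
  assumes "finite S" "Poly_Mapping.keys p \<subseteq> S"
  shows "p = (\<Sum>m\<in>S. Poly_Mapping.single m (Poly_Mapping.lookup p m))"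
proof (rule poly_mapping_eqI)
  fix k
  show "Poly_Mapping.lookup p k = Poly_Mapping.lookup (\<Sum>m\<in>S. Poly_Mapping.single m (Poly_Mapping.lookup p m)) k"
    using assms by (cases "k \<in> S") (auto simp: lookup_sum lookup_single when_def in_keys_iff)
qed

lemma times_sum_single:
  fixes p q :: "'v cpoly"
  shows "p * q = (\<Sum>m\<in>Poly_Mapping.keys p. \<Sum>m'\<in>Poly_Mapping.keys q.
    Poly_Mapping.single (m + m') (Poly_Mapping.lookup p m * Poly_Mapping.lookup q m'))"
  by (subst poly_mapping_sum_single[of "Poly_Mapping.keys p" p], simp, simp,
      subst poly_mapping_sum_single[of "Poly_Mapping.keys q" q], simp, simp)
     (simp add: sum_product mult_single)

lemma monomials_sum: "finite V \<Longrightarrow> m \<in> monomials V \<Longrightarrow>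
    m = (\<Sum>v\<in>V. Poly_Mapping.single v (Poly_Mapping.lookup m v))"
  using poly_mapping_sum_single[of V m] by (auto simp: monomials_def)

context
  fixes h :: "complex \<Rightarrow> 'r::comm_ring_1"
  assumes h: "comm_ring_hom h"
begin

interpretation h: comm_ring_hom h by (rule h)

lemma subst_superset:
  assumes "finite S" "Poly_Mapping.keys p \<subseteq> S"
  shows "subst h a p = (\<Sum>m\<in>S. h (Poly_Mapping.lookup p m) * meval a m)"
  unfolding subst_def meval_def
  by (rule sum.mono_neutral_left) (use assms in \<open>auto simp: in_keys_iff\<close>)

lemma subst_single: "subst h a (Poly_Mapping.single m c) = h c * meval a m"
  by (subst subst_superset[of "{m}"]) auto

lemma subst_add: "subst h a (p + q) = subst h a p + subst h a q"
proof -
  let ?S = "Poly_Mapping.keys p \<union> Poly_Mapping.keys q"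
  have "Poly_Mapping.keys (p + q) \<subseteq> ?S" by (rule keys_add)
  then show ?thesis
    by (simp add: subst_superset[of ?S] lookup_add h.hom_add algebra_simps sum.distrib)
qed

lemma subst_zero: "subst h a 0 = 0"
  by (simp add: subst_def)

lemma subst_sum: "subst h a (sum g A) = (\<Sum>x\<in>A. subst h a (g x))"
  by (induction A rule: infinite_finite_induct) (simp_all add: subst_zero subst_add)

lemma subst_mult: "subst h a (p * q) = subst h a p * subst h a q"
  by (simp only: times_sum_single[of p q] subst_sum subst_single h.hom_mult meval_add)
     (simp add: subst_def sum_product mult_ac flip: meval_def)

lemma subst_hom: "comm_ring_hom (subst h a)"
proof unfold_locales
  show "subst h a 1 = 1" by (simp flip: single_one add: subst_single)
qed (auto simp: subst_add subst_zero subst_mult)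

lemma subst_Const [simp]: "subst h a (Const c) = h c"
  by (simp add: Const_def subst_single)

lemma subst_Var [simp]: "subst h a (Var v) = a v"
  by (simp add: Var_def subst_single)

lemma subst_smult [simp]: "subst h a (smult c p) = h c * subst h a p"
  by (subst (1 2) subst_superset[of "Poly_Mapping.keys p"])
     (auto simp: in_keys_iff h.hom_mult sum_distrib_left mult_ac)

end

lemma hom_subst:
  assumes "comm_ring_hom g"
  shows "g (subst h a p) = subst (g \<circ> h) (g \<circ> a) p"
proof -
  interpret comm_ring_hom g by fact
  show ?thesis by (simp add: subst_def hom_distribs)
qed

lemma comm_ring_hom_id: "comm_ring_hom (id :: 'r::comm_ring_1 \<Rightarrow> 'r)"
  by unfold_locales auto

global_interpretation eval: comm_ring_hom "eval a :: 'v cpoly \<Rightarrow> complex"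
  unfolding eval_def by (rule subst_hom[OF comm_ring_hom_id])

lemma eval_Const [simp]: "eval a (Const c) = c"
  and eval_Var [simp]: "eval a (Var v) = a v"
  and eval_smult [simp]: "eval a (smult c p) = c * eval a p"
  by (simp_all add: eval_def comm_ring_hom_id)

lemma Const_hom: "comm_ring_hom Const"
  by unfold_locales (simp_all add: Const_def single_add mult_single)

global_interpretation Const: comm_ring_hom "Const :: complex \<Rightarrow> 'v cpoly"
  by (rule Const_hom)

lemma smult_conv_mult: "smult c p = Const c * p"
  by (simp add: smult_def Const_def mult_map_scale_conv_mult)

lemma mult_smult_left [simp]: "smult c p * q = smult c (p * q)"
  and mult_smult_right [simp]: "p * smult c q = smult c (p * q)"
  by (simp_all add: smult_conv_mult mult_ac)


subsection \<open>The polynomials with coefficients in a subring\<close>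

lemma ring_complex_ring: "ring complex_ring"
  by (rule ringI) (auto simp: complex_ring_def algebra_simps
      intro!: abelian_groupI monoidI exI[of _ "- x" for x])

lemma subring_complexD:
  assumes "subring K complex_ring"
  shows "0 \<in> K" "1 \<in> K" "x \<in> K \<Longrightarrow> y \<in> K \<Longrightarrow> x + y \<in> K" "x \<in> K \<Longrightarrow> y \<in> K \<Longrightarrow> x * y \<in> K"
    "x \<in> K \<Longrightarrow> - x \<in> K"
proof -
  interpret ring complex_ring by (rule ring_complex_ring)
  show "0 \<in> K" "1 \<in> K" "x \<in> K \<Longrightarrow> y \<in> K \<Longrightarrow> x + y \<in> K" "x \<in> K \<Longrightarrow> y \<in> K \<Longrightarrow> x * y \<in> K"
    using subringE[OF assms] by (auto simp: complex_ring_def)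
  show "- x \<in> K" if "x \<in> K"
  proof -
    have "\<ominus>\<^bsub>complex_ring\<^esub> x = - x"
      using minus_equality[of "- x" x] by (simp add: complex_ring_def)
    then show ?thesis using subringE(5)[OF assms that] by simp
  qed
qed

lemma subring_complex_UNIV: "subring UNIV complex_ring"
proof -
  interpret ring complex_ring by (rule ring_complex_ring)
  show ?thesis using carrier_is_subring by (simp add: complex_ring_def)
qed

context
  fixes K :: "complex set" and V :: "'v set"
  assumes K: "subring K complex_ring"
begin

lemma polys_zero: "0 \<in> polys K V"
  using subring_complexD[OF K] by (auto simp: polys_def)

lemma polys_single: "m \<in> monomials V \<Longrightarrow> c \<in> K \<Longrightarrow> Poly_Mapping.single m c \<in> polys K V"
  using subring_complexD(1)[OF K] by (auto simp: polys_def lookup_single when_def split: if_splits)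

lemma polys_add: "p \<in> polys K V \<Longrightarrow> q \<in> polys K V \<Longrightarrow> p + q \<in> polys K V"
  using keys_add[of p q] subring_complexD(3)[OF K] by (auto simp: polys_def lookup_add)

lemma polys_uminus: "p \<in> polys K V \<Longrightarrow> - p \<in> polys K V"
  using subring_complexD(5)[OF K] by (auto simp: polys_def in_keys_iff)

lemma polys_diff: "p \<in> polys K V \<Longrightarrow> q \<in> polys K V \<Longrightarrow> p - q \<in> polys K V"
  using polys_add[of p "- q"] polys_uminus[of q] by simp

lemma polys_sum: "(\<And>x. x \<in> A \<Longrightarrow> g x \<in> polys K V) \<Longrightarrow> sum g A \<in> polys K V"
  by (induction A rule: infinite_finite_induct) (simp_all add: polys_zero polys_add)

lemma polys_mult:
  assumes "p \<in> polys K V" "q \<in> polys K V"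
  shows "p * q \<in> polys K V"
  unfolding times_sum_single[of p q] using assms subring_complexD(4)[OF K]
  by (intro polys_sum polys_single) (auto simp: polys_def monomials_def keys_add_nat subset_iff)

lemma polys_Const: "c \<in> K \<Longrightarrow> Const c \<in> polys K V"
  by (simp add: Const_def polys_single monomials_def)

lemma polys_one: "1 \<in> polys K V"
  using polys_Const[of 1] subring_complexD(2)[OF K] by simp

lemma polys_Var: "v \<in> V \<Longrightarrow> Var v \<in> polys K V"
  unfolding Var_def using subring_complexD(2)[OF K] by (auto intro: polys_single simp: monomials_def)

lemma polys_smult: "c \<in> K \<Longrightarrow> p \<in> polys K V \<Longrightarrow> smult c p \<in> polys K V"
  unfolding smult_conv_mult by (intro polys_mult polys_Const)

lemma polys_prod: "(\<And>x. x \<in> A \<Longrightarrow> g x \<in> polys K V) \<Longrightarrow> prod g A \<in> polys K V"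
  by (induction A rule: infinite_finite_induct) (simp_all add: polys_one polys_mult)

lemma polys_power: "p \<in> polys K V \<Longrightarrow> p ^ k \<in> polys K V"
  by (induction k) (simp_all add: polys_one polys_mult)

lemmas polys_closed = polys_zero polys_one polys_add polys_uminus polys_diff polys_sum polys_mult
  polys_Const polys_Var polys_smult polys_prod polys_power

end

lemmas cpolys_closed = polys_closed[OF subring_complex_UNIV, simplified]

lemma polys_mono: "K \<subseteq> K' \<Longrightarrow> polys K V \<subseteq> polys K' V"
  by (auto simp: polys_def)

lemma polys_induct [consumes 1, case_names Const add Var]:
  assumes p: "p \<in> polys UNIV V"
    and C: "\<And>c. P (Const c)"
    and A: "\<And>p q. p \<in> polys UNIV V \<Longrightarrow> q \<in> polys UNIV V \<Longrightarrow> P p \<Longrightarrow> P q \<Longrightarrow> P (p + q)"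
    and X: "\<And>v p. v \<in> V \<Longrightarrow> p \<in> polys UNIV V \<Longrightarrow> P p \<Longrightarrow> P (Var v * p)"
  shows "P p"
proof -
  have single: "P (Poly_Mapping.single m c)" if "m \<in> monomials V" for m c
    using that
  proof (induction rule: monomial_induct)
    case 0
    show ?case using C[of c] by (simp add: Const_def)
  next
    case (add_single m v)
    then have "P (Var v * Poly_Mapping.single m c)"
      using X[OF _ polys_single[OF subring_complex_UNIV]] by simp
    then show ?case by (simp add: Var_def mult_single add.commute)
  qed
  have "S \<subseteq> monomials V \<Longrightarrow> (\<Sum>m\<in>S. Poly_Mapping.single m (Poly_Mapping.lookup p m)) \<in> polys UNIV V \<and>
      P (\<Sum>m\<in>S. Poly_Mapping.single m (Poly_Mapping.lookup p m))" if "finite S" for S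
    using that
  proof induction
    case empty
    then show ?case using C[of 0] cpolys_closed(1) by simp
  next
    case (insert m S)
    then show ?case using A single polys_single[OF subring_complex_UNIV, of m V]
      by (auto intro: polys_add[OF subring_complex_UNIV])
  qed
  from this[of "Poly_Mapping.keys p"] show ?thesis
    using p poly_mapping_sum_single[of "Poly_Mapping.keys p" p] by (auto simp: polys_def)
qed


section \<open>Primary decompositions in commutative Noetherian rings\<close>

locale noetherian_cring = noetherian_ring R + cring R for R (structure)
begin

text \<open>
  The maximal condition, which takes the place of induction along ascending chains of ideals.
\<close>

lemma maximal_ideal_in:
  assumes "S \<noteq> {}" "S \<subseteq> {I. ideal I R}"
  obtains M where "M \<in> S" "\<And>I. I \<in> S \<Longrightarrow> M \<subseteq> I \<Longrightarrow> I = M"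
proof -
  have "\<exists>M\<in>S. \<forall>X\<in>S. M \<subseteq> X \<longrightarrow> X = M"
  proof (rule subset_Zorn_nonempty[OF assms(1)])
    fix C assume C: "C \<noteq> {}" "subset.chain S C"
    then have "subset.chain {I. ideal I R} C"
      using assms(2) by (auto simp: pred_on.chain_def)
    then show "\<Union>C \<in> S"
      using ideal_chain_is_trivial[OF C(1)] C(2) by (auto simp: pred_on.chain_def)
  qed
  then show ?thesis using that by blast
qed

lemma colon_ideal:
  assumes I: "ideal I R" and c: "c \<in> carrier R"
  shows "ideal {x \<in> carrier R. x \<otimes> c \<in> I} R"
proof -
  interpret I: ideal I R by (rule I)
  show ?thesis
  proof (intro idealI)
    show "subgroup {x \<in> carrier R. x \<otimes> c \<in> I} (add_monoid R)"
      using c I.a_inv_closed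
      by unfold_locales (auto simp: l_distr l_minus simp flip: a_inv_def)
    fix a x assume a: "a \<in> {x \<in> carrier R. x \<otimes> c \<in> I}" and x: "x \<in> carrier R"
    have "x \<otimes> a \<otimes> c = x \<otimes> (a \<otimes> c)" using a x c by (simp add: m_assoc)
    then show "x \<otimes> a \<in> {x \<in> carrier R. x \<otimes> c \<in> I}"
      using a x c I.I_l_closed by auto
    then show "a \<otimes> x \<in> {x \<in> carrier R. x \<otimes> c \<in> I}"
      using a x by (simp add: m_comm)
  qed (rule ring_axioms)
qed

lemma mem_add_cgenideal:
  assumes "ideal I R" "c \<in> carrier R"
  shows "x \<in> I <+>\<^bsub>R\<^esub> PIdl c \<longleftrightarrow> (\<exists>i\<in>I. \<exists>r\<in>carrier R. x = i \<oplus> r \<otimes> c)"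
  by (auto simp: set_add_def' cgenideal_def)

text \<open>
  Let \<open>a b \<in> I\<close> where neither \<open>a\<close> nor a power of \<open>b\<close> is in \<open>I\<close>.  The colon ideals \<open>(I : b\<^sup>k)\<close> increase with \<open>k\<close> and
  therefore become stationary.  For such a \<open>k\<close> the ideals \<open>I + (a)\<close> and \<open>I + (b\<^sup>k)\<close> meet in \<open>I\<close>: if
  \<open>x = i + r a = j + s b\<^sup>k\<close>, then \<open>x b \<in> I\<close>, hence \<open>s b\<^sup>k b \<in> I\<close>, hence already \<open>s b\<^sup>k \<in> I\<close>.
\<close>

lemma nonprimary_imp_intersection:
  assumes I: "ideal I R" "I \<noteq> carrier R" "\<not> primary_ideal R I"
  obtains J1 J2 where "ideal J1 R" "ideal J2 R" "I \<subset> J1" "I \<subset> J2" "I = J1 \<inter> J2"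
proof -
  interpret I: ideal I R by (rule I(1))
  obtain a b where ab: "a \<in> carrier R" "b \<in> carrier R" "a \<otimes> b \<in> I" "a \<notin> I" "b \<notin> radical R I"
    using I by (auto simp: primary_ideal_def)
  define C where "C k = {x \<in> carrier R. x \<otimes> b [^] k \<in> I}" for k :: nat
  obtain M where M: "M \<in> range C" "\<And>J. J \<in> range C \<Longrightarrow> M \<subseteq> J \<Longrightarrow> J = M"
    by (rule maximal_ideal_in[of "range C"]) (auto simp: C_def intro!: colon_ideal I ab)
  then obtain k where k: "M = C k" by auto
  have "C k \<subseteq> C (Suc k)"
    using ab I.I_r_closed by (auto simp: C_def m_assoc[symmetric])
  with M k have stable: "C (Suc k) = C k" by blast
  let ?c = "b [^] k"
  have c: "?c \<in> carrier R" using ab by simp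
  have cI: "?c \<notin> I" using ab by (auto simp: radical_def)
  let ?J1 = "I <+>\<^bsub>R\<^esub> PIdl a" and ?J2 = "I <+>\<^bsub>R\<^esub> PIdl ?c"
  have J: "ideal ?J1 R" "ideal ?J2 R"
    using ab c by (auto intro!: add_ideals I cgenideal_ideal)
  have "i \<in> I <+>\<^bsub>R\<^esub> PIdl d" if "i \<in> I" "d \<in> carrier R" for i d
    unfolding mem_add_cgenideal[OF I(1) that(2)]
    by (rule bexI[OF _ that(1)], rule bexI[of _ \<zero>]) (use that in auto)
  then have sub: "I \<subseteq> ?J1" "I \<subseteq> ?J2" using ab c by auto
  have "d \<in> I <+>\<^bsub>R\<^esub> PIdl d" if "d \<in> carrier R" for d
    unfolding mem_add_cgenideal[OF I(1) that]
    by (rule bexI[of _ \<zero>], rule bexI[of _ \<one>]) (use that in auto)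
  then have "a \<in> ?J1" "?c \<in> ?J2" using ab c by auto
  with sub ab cI have strict: "I \<subset> ?J1" "I \<subset> ?J2" by auto
  have "x \<in> I" if x1: "x \<in> ?J1" and x2: "x \<in> ?J2" for x
  proof -
    obtain i r where i: "i \<in> I" "r \<in> carrier R" "x = i \<oplus> r \<otimes> a"
      using x1 unfolding mem_add_cgenideal[OF I(1) ab(1)] by blast
    obtain j s where j: "j \<in> I" "s \<in> carrier R" "x = j \<oplus> s \<otimes> ?c"
      using x2 unfolding mem_add_cgenideal[OF I(1) c] by blast
    note cl = i(2) j(2) ab(1,2) c I.Icarr[OF i(1)] I.Icarr[OF j(1)]
    have "x \<otimes> b = i \<otimes> b \<oplus> r \<otimes> (a \<otimes> b)"
      using cl by (simp add: i(3) l_distr m_assoc)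
    also have "\<dots> \<in> I" using i ab I.I_r_closed I.I_l_closed I.a_closed by simp
    finally have xb: "x \<otimes> b \<in> I" .
    have "x \<otimes> b = j \<otimes> b \<oplus> s \<otimes> b [^] Suc k"
      using cl by (simp add: j(3) l_distr m_assoc)
    then have "s \<otimes> b [^] Suc k = x \<otimes> b \<ominus> j \<otimes> b"
      using cl by (simp add: a_minus_def a_comm r_neg1 r_neg2)
    also have "\<dots> \<in> I" using xb j ab I.I_r_closed I.a_closed I.a_inv_closed by (simp add: a_minus_def)
    finally have "s \<in> C (Suc k)" using j by (simp add: C_def)
    then have "s \<otimes> ?c \<in> I" unfolding stable by (simp add: C_def)
    then show ?thesis using j I.a_closed by simp
  qed
  then have "I = ?J1 \<inter> ?J2" using sub by auto
  then show ?thesis using that J strict by blast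
qed

text \<open>
  An ideal that is maximal among those without a decomposition would be the intersection of two
  larger ideals, and these have one.
\<close>

lemma exists_primary_decomposition:
  assumes "ideal I R"
  shows "\<exists>\<Q>. finite \<Q> \<and> (\<forall>Q\<in>\<Q>. primary_ideal R Q) \<and> I = carrier R \<inter> \<Inter>\<Q>"
proof (rule ccontr)
  define dec where "dec I \<longleftrightarrow> (\<exists>\<Q>. finite \<Q> \<and> (\<forall>Q\<in>\<Q>. primary_ideal R Q) \<and> I = carrier R \<inter> \<Inter>\<Q>)" for I
  assume "\<not> ?thesis"
  then have "{J. ideal J R \<and> \<not> dec J} \<noteq> {}" using assms by (auto simp: dec_def)
  then obtain M where M: "ideal M R" "\<not> dec M" and max: "\<And>J. ideal J R \<Longrightarrow> M \<subset> J \<Longrightarrow> dec J"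
    by (rule maximal_ideal_in) auto
  interpret M: ideal M R by (rule M(1))
  have "M \<noteq> carrier R" using M(2) unfolding dec_def by (metis Inf_empty finite.emptyI empty_iff inf_top.right_neutral)
  moreover have "\<not> primary_ideal R M"
  proof
    assume "primary_ideal R M"
    moreover have "M = carrier R \<inter> \<Inter>{M}" using M.a_subset by auto
    ultimately show False using M(2) unfolding dec_def by (metis finite.simps singletonD)
  qed
  ultimately obtain J1 J2 where J: "ideal J1 R" "ideal J2 R" "M \<subset> J1" "M \<subset> J2" "M = J1 \<inter> J2"
    using nonprimary_imp_intersection[OF M(1)] by blast
  then obtain \<Q>1 \<Q>2 where "finite \<Q>1" "\<forall>Q\<in>\<Q>1. primary_ideal R Q" "J1 = carrier R \<inter> \<Inter>\<Q>1"
    "finite \<Q>2" "\<forall>Q\<in>\<Q>2. primary_ideal R Q" "J2 = carrier R \<inter> \<Inter>\<Q>2"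
    using max unfolding dec_def by metis
  then have "dec M" unfolding dec_def J(5) by (intro exI[of _ "\<Q>1 \<union> \<Q>2"]) auto
  with M(2) show False ..
qed

lemma radical_Int:
  assumes "ideal I R" "ideal J R"
  shows "radical R (I \<inter> J) = radical R I \<inter> radical R J"
proof -
  have "x \<in> radical R (I \<inter> J)" if x: "x \<in> radical R I" "x \<in> radical R J" for x
  proof -
    obtain k l :: nat where "x [^] k \<in> I" "x [^] l \<in> J" "x \<in> carrier R"
      using x by (auto simp: radical_def)
    then have "x [^] (k + l) \<in> I" "x [^] (k + l) \<in> J"
      using ideal.I_r_closed[OF assms(1)] ideal.I_l_closed[OF assms(2)]
      by (simp_all flip: nat_pow_mult)
    then show ?thesis using \<open>x \<in> carrier R\<close> by (auto simp: radical_def)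
  qed
  then show ?thesis by (auto simp: radical_def)
qed

lemma primary_ideal_Int:
  assumes "primary_ideal R I" "primary_ideal R J" "radical R I = radical R J"
  shows "primary_ideal R (I \<inter> J)"
proof -
  have id: "ideal I R" "ideal J R" using assms by (auto simp: primary_ideal_def)
  have ne: "I \<noteq> carrier R" and sub: "I \<subseteq> carrier R"
    using assms(1) additive_subgroup.a_subset[OF ideal.axioms(1)[OF id(1)]]
    by (auto simp: primary_ideal_def)
  have rad: "radical R (I \<inter> J) = radical R I" "radical R (I \<inter> J) = radical R J"
    using radical_Int[OF id] assms(3) by simp_all
  show ?thesis
    unfolding primary_ideal_def
  proof (intro conjI ballI impI)
    show "ideal (I \<inter> J) R" by (rule i_intersect[OF id])
    show "I \<inter> J \<noteq> carrier R" using ne sub by auto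
    fix a b assume ab: "a \<in> carrier R" "b \<in> carrier R" "a \<otimes> b \<in> I \<inter> J"
    have "a \<in> I \<or> b \<in> radical R I"
      using assms(1) ab by (auto simp: primary_ideal_def)
    moreover have "a \<in> J \<or> b \<in> radical R J"
      using assms(2) ab by (auto simp: primary_ideal_def)
    ultimately show "a \<in> I \<inter> J \<or> b \<in> radical R (I \<inter> J)"
      using rad by auto
  qed
qed

text \<open>
  A decomposition with the least number of components is minimal: two components with the same
  radical could be replaced by their intersection, and a redundant component could be dropped.
\<close>

theorem exists_minimal_primary_decomposition:
  assumes "ideal I R"
  shows "\<exists>\<Q>. minimal_primary_decomposition R I \<Q>"
proof -
  define dec where "dec \<Q> \<longleftrightarrow> finite \<Q> \<and> (\<forall>Q\<in>\<Q>. primary_ideal R Q) \<and> I = carrier R \<inter> \<Inter>\<Q>" for \<Q>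
  have "\<exists>\<Q>. dec \<Q>" using exists_primary_decomposition[OF assms] by (simp add: dec_def)
  then obtain \<Q> where \<Q>: "dec \<Q>" and min: "\<And>\<Q>'. dec \<Q>' \<Longrightarrow> card \<Q> \<le> card \<Q>'"
    using ex_has_least_nat[of dec _ card] by blast
  have fin: "finite \<Q>" and prim: "\<And>Q. Q \<in> \<Q> \<Longrightarrow> primary_ideal R Q" and I: "I = carrier R \<inter> \<Inter>\<Q>"
    using \<Q> by (simp_all add: dec_def)
  have inj: "inj_on (radical R) \<Q>"
  proof (rule inj_onI, rule ccontr)
    fix Q Q' assume Q: "Q \<in> \<Q>" "Q' \<in> \<Q>" "radical R Q = radical R Q'" "Q \<noteq> Q'"
    have "\<Inter>\<Q> = \<Inter>(insert (Q \<inter> Q') (\<Q> - {Q, Q'}))"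
      using Q(1,2) by auto
    moreover have "primary_ideal R (Q \<inter> Q')"
      using primary_ideal_Int[OF prim[OF Q(1)] prim[OF Q(2)] Q(3)] .
    ultimately have "dec (insert (Q \<inter> Q') (\<Q> - {Q, Q'}))"
      unfolding dec_def using fin prim I by simp
    from min[OF this] have "card \<Q> \<le> Suc (card (\<Q> - {Q, Q'}))"
      using fin by (simp add: card_insert_if split: if_splits)
    moreover have "card (\<Q> - {Q, Q'}) = card \<Q> - 2"
      using Q fin by (simp add: card_Diff_subset)
    moreover have "card \<Q> \<ge> 2"
      using Q fin card_mono[of \<Q> "{Q, Q'}"] by simp
    ultimately show False by simp
  qed
  have irred: "I \<noteq> carrier R \<inter> \<Inter>(\<Q> - {Q})" if "Q \<in> \<Q>" for Q
  proof
    assume "I = carrier R \<inter> \<Inter>(\<Q> - {Q})"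
    then have "dec (\<Q> - {Q})" unfolding dec_def using fin prim by simp
    from min[OF this] show False using card_Diff1_less[OF fin that] by simp
  qed
  show ?thesis
    unfolding minimal_primary_decomposition_def
    using fin prim I inj irred by (intro exI[of _ \<Q>] conjI ballI) auto
qed

end


section \<open>Polynomial rings in finitely many variables are Noetherian\<close>

text \<open>
  One coordinate at a time: a sequence of natural numbers has a monotone subsequence, and if this
  is decreasing, it is constant from the place on where it attains its minimum.
\<close>

lemma dickson_sequence:
  fixes f :: "nat \<Rightarrow> 'v \<Rightarrow> nat"
  assumes "finite V"
  shows "\<exists>r. strict_mono (r :: nat \<Rightarrow> nat) \<and> (\<forall>v\<in>V. \<forall>i j. i \<le> j \<longrightarrow> f (r i) v \<le> f (r j) v)"
  using assms
proof induction
  case empty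
  show ?case by (intro exI[of _ id]) (auto simp: strict_mono_def)
next
  case (insert u V)
  from insert.IH obtain r where "strict_mono (r :: nat \<Rightarrow> nat) \<and> (\<forall>v\<in>V. \<forall>i j. i \<le> j \<longrightarrow> f (r i) v \<le> f (r j) v)" ..
  note r = conjunct1[OF this] conjunct2[OF this]
  obtain s where "strict_mono (s :: nat \<Rightarrow> nat) \<and> monoseq (\<lambda>i. f (r (s i)) u)"
    using seq_monosub[of "\<lambda>i. f (r i) u"] ..
  note s = conjunct1[OF this] conjunct2[OF this]
  have "\<exists>s'. strict_mono (s' :: nat \<Rightarrow> nat) \<and> (\<forall>i j. i \<le> j \<longrightarrow> f (r (s' i)) u \<le> f (r (s' j)) u)"
  proof (cases "incseq (\<lambda>i. f (r (s i)) u)")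
    case True
    then show ?thesis using s(1) by (intro exI[of _ s]) (simp add: incseq_def)
  next
    case False
    then have dec: "f (r (s j)) u \<le> f (r (s i)) u" if "i \<le> j" for i j
      using s(2) that unfolding monoseq_iff by (simp add: decseq_def)
    define i0 where "i0 = arg_min (\<lambda>i. f (r (s i)) u) (\<lambda>_. True)"
    have i0: "f (r (s i0)) u \<le> f (r (s j)) u" for j
      unfolding i0_def by (rule arg_min_nat_le) simp
    have "f (r (s (i0 + j))) u = f (r (s i0)) u" for j
      using dec[of i0 "i0 + j"] i0[of "i0 + j"] by simp
    moreover have "strict_mono (\<lambda>j. s (i0 + j))"
      using s(1) by (simp add: strict_mono_def)
    ultimately show ?thesis
      by (intro exI[of _ "\<lambda>j. s (i0 + j)"]) simp
  qed
  then obtain s' where "strict_mono (s' :: nat \<Rightarrow> nat) \<and> (\<forall>i j. i \<le> j \<longrightarrow> f (r (s' i)) u \<le> f (r (s' j)) u)" ..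
  note s' = conjunct1[OF this] conjunct2[OF this, rule_format]
  show ?case
  proof (intro exI[of _ "r \<circ> s'"] conjI ballI allI impI)
    show "strict_mono (r \<circ> s')" using r s' by (simp add: strict_mono_o)
    fix v and i j :: nat assume "v \<in> insert u V" "i \<le> j"
    then show "f ((r \<circ> s') i) v \<le> f ((r \<circ> s') j) v"
      using r(2) s'(2)[of i j] strict_mono_less_eq[OF s'(1), of i j] by auto
  qed
qed

text \<open>
  Dickson's lemma.  If no finite \<open>G\<close> works, one can choose a sequence in \<open>S\<close> none of whose elements is
  a multiple of an earlier one; but \<open>dickson_sequence\<close> finds two comparable elements in it.
\<close>

lemma dickson:
  fixes S :: "'v monomial set"
  assumes V: "finite V" and S: "S \<subseteq> monomials V"
  shows "\<exists>G. finite G \<and> G \<subseteq> S \<and> (\<forall>m\<in>S. \<exists>g\<in>G. \<exists>d. m = g + d)"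
proof (rule ccontr)
  assume nex: "\<not> ?thesis"
  have ex: "\<exists>m. m \<in> S \<and> (\<forall>g\<in>G. \<forall>d. m \<noteq> g + d)" if "finite G" "G \<subseteq> S" for G
  proof (rule ccontr)
    assume "\<not> ?thesis"
    then have "\<forall>m\<in>S. \<exists>g\<in>G. \<exists>d. m = g + d" by simp
    with that have "\<exists>G. finite G \<and> G \<subseteq> S \<and> (\<forall>m\<in>S. \<exists>g\<in>G. \<exists>d. m = g + d)"
      by (intro exI[of _ G] conjI)
    with nex show False ..
  qed
  define pick where "pick G = (SOME m. m \<in> S \<and> (\<forall>g\<in>G. \<forall>d. m \<noteq> g + d))" for G
  have pick: "pick G \<in> S \<and> (\<forall>g\<in>G. \<forall>d. pick G \<noteq> g + d)" if "finite G" "G \<subseteq> S" for G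
    unfolding pick_def by (rule someI_ex[OF ex[OF that]])
  define F where "F = rec_nat {} (\<lambda>_ G. insert (pick G) G)"
  have F: "finite (F i)" "F i \<subseteq> S" for i
    by (induction i) (simp_all add: F_def pick)
  have mono: "i \<le> j \<Longrightarrow> F i \<subseteq> F j" for i j
    by (induction rule: dec_induct) (auto simp: F_def)
  have pickF: "pick (F i) \<in> F j" if "i < j" for i j
    using mono[of "Suc i" j] that by (auto simp: F_def)
  obtain r where "strict_mono (r :: nat \<Rightarrow> nat) \<and> (\<forall>v\<in>V. \<forall>i j. i \<le> j \<longrightarrow>
      Poly_Mapping.lookup (pick (F (r i))) v \<le> Poly_Mapping.lookup (pick (F (r j))) v)"
    using dickson_sequence[OF V, of "\<lambda>i. Poly_Mapping.lookup (pick (F i))"] ..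
  note r = conjunct1[OF this] conjunct2[OF this]
  let ?m = "pick (F (r 0))" and ?m' = "pick (F (r 1))"
  have "?m \<in> monomials V" using pick[OF F] S by blast
  then have m0: "Poly_Mapping.lookup ?m v = 0" if "v \<notin> V" for v
    using that by (auto simp: monomials_def in_keys_iff)
  have le: "Poly_Mapping.lookup ?m v \<le> Poly_Mapping.lookup ?m' v" for v
  proof (cases "v \<in> V")
    case True
    from r(2)[rule_format, OF this, of 0 1] show ?thesis by simp
  qed (simp add: m0)
  have "?m' = ?m + (?m' - ?m)"
    using le by (intro poly_mapping_eqI) (simp add: lookup_add lookup_minus)
  moreover have "?m \<in> F (r 1)" using r(1) by (intro pickF) (simp add: strict_mono_def)
  then have "\<forall>d. ?m' \<noteq> ?m + d" using pick[OF F, of "r 1"] by simp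
  ultimately show False by simp
qed

subsection \<open>Leading monomials\<close>

definition lexvec :: "'v list \<Rightarrow> 'v monomial \<Rightarrow> nat list" where
  "lexvec vs m = map (Poly_Mapping.lookup m) vs"

text \<open>
  The lexicographic order for an enumeration \<open>vs\<close> of the variables.  It is well-founded because
  \<open>lex\<close> relates only lists of the same length.
\<close>

definition lexless :: "'v list \<Rightarrow> ('v monomial \<times> 'v monomial) set" where
  "lexless vs = inv_image (lex less_than) (lexvec vs)"

lemma wf_lexless: "wf (lexless vs)"
  unfolding lexless_def by (intro wf_inv_image wf_lex wf_less_than)

lemma trans_lexless: "trans (lexless vs)"
  unfolding lexless_def by (intro trans_inv_image lex_transI trans_less_than)

lemma lexless_total:
  assumes "m \<in> monomials (set vs)" "m' \<in> monomials (set vs)" "m \<noteq> m'"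
  shows "(m, m') \<in> lexless vs \<or> (m', m) \<in> lexless vs"
proof -
  have "lexvec vs m \<noteq> lexvec vs m'"
  proof
    assume "lexvec vs m = lexvec vs m'"
    then have "m = m'"
      using monomials_sum[of "set vs" m] monomials_sum[of "set vs" m'] assms
      by (simp add: lexvec_def cong: sum.cong)
    with assms(3) show False ..
  qed
  then have "(lexvec vs m, lexvec vs m') \<in> lenlex less_than \<or> (lexvec vs m', lexvec vs m) \<in> lenlex less_than"
    using total_lenlex[OF total_less_than] by (meson UNIV_I total_on_def)
  then show ?thesis
    by (auto simp: lenlex_conv lexvec_def lexless_def)
qed

lemma lexless_add: "(m, m') \<in> lexless vs \<Longrightarrow> (m + d, m' + d) \<in> lexless vs"
proof (induction vs)
  case Nil
  then show ?case by (simp add: lexless_def lexvec_def)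
next
  case (Cons v vs)
  then show ?case by (auto simp: lexless_def lexvec_def lookup_add)
qed

lemma lexless_max:
  assumes "finite A" "A \<noteq> {}" "A \<subseteq> monomials (set vs)"
  shows "\<exists>m\<in>A. \<forall>m'\<in>A. m' \<noteq> m \<longrightarrow> (m', m) \<in> lexless vs"
  using assms
proof (induction rule: finite_ne_induct)
  case (insert x A)
  then obtain m where m: "m \<in> A" "\<forall>m'\<in>A. m' \<noteq> m \<longrightarrow> (m', m) \<in> lexless vs" by auto
  show ?case
  proof (cases "(x, m) \<in> lexless vs")
    case True
    then show ?thesis using m by auto
  next
    case False
    then have "(m, x) \<in> lexless vs" 
      using lexless_total[of x vs m] insert m by auto
    then show ?thesis using m trans_lexless[of vs] by (auto dest: transD)
  qed
qed simp

definition leading :: "'v list \<Rightarrow> 'v cpoly \<Rightarrow> 'v monomial \<Rightarrow> bool" where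
  "leading vs p m \<longleftrightarrow> m \<in> Poly_Mapping.keys p \<and>
     (\<forall>m'\<in>Poly_Mapping.keys p. m' \<noteq> m \<longrightarrow> (m', m) \<in> lexless vs)"

lemma exists_leading:
  assumes "p \<in> polys K (set vs)" "p \<noteq> 0"
  obtains m where "leading vs p m"
  using lexless_max[of "Poly_Mapping.keys p" vs] assms by (auto simp: polys_def leading_def)

subsection \<open>The ring of polynomials\<close>

lemma poly_ring_simps [simp]:
  "carrier (poly_ring V) = polys UNIV V" "monoid.mult (poly_ring V) = (*)" "one (poly_ring V) = 1"
  "zero (poly_ring V) = 0" "add (poly_ring V) = (+)"
  by (simp_all add: poly_ring_def)

lemma cring_poly_ring: "cring (poly_ring V)"
proof (rule cringI)
  show "abelian_group (poly_ring V)"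
    by (rule abelian_groupI)
      (auto simp: cpolys_closed algebra_simps intro!: bexI[of _ "- x" for x])
  show "comm_monoid (poly_ring V)"
    by (rule comm_monoidI) (auto simp: cpolys_closed algebra_simps)
qed (simp add: algebra_simps)

lemma poly_ring_nat_pow [simp]: "p [^]\<^bsub>poly_ring V\<^esub> (k::nat) = p ^ k"
  by (induction k) (simp_all add: nat_pow_def mult.commute)

text \<open>
  Ideals are handled through these closure conditions, in the ring operations of the type of
  polynomials.
\<close>

lemma ideal_poly_ring_iff:
  "ideal I (poly_ring V) \<longleftrightarrow> I \<subseteq> polys UNIV V \<and> 0 \<in> I \<and> (\<forall>p\<in>I. \<forall>q\<in>I. p + q \<in> I) \<and>
     (\<forall>p\<in>I. \<forall>r\<in>polys UNIV V. r * p \<in> I)"  (is "?L \<longleftrightarrow> ?R")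
proof
  assume ?L
  then have "additive_subgroup I (poly_ring V)" by (rule ideal.axioms(1))
  from additive_subgroup.a_subset[OF this] additive_subgroup.zero_closed[OF this]
    additive_subgroup.a_closed[OF this] ideal.I_l_closed[OF \<open>?L\<close>]
  show ?R by simp
next
  assume R: ?R
  interpret cring "poly_ring V" by (rule cring_poly_ring)
  have neg: "- p \<in> I" if "p \<in> I" for p
  proof -
    have "Const (-1) * p \<in> I" using R that cpolys_closed(8) by blast
    then show ?thesis by (simp add: Const.hom_uminus)
  qed
  have inv: "inv\<^bsub>add_monoid (poly_ring V)\<^esub> p = - p" if "p \<in> I" for p
    using minus_equality[of "- p" p] that R by (simp add: cpolys_closed a_inv_def subset_iff)
  show ?L
  proof (rule idealI)
    show "subgroup I (add_monoid (poly_ring V))"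
    proof
      fix p assume "p \<in> I"
      then show "inv\<^bsub>add_monoid (poly_ring V)\<^esub> p \<in> I"
        using inv neg by simp
    qed (use R in auto)
  qed (use R ring_axioms in \<open>auto simp: mult.commute\<close>)
qed

lemma idealD_poly_ring:
  assumes "ideal I (poly_ring V)"
  shows "p \<in> I \<Longrightarrow> p \<in> polys UNIV V" "0 \<in> I" "p \<in> I \<Longrightarrow> q \<in> I \<Longrightarrow> p + q \<in> I"
    "p \<in> I \<Longrightarrow> r \<in> polys UNIV V \<Longrightarrow> r * p \<in> I" "p \<in> I \<Longrightarrow> - p \<in> I"
    "p \<in> I \<Longrightarrow> q \<in> I \<Longrightarrow> p - q \<in> I" "(\<And>x. x \<in> A \<Longrightarrow> g x \<in> I) \<Longrightarrow> sum g A \<in> I"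
    "p \<in> I \<Longrightarrow> smult c p \<in> I"
proof -
  note * = assms[unfolded ideal_poly_ring_iff]
  show 1: "p \<in> I \<Longrightarrow> p \<in> polys UNIV V" for p using * by blast
  show 2: "0 \<in> I" "p \<in> I \<Longrightarrow> q \<in> I \<Longrightarrow> p + q \<in> I"  "p \<in> I \<Longrightarrow> r \<in> polys UNIV V \<Longrightarrow> r * p \<in> I" for p q r
    using * by auto
  show 3: "smult c p \<in> I" if "p \<in> I" for c p
    unfolding smult_conv_mult using 2(3)[OF that] cpolys_closed(8) by blast
  show 4: "- p \<in> I" if "p \<in> I" for p using 3[OF that, of "-1"] by (simp add: smult_conv_mult Const.hom_uminus)
  show "p \<in> I \<Longrightarrow> q \<in> I \<Longrightarrow> p - q \<in> I" using 2(2)[of p "- q"] 4 by simp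
  show "(\<And>x. x \<in> A \<Longrightarrow> g x \<in> I) \<Longrightarrow> sum g A \<in> I"
    by (induction A rule: infinite_finite_induct) (use 2 in auto)
qed

text \<open>
  By Dickson's lemma an ideal \<open>I\<close> contains a finite set \<open>b ` G\<close> such that the leading monomial of every
  non-zero element of \<open>I\<close> is a multiple of the leading monomial of some \<open>b g\<close>.  Subtracting a suitable
  multiple of \<open>b g\<close> cancels the leading term, and well-founded induction on the leading monomial
  shows that the \<open>b g\<close> generate \<open>I\<close>.
\<close>

theorem noetherian_poly_ring:
  fixes V :: "'v set"
  assumes "finite V"
  shows "noetherian_ring (poly_ring V)"
proof -
  interpret cring "poly_ring V" by (rule cring_poly_ring)
  obtain vs where vs: "set vs = V" using assms finite_list by blast
  show ?thesis
  proof (rule noetherian_ringI)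
    fix I assume I: "ideal I (poly_ring V)"
    note ID = idealD_poly_ring[OF I]
    define S where "S = {m. \<exists>p\<in>I. leading vs p m}"
    have "m \<in> monomials V" if "m \<in> S" for m
    proof -
      obtain p where "p \<in> I" "leading vs p m" using \<open>m \<in> S\<close> by (auto simp: S_def)
      then show ?thesis using ID(1)[of p] by (auto simp: leading_def polys_def)
    qed
    then have "S \<subseteq> monomials V" by (rule subsetI)
    then obtain G where "finite G \<and> G \<subseteq> S \<and> (\<forall>m\<in>S. \<exists>g\<in>G. \<exists>d. m = g + d)"
      using dickson[OF assms, of S] by (rule_tac exE)
    then have G: "finite G" "G \<subseteq> S" "\<forall>m\<in>S. \<exists>g\<in>G. \<exists>d. m = g + d" by simp_all
    define b where "b g = (SOME p. p \<in> I \<and> leading vs p g)" for g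
    have b: "b g \<in> I \<and> leading vs (b g) g" if "g \<in> G" for g
    proof -
      have "\<exists>p. p \<in> I \<and> leading vs p g" using G(2) that by (auto simp: S_def)
      then show ?thesis unfolding b_def by (rule someI_ex)
    qed
    let ?A = "b ` G"
    have A: "?A \<subseteq> I" using b by auto
    have AV: "?A \<subseteq> carrier (poly_ring V)" using A ID(1) by auto
    have J: "ideal (Idl\<^bsub>poly_ring V\<^esub> ?A) (poly_ring V)" using genideal_ideal[OF AV] .
    note JD = idealD_poly_ring[OF J]
    have bJ: "b g \<in> Idl\<^bsub>poly_ring V\<^esub> ?A" if "g \<in> G" for g
      using genideal_self[OF AV] that by auto
    have red: "p \<in> I \<Longrightarrow> leading vs p m \<Longrightarrow> p \<in> Idl\<^bsub>poly_ring V\<^esub> ?A" for m p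
    proof (induction m arbitrary: p rule: wf_induct_rule[OF wf_lexless[of vs]])
      case (1 m)
      then have mS: "m \<in> S" by (auto simp: S_def)
      then obtain g d where gd: "g \<in> G" "m = g + d" using G(3) by blast
      note bg = b[OF gd(1)]
      \<comment> \<open>The term \<open>t\<close> is chosen such that \<open>p\<close> and \<open>t * b g\<close> have the same leading term.\<close>
      define c where "c = Poly_Mapping.lookup p m / Poly_Mapping.lookup (b g) g"
      define t where "t = Poly_Mapping.single d c"
      have lb: "Poly_Mapping.lookup (b g) g \<noteq> 0" using bg by (auto simp: leading_def in_keys_iff)
      have "m \<in> monomials V" using mS \<open>S \<subseteq> monomials V\<close> by auto
      then have "d \<in> monomials V" by (auto simp: gd monomials_def keys_add_nat)
      then have tV: "t \<in> polys UNIV V"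
        using polys_single[OF subring_complex_UNIV] by (simp add: t_def)
      have tb: "t * b g = (\<Sum>m'\<in>Poly_Mapping.keys (b g). Poly_Mapping.single (d + m') (c * Poly_Mapping.lookup (b g) m'))"
        by (subst poly_mapping_sum_single[of "Poly_Mapping.keys (b g)" "b g"])
           (auto simp: t_def sum_distrib_left mult_single)
      have ltb: "Poly_Mapping.lookup (t * b g) m = Poly_Mapping.lookup p m"
        using bg lb by (simp add: tb lookup_sum lookup_single when_def gd c_def add.commute[of d] leading_def)
      have ktb: "m' = m \<or> (m', m) \<in> lexless vs" if "m' \<in> Poly_Mapping.keys (t * b g)" for m'
      proof -
        have "m' \<in> (\<Union>m'\<in>Poly_Mapping.keys (b g). Poly_Mapping.keys (Poly_Mapping.single (d + m') (c * Poly_Mapping.lookup (b g) m')))"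
          using that keys_sum[of _ "Poly_Mapping.keys (b g)"] unfolding tb by (rule_tac subsetD)
        then obtain e where e: "e \<in> Poly_Mapping.keys (b g)" "m' = e + d"
          by (auto split: if_splits simp: add.commute)
        then show ?thesis using bg lexless_add[of e g vs d] by (auto simp: leading_def gd)
      qed
      define q where "q = p - t * b g"
      have qI: "q \<in> I" using 1 ID bg tV by (simp add: q_def)
      have qk: "(m', m) \<in> lexless vs" if "m' \<in> Poly_Mapping.keys q" for m'
      proof -
        have "m' \<noteq> m" using that ltb by (auto simp: q_def in_keys_iff lookup_minus)
        moreover have "m' \<in> Poly_Mapping.keys p \<union> Poly_Mapping.keys (t * b g)"
          using that by (auto simp: q_def in_keys_iff lookup_minus)
        ultimately show ?thesis using ktb 1(3) by (auto simp: leading_def)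
      qed
      have "q \<in> Idl\<^bsub>poly_ring V\<^esub> ?A"
      proof (cases "q = 0")
        case True
        then show ?thesis using JD(2) by simp
      next
        case False
        then obtain m' where m': "leading vs q m'"
          using exists_leading[of q UNIV vs] ID(1)[OF qI] vs by auto
        then have "(m', m) \<in> lexless vs" using qk by (auto simp: leading_def)
        then show ?thesis using 1(1) qI m' by blast
      qed
      from JD(3)[OF this JD(4)[OF bJ[OF gd(1)] tV]] show ?case by (simp add: q_def)
    qed
    have "I \<subseteq> Idl\<^bsub>poly_ring V\<^esub> ?A"
    proof
      fix p assume p: "p \<in> I"
      show "p \<in> Idl\<^bsub>poly_ring V\<^esub> ?A"
      proof (cases "p = 0")
        case True
        then show ?thesis using JD(2) by simp
      next
        case False
        then show ?thesis using red[OF p] exists_leading[of p UNIV vs] ID(1)[OF p] vs by auto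
      qed
    qed
    moreover have "Idl\<^bsub>poly_ring V\<^esub> ?A \<subseteq> I" using genideal_minimal[OF I] A by simp
    ultimately show "\<exists>A\<subseteq>carrier (poly_ring V). finite A \<and> I = Idl\<^bsub>poly_ring V\<^esub> A"
      using AV G(1) by blast
  qed
qed


section \<open>Roots without tangent vectors are isolated and simple\<close>

text \<open>
  Dual numbers \<open>u + \<epsilon> v\<close> with \<open>\<epsilon>\<^sup>2 = 0\<close>.  A ring homomorphism from the polynomials to the dual
  numbers that fixes the constants is a point together with a tangent vector at it.
\<close>

datatype dual = Dual (std: complex) (eps: complex)

instantiation dual :: comm_ring_1
begin

definition "0 = Dual 0 0"
definition "1 = Dual 1 0"
definition "x + y = Dual (std x + std y) (eps x + eps y)"
definition "x - y = Dual (std x - std y) (eps x - eps y)"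
definition "- x = Dual (- std x) (- eps x)"
definition "x * y = Dual (std x * std y) (std x * eps y + eps x * std y)"

instance
  by standard (simp_all add: zero_dual_def one_dual_def plus_dual_def minus_dual_def
      uminus_dual_def times_dual_def algebra_simps)

end

lemma dual_simps [simp]:
  "std 0 = 0" "eps 0 = 0" "std 1 = 1" "eps 1 = 0"
  "std (x + y) = std x + std y" "eps (x + y) = eps x + eps y"
  "std (x - y) = std x - std y" "eps (x - y) = eps x - eps y"
  "std (- x) = - std x" "eps (- x) = - eps x"
  "std (x * y) = std x * std y" "eps (x * y) = std x * eps y + eps x * std y"
  by (simp_all add: zero_dual_def one_dual_def plus_dual_def minus_dual_def
      uminus_dual_def times_dual_def)

lemma eps_sum [simp]: "eps (sum g A) = (\<Sum>x\<in>A. eps (g x))"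
  by (induction A rule: infinite_finite_induct) simp_all

lemma std_hom: "comm_ring_hom std"
  by unfold_locales simp_all

lemma std_sum [simp]: "std (sum g A) = (\<Sum>x\<in>A. std (g x))"
  by (induction A rule: infinite_finite_induct) simp_all

definition const_dual :: "complex \<Rightarrow> dual" where
  "const_dual c = Dual c 0"

lemma const_dual_sel [simp]: "std (const_dual c) = c" "eps (const_dual c) = 0"
  by (simp_all add: const_dual_def)

lemma const_dual_hom: "comm_ring_hom const_dual"
  by unfold_locales (simp_all add: dual.expand)

text \<open>
  Evaluation at \<open>a + \<epsilon> t\<close>; the \<open>\<epsilon>\<close>-part is the derivative at \<open>a\<close> in the direction \<open>t\<close>.
\<close>

definition tangent_eval :: "('v \<Rightarrow> complex) \<Rightarrow> ('v \<Rightarrow> complex) \<Rightarrow> 'v cpoly \<Rightarrow> dual" where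
  "tangent_eval a t = subst const_dual (\<lambda>v. Dual (a v) (t v))"

lemma tangent_eval_hom: "comm_ring_hom (tangent_eval a t)"
  unfolding tangent_eval_def by (rule subst_hom[OF const_dual_hom])

lemma tangent_eval_Const [simp]: "tangent_eval a t (Const c) = const_dual c"
  and tangent_eval_Var [simp]: "tangent_eval a t (Var v) = Dual (a v) (t v)"
  by (simp_all add: tangent_eval_def const_dual_hom)

lemma std_tangent_eval [simp]: "std (tangent_eval a t p) = eval a p"
  unfolding tangent_eval_def hom_subst[OF std_hom] eval_def by (simp add: o_def id_def)

lemma ideal_max_ideal_at: "ideal (max_ideal_at V a) (poly_ring V)"
  unfolding ideal_poly_ring_iff max_ideal_at_def
  by (auto simp: cpolys_closed eval.hom_add eval.hom_mult)

text \<open>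
  The assumption \<open>no_tangent\<close> says that the Jacobian matrix of \<open>F\<close> at \<open>a\<close> has a trivial kernel; in this
  form no derivatives of the elements of \<open>F\<close> have to be computed.
\<close>

locale root_without_tangents =
  fixes V :: "'v set" and F :: "'v cpoly set" and a :: "'v \<Rightarrow> complex"
  assumes finite_V: "finite V" and F_polys: "F \<subseteq> polys UNIV V"
    and point: "a \<in> V \<rightarrow>\<^sub>E UNIV" and root: "\<And>p. p \<in> F \<Longrightarrow> eval a p = 0"
    and no_tangent: "\<And>t v. (\<And>p. p \<in> F \<Longrightarrow> tangent_eval a t p = 0) \<Longrightarrow> v \<in> V \<Longrightarrow> t v = 0"
begin

sublocale R: cring "poly_ring V" by (rule cring_poly_ring)

abbreviation "\<I> \<equiv> Idl\<^bsub>poly_ring V\<^esub> F"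

definition y :: "'v \<Rightarrow> 'v cpoly" where "y v = Var v - Const (a v)"

lemma ideal_I: "ideal \<I> (poly_ring V)"
  using R.genideal_ideal[of F] F_polys by simp

lemmas I = idealD_poly_ring[OF ideal_I]
lemmas m = idealD_poly_ring[OF ideal_max_ideal_at[of V a]]

lemma F_subset_I: "F \<subseteq> \<I>"
  using R.genideal_self[of F] F_polys by simp

lemma eval_y [simp]: "eval b (y v) = b v - a v"
  by (simp add: y_def eval.hom_minus)

lemma y_polys: "v \<in> V \<Longrightarrow> y v \<in> polys UNIV V"
  by (simp add: y_def cpolys_closed)

lemma y_max_ideal: "v \<in> V \<Longrightarrow> y v \<in> max_ideal_at V a"
  by (simp add: max_ideal_at_def y_polys)

lemma eval_ideal:
  assumes "\<And>p. p \<in> F \<Longrightarrow> eval b p = 0" "p \<in> \<I>"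
  shows "eval b p = 0"
proof -
  have "\<I> \<subseteq> max_ideal_at V b"
    by (rule R.genideal_minimal[OF ideal_max_ideal_at])
       (use assms F_polys in \<open>auto simp: max_ideal_at_def\<close>)
  then show ?thesis using assms(2) by (auto simp: max_ideal_at_def)
qed

text \<open>
  The sum of \<open>\<I>\<close> and the square of the maximal ideal.
\<close>

definition S :: "'v cpoly set" where
  "S = {i + (\<Sum>w\<in>V. c w * y w) | i c. i \<in> \<I> \<and> (\<forall>w. c w \<in> max_ideal_at V a)}"

lemma subspace_S: "cpoly.subspace S"
  unfolding cpoly.subspace_def
proof (intro conjI ballI allI)
  show "0 \<in> S"
    unfolding S_def mem_Collect_eq
    by (rule exI[of _ 0], rule exI[of _ "\<lambda>_. 0"]) (simp add: I m)
next
  fix p q assume "p \<in> S" "q \<in> S"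
  then obtain i c j d where
    "p = i + (\<Sum>w\<in>V. c w * y w)" "i \<in> \<I>" "\<forall>w. c w \<in> max_ideal_at V a"
    "q = j + (\<Sum>w\<in>V. d w * y w)" "j \<in> \<I>" "\<forall>w. d w \<in> max_ideal_at V a"
    by (auto simp: S_def)
  then show "p + q \<in> S"
    unfolding S_def mem_Collect_eq
    by (intro exI[of _ "i + j"] exI[of _ "\<lambda>w. c w + d w"])
       (simp add: I m algebra_simps sum.distrib)
next
  fix k p assume "p \<in> S"
  then obtain i c where "p = i + (\<Sum>w\<in>V. c w * y w)" "i \<in> \<I>" "\<forall>w. c w \<in> max_ideal_at V a"
    by (auto simp: S_def)
  then show "smult k p \<in> S"
    unfolding S_def mem_Collect_eq
    by (intro exI[of _ "smult k i"] exI[of _ "\<lambda>w. smult k (c w)"])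
       (simp add: I m cpoly.scale_right_distrib cpoly.scale_sum_right)
qed

lemma I_subset_S: "\<I> \<subseteq> S"
proof
  fix p assume "p \<in> \<I>"
  then show "p \<in> S"
    unfolding S_def mem_Collect_eq
    by (intro exI[of _ p] exI[of _ "\<lambda>_. 0"]) (simp add: m)
qed

lemma mult_y_S:
  assumes "c \<in> max_ideal_at V a" "v \<in> V"
  shows "c * y v \<in> S"
  unfolding S_def mem_Collect_eq
  by (rule exI[of _ 0], rule exI[of _ "\<lambda>w. if w = v then c else 0"])
     (use assms finite_V in \<open>simp add: I m if_distrib[of "\<lambda>c. c * _"] cong: if_cong\<close>)

text \<open>
  Otherwise some linear functional \<open>D\<close> vanishes on \<open>S\<close> but not at \<open>y v\<close>.  As \<open>S\<close> contains the square of
  the maximal ideal, \<open>p \<mapsto> D (p - p(a))\<close> is a derivation at \<open>a\<close>, hence the derivative in the direction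
  \<open>t w = D (y w)\<close>.  As \<open>S\<close> contains \<open>F\<close>, this \<open>t\<close> is a tangent vector, and \<open>t v \<noteq> 0\<close>.
\<close>

lemma y_in_S:
  assumes v: "v \<in> V"
  shows "y v \<in> S"
proof (rule ccontr)
  assume yS: "y v \<notin> S"
  interpret vp: vector_space_pair "smult :: complex \<Rightarrow> 'v cpoly \<Rightarrow> 'v cpoly" "(*) :: complex \<Rightarrow> complex \<Rightarrow> complex"
    by unfold_locales (simp_all add: algebra_simps)
  obtain B where B: "B \<subseteq> S" "cpoly.independent B" "S \<subseteq> cpoly.span B"
    by (rule cpoly.maximal_independent_subset)
  have spanB: "cpoly.span B = S"
    using B cpoly.span_minimal[OF B(1) subspace_S] by blast
  have "cpoly.independent (insert (y v) B)"
    using yS B(2) by (intro cpoly.independent_insertI) (simp_all add: spanB)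
  from vp.linear_independent_extend[OF this, of "\<lambda>b. if b = y v then 1 else 0"]
  obtain D where D: "Vector_Spaces.linear smult (*) D"
    and D_basis: "\<forall>b\<in>insert (y v) B. D b = (if b = y v then 1 else 0)" by blast
  have "D b = 0" if "b \<in> B" for b
    using D_basis that yS B(1) by auto
  then have D_S: "D p = 0" if "p \<in> S" for p
    using vp.linear_eq_0_on_span[OF D, of B p] that spanB by auto
  note D_add = vp.linear_add[OF D] and D_smult = vp.linear_scale[OF D]
  define t where "t w = D (y w)" for w
  interpret T: comm_ring_hom "tangent_eval a t" by (rule tangent_eval_hom)
  have deriv: "eps (tangent_eval a t p) = D (p - Const (eval a p))" if "p \<in> polys UNIV V" for p
    using that
  proof (induction rule: polys_induct)
    case (Const c)
    then show ?case using D_S[of 0] cpoly.subspace_0[OF subspace_S] by simp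
  next
    case (add p q)
    have "p + q - Const (eval a (p + q)) = (p - Const (eval a p)) + (q - Const (eval a q))"
      by (simp add: eval.hom_add Const.hom_add)
    then have "D (p + q - Const (eval a (p + q))) = D (p - Const (eval a p)) + D (q - Const (eval a q))"
      by (simp only: D_add)
    then show ?case
      using add by (simp add: T.hom_add)
  next
    case (Var w p)
    have eq: "Var w * p - Const (eval a (Var w * p)) =
        (p - Const (eval a p)) * y w + smult (a w) (p - Const (eval a p)) + smult (eval a p) (y w)"
      by (simp add: y_def smult_conv_mult eval.hom_mult Const.hom_mult algebra_simps)
    have "p - Const (eval a p) \<in> max_ideal_at V a"
      using Var by (simp add: max_ideal_at_def cpolys_closed eval.hom_minus)
    then have "D ((p - Const (eval a p)) * y w) = 0"
      using mult_y_S Var D_S by blast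
    then have "D (Var w * p - Const (eval a (Var w * p))) =
        a w * D (p - Const (eval a p)) + eval a p * t w"
      unfolding eq by (simp add: D_add D_smult t_def)
    then show ?case using Var.IH by (simp add: T.hom_mult)
  qed
  have "tangent_eval a t p = 0" if "p \<in> F" for p
  proof (rule dual.expand, intro conjI)
    show "std (tangent_eval a t p) = std 0" using root[OF that] by simp
    have "D p = 0" using that F_subset_I I_subset_S D_S by blast
    then show "eps (tangent_eval a t p) = eps 0"
      using deriv[of p] that F_polys root[OF that] by auto
  qed
  from no_tangent[OF this v] D_basis show False by (simp add: t_def)
qed

text \<open>
  Nakayama's lemma, eliminating one generator of the maximal ideal at a time.  Multiplying the
  relation of \<open>y_in_S\<close> for \<open>y u\<close> by \<open>s\<close> and inserting the relations found so far yields a relation in which the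
  coefficient \<open>d u\<close> of \<open>y u\<close> on the right vanishes at \<open>a\<close>.  So \<open>s - d u\<close> does not vanish there, and
  after multiplication by it \<open>y u\<close> can be eliminated from all relations.
\<close>

lemma exists_denominator_aux:
  assumes "U \<subseteq> V"
  shows "\<exists>s\<in>polys UNIV V. eval a s \<noteq> 0 \<and>
    (\<forall>v\<in>V. \<exists>i\<in>\<I>. \<exists>c. (\<forall>w\<in>V. c w \<in> polys UNIV V) \<and> s * y v = i + (\<Sum>w\<in>V - U. c w * y w))"
  using finite_subset[OF assms finite_V] assms
proof (induction U rule: finite_induct)
  case empty
  show ?case
  proof (rule bexI[of _ 1], intro conjI ballI)
    fix v assume v: "v \<in> V"
    show "\<exists>i\<in>\<I>. \<exists>c. (\<forall>w\<in>V. c w \<in> polys UNIV V) \<and> 1 * y v = i + (\<Sum>w\<in>V - {}. c w * y w)"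
      by (rule bexI[of _ 0], rule exI[of _ "\<lambda>w. if w = v then 1 else 0"])
        (use v finite_V in \<open>simp_all add: I cpolys_closed if_distrib[of "\<lambda>c. c * _"] cong: if_cong\<close>)
  qed (simp_all add: cpolys_closed)
next
  case (insert u U)
  let ?P = "polys UNIV V" and ?W = "V - insert u U"
  from insert obtain s where s: "s \<in> ?P" "eval a s \<noteq> 0"
    and ex0: "\<forall>v\<in>V. \<exists>i\<in>\<I>. \<exists>c. (\<forall>w\<in>V. c w \<in> ?P) \<and> s * y v = i + (\<Sum>w\<in>V - U. c w * y w)"
    by auto
  have ex: "\<forall>v\<in>V. \<exists>i. \<exists>c. i \<in> \<I> \<and> (\<forall>w\<in>V. c w \<in> ?P) \<and> s * y v = i + (\<Sum>w\<in>V - U. c w * y w)"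
    using ex0 by (simp add: Bex_def)
  from bchoice[OF ex] obtain i where
    "\<forall>v\<in>V. \<exists>c. i v \<in> \<I> \<and> (\<forall>w\<in>V. c w \<in> ?P) \<and> s * y v = i v + (\<Sum>w\<in>V - U. c w * y w)" ..
  from bchoice[OF this] obtain c where
    ic: "\<forall>v\<in>V. i v \<in> \<I> \<and> (\<forall>w\<in>V. c v w \<in> ?P) \<and> s * y v = i v + (\<Sum>w\<in>V - U. c v w * y w)" ..
  have u: "u \<in> V" using insert by simp
  obtain i0 e where e: "y u = i0 + (\<Sum>w\<in>V. e w * y w)" "i0 \<in> \<I>" "\<forall>w. e w \<in> max_ideal_at V a"
    using y_in_S[OF u] unfolding S_def mem_Collect_eq by (elim exE conjE)
  define d where "d w = (\<Sum>v\<in>V. e v * c v w)" for w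
  have eP: "e w \<in> ?P" for w using e(3) by (simp add: max_ideal_at_def)
  have dP: "d w \<in> ?P" if "w \<in> V" for w
    using ic that eP by (auto simp: d_def intro!: cpolys_closed)
  have da: "eval a (d u) = 0"
    using e(3) by (simp add: d_def eval.hom_sum eval.hom_mult max_ideal_at_def)
  define j where "j = s * i0 + (\<Sum>v\<in>V. e v * i v)"
  have jI: "j \<in> \<I>" unfolding j_def using ic e s eP by (intro I(3) I(4) I(7)) auto
  have VU: "V - U = insert u ?W" "u \<notin> ?W" "finite ?W" using u insert finite_V by auto
  have split: "(\<Sum>w\<in>V - U. g w) = g u + (\<Sum>w\<in>?W. g w)" for g :: "'v \<Rightarrow> 'v cpoly"
    unfolding VU(1) using VU(2,3) by (rule sum.insert[rotated])
  have "s * y u = s * i0 + (\<Sum>v\<in>V. e v * (s * y v))"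
    by (subst e(1)) (simp add: algebra_simps sum_distrib_left)
  also have "(\<Sum>v\<in>V. e v * (s * y v)) = (\<Sum>v\<in>V. e v * (i v + (\<Sum>w\<in>V - U. c v w * y w)))"
    using ic by (intro sum.cong) auto
  also have "\<dots> = (\<Sum>v\<in>V. e v * i v) + (\<Sum>w\<in>V - U. d w * y w)"
    unfolding d_def distrib_left sum.distrib sum_distrib_left sum_distrib_right
    by (subst sum.swap) (simp add: mult.assoc)
  finally have yu: "(s - d u) * y u = j + (\<Sum>w\<in>?W. d w * y w)"
    unfolding split by (simp add: j_def algebra_simps)
  show ?case
  proof (rule bexI[of _ "s * (s - d u)"], intro conjI ballI)
    show "s * (s - d u) \<in> ?P" using s dP u by (intro cpolys_closed)
    show "eval a (s * (s - d u)) \<noteq> 0"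
      using s(2) da by (simp add: eval.hom_mult eval.hom_minus)
    fix v assume v: "v \<in> V"
    have "s * (s - d u) * y v = (s - d u) * (s * y v)" by (simp add: mult_ac)
    also have "s * y v = i v + (c v u * y u + (\<Sum>w\<in>?W. c v w * y w))"
      using ic v by (simp add: split)
    also have "(s - d u) * \<dots> = (s - d u) * i v + (c v u * ((s - d u) * y u) + (\<Sum>w\<in>?W. (s - d u) * c v w * y w))"
      by (simp add: distrib_left sum_distrib_left mult_ac)
    also have "\<dots> = ((s - d u) * i v + c v u * j) + (\<Sum>w\<in>?W. (c v u * d w + (s - d u) * c v w) * y w)"
      unfolding yu by (simp add: distrib_left distrib_right sum_distrib_left sum.distrib mult.assoc add_ac)
    finally have eq: "s * (s - d u) * y v =
      ((s - d u) * i v + c v u * j) + (\<Sum>w\<in>?W. (c v u * d w + (s - d u) * c v w) * y w)" .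
    have "(s - d u) * i v + c v u * j \<in> \<I>"
      using ic v u jI s dP by (intro I(3) I(4) cpolys_closed) auto
    moreover have "\<forall>w\<in>V. c v u * d w + (s - d u) * c v w \<in> ?P"
      using ic v u s dP by (auto intro!: cpolys_closed)
    ultimately show "\<exists>i\<in>\<I>. \<exists>c. (\<forall>w\<in>V. c w \<in> ?P) \<and> s * (s - d u) * y v = i + (\<Sum>w\<in>?W. c w * y w)"
      by (intro bexI[of _ "(s - d u) * i v + c v u * j"]
          exI[of _ "\<lambda>w. c v u * d w + (s - d u) * c v w"] conjI eq)
  qed
qed

lemma exists_denominator:
  "\<exists>s\<in>polys UNIV V. eval a s \<noteq> 0 \<and> (\<forall>p\<in>max_ideal_at V a. s * p \<in> \<I>)"
proof -
  obtain s where s: "s \<in> polys UNIV V" "eval a s \<noteq> 0" and sy: "\<And>v. v \<in> V \<Longrightarrow> s * y v \<in> \<I>"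
    using exists_denominator_aux[of V] by auto
  have "s * (p - Const (eval a p)) \<in> \<I>" if "p \<in> polys UNIV V" for p
    using that
  proof (induction rule: polys_induct)
    case (Const c)
    then show ?case by (simp add: I)
  next
    case (add p q)
    have "s * (p + q - Const (eval a (p + q))) = s * (p - Const (eval a p)) + s * (q - Const (eval a q))"
      by (simp add: eval.hom_add Const.hom_add algebra_simps)
    then show ?case using add I(3) by simp
  next
    case (Var v p)
    have "s * (Var v * p - Const (eval a (Var v * p))) =
        Var v * (s * (p - Const (eval a p))) + Const (eval a p) * (s * y v)"
      by (simp add: eval.hom_mult Const.hom_mult y_def algebra_simps)
    then show ?case using Var sy I(3,4) by (simp add: cpolys_closed)
  qed
  then have "s * p \<in> \<I>" if "p \<in> max_ideal_at V a" for p
    using that by (force simp: max_ideal_at_def)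
  with s show ?thesis by blast
qed

text \<open>
  The neighbourhood is the set where \<open>s\<close> does not vanish: \<open>s y\<^sub>v \<in> \<I>\<close> forces a common zero in it to
  have the coordinate \<open>a v\<close>.
\<close>

theorem isolated_root: "isolated_root V F a"
proof -
  obtain s where s: "s \<in> polys UNIV V" "eval a s \<noteq> 0" "\<forall>p\<in>max_ideal_at V a. s * p \<in> \<I>"
    using exists_denominator by auto
  let ?T = "{b. eval b s \<noteq> 0}" and ?Z = "{b \<in> V \<rightarrow>\<^sub>E UNIV. \<forall>p\<in>F. eval b p = 0}"
  have "continuous_on UNIV (\<lambda>b. eval b s)"
    unfolding eval_def subst_def
    by (intro continuous_on_sum continuous_on_mult continuous_on_prod continuous_on_power
        continuous_on_const continuous_on_product_coordinates)
  then have "open ?T" by (intro open_Collect_neq continuous_on_const)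
  have unique: "b = a" if "b \<in> ?T" "b \<in> ?Z" for b
  proof (rule PiE_ext[of _ V "\<lambda>_. UNIV"])
    fix v assume v: "v \<in> V"
    have "eval b (s * y v) = 0"
      using eval_ideal[of b "s * y v"] s(3) y_max_ideal[OF v] that by simp
    then show "b v = a v" using that by (simp add: eval.hom_mult)
  qed (use that point in simp_all)
  have aZ: "a \<in> ?Z" using point root by simp
  have "?T \<inter> ?Z = {a}"
    using s(2) aZ unique by (intro equalityI subsetI) blast+
  with \<open>open ?T\<close> show ?thesis
    unfolding isolated_root_def isolated_in_def using aZ by (intro conjI exI[of _ ?T])
qed

text \<open>
  As \<open>\<I>\<close> is contained in the prime ideal \<open>m\<close> of the point, so is some component.  If the radical of
  a component \<open>Q\<close> is contained in \<open>m\<close>, then \<open>s\<close> is outside the radical, and \<open>s p \<in> \<I> \<subseteq> Q\<close> gives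
  \<open>p \<in> Q\<close> for every \<open>p \<in> m\<close>.
\<close>

theorem root_multiplicity_one: "root_multiplicity V F a 1"
proof -
  let ?m = "max_ideal_at V a"
  obtain s where s: "s \<in> polys UNIV V" "eval a s \<noteq> 0" "\<forall>p\<in>?m. s * p \<in> \<I>"
    using exists_denominator by auto
  interpret noetherian_cring "poly_ring V"
    by (intro noetherian_cring.intro noetherian_poly_ring finite_V cring_poly_ring)
  obtain \<Q> where \<Q>: "minimal_primary_decomposition (poly_ring V) \<I> \<Q>"
    using exists_minimal_primary_decomposition[OF ideal_I] by blast
  then have fin: "finite \<Q>" and prim: "\<And>Q. Q \<in> \<Q> \<Longrightarrow> primary_ideal (poly_ring V) Q"
    and dec: "\<I> = polys UNIV V \<inter> \<Inter>\<Q>"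
    by (simp_all add: minimal_primary_decomposition_def)
  have rad: "Q \<subseteq> radical (poly_ring V) Q" if "Q \<in> \<Q>" for Q
  proof
    fix p assume "p \<in> Q"
    moreover have "ideal Q (poly_ring V)" using prim[OF that] by (simp add: primary_ideal_def)
    ultimately show "p \<in> radical (poly_ring V) Q"
      using idealD_poly_ring(1) by (auto simp: radical_def intro!: exI[of _ 1])
  qed
  have eq_m: "Q = ?m" if Q: "Q \<in> \<Q>" "radical (poly_ring V) Q \<subseteq> ?m" for Q
  proof
    show "Q \<subseteq> ?m" using rad Q by blast
    show "?m \<subseteq> Q"
    proof
      fix p assume p: "p \<in> ?m"
      have "s * p \<in> Q" using s(3) p dec Q(1) by auto
      then have "p * s \<in> Q" by (simp add: mult.commute)
      moreover have "s \<notin> radical (poly_ring V) Q"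
        using Q(2) s(2) by (auto simp: max_ideal_at_def)
      ultimately show "p \<in> Q"
        using prim[OF Q(1)] p s(1) by (auto simp: primary_ideal_def max_ideal_at_def)
    qed
  qed
  have "\<exists>Q\<in>\<Q>. Q \<subseteq> ?m"
  proof (rule ccontr)
    assume "\<not> ?thesis"
    then have "\<forall>Q\<in>\<Q>. \<exists>p. p \<in> Q \<and> p \<notin> ?m" by blast
    from bchoice[OF this] obtain g where g: "\<forall>Q\<in>\<Q>. g Q \<in> Q \<and> g Q \<notin> ?m" ..
    have gP: "g Q \<in> polys UNIV V" and Qid: "ideal Q (poly_ring V)" if "Q \<in> \<Q>" for Q
      using prim[OF that] g that idealD_poly_ring(1)[of Q] by (auto simp: primary_ideal_def)
    have "prod g \<Q> \<in> Q" if Q: "Q \<in> \<Q>" for Q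
    proof -
      have "prod g \<Q> = prod g (\<Q> - {Q}) * g Q"
        using fin Q by (simp add: prod.remove mult.commute)
      moreover have "prod g (\<Q> - {Q}) \<in> polys UNIV V" using gP by (intro cpolys_closed) auto
      ultimately show ?thesis using idealD_poly_ring(4)[OF Qid[OF Q]] g Q by simp
    qed
    moreover have "prod g \<Q> \<in> polys UNIV V" using gP by (intro cpolys_closed)
    ultimately have "prod g \<Q> \<in> \<I>" using dec by blast
    then have "eval a (prod g \<Q>) = 0" using eval_ideal[OF root] by blast
    then have "\<exists>Q\<in>\<Q>. eval a (g Q) = 0" using fin by (simp add: eval.hom_prod)
    then show False using g gP by (auto simp: max_ideal_at_def)
  qed
  then obtain Q where Q: "Q \<in> \<Q>" "Q \<subseteq> ?m" by blast
  have "radical (poly_ring V) Q \<subseteq> ?m"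
  proof
    fix p assume "p \<in> radical (poly_ring V) Q"
    then obtain k where "p \<in> polys UNIV V" "p ^ k \<in> ?m" using Q(2) by (auto simp: radical_def)
    then show "p \<in> ?m" by (simp add: max_ideal_at_def eval.hom_power)
  qed
  with eq_m Q(1) rad have Qm: "Q = ?m" "radical (poly_ring V) Q = ?m" by blast+
  have "primary_component_at V F a ?m"
    unfolding primary_component_at_def isolated_primary_component_def
    using \<Q> Q(1) Qm eq_m by (intro exI[of _ \<Q>]) auto
  moreover have "quotient_dim V ?m 1"
    unfolding quotient_dim_def quotient_basis_def
  proof (rule exI[of _ "\<lambda>_. 1"], intro conjI ballI allI impI)
    fix c :: "nat \<Rightarrow> complex" and j :: nat assume "(\<Sum>j<1. smult (c j) 1) \<in> ?m" "j < 1"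
    then show "c j = 0" by (simp add: max_ideal_at_def)
  next
    fix p assume "p \<in> polys UNIV V"
    then have "p - (\<Sum>j<1::nat. smult (eval a p) 1) \<in> ?m"
      by (simp add: max_ideal_at_def eval.hom_minus cpolys_closed)
    then show "\<exists>c. p - (\<Sum>j<1::nat. smult (c j) 1) \<in> ?m"
      by (rule exI[of _ "\<lambda>_. eval a p"])
  qed (simp add: cpolys_closed)
  ultimately show ?thesis unfolding root_multiplicity_def by blast
qed

end


section \<open>Taylor coefficients\<close>

subsection \<open>Monomials of bounded degree\<close>

definition bounded_monomials :: "'v set \<Rightarrow> nat \<Rightarrow> 'v monomial set" where
  "bounded_monomials V d = {m \<in> monomials V. mdeg m \<le> d}"

lemma finite_bounded_monomials:
  assumes "finite V"
  shows "finite (bounded_monomials V d)"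
proof -
  have "bounded_monomials V d \<subseteq> (\<lambda>f. \<Sum>v\<in>V. Poly_Mapping.single v (f v)) ` (V \<rightarrow>\<^sub>E {..d})"
  proof
    fix m assume m: "m \<in> bounded_monomials V d"
    let ?f = "restrict (Poly_Mapping.lookup m) V"
    have "m = (\<Sum>v\<in>V. Poly_Mapping.single v (?f v))"
      using monomials_sum[OF assms, of m] m by (simp add: bounded_monomials_def)
    moreover have "?f \<in> V \<rightarrow>\<^sub>E {..d}"
      using m order_trans[OF lookup_le_mdeg[of m]] by (simp add: bounded_monomials_def)
    ultimately show "m \<in> (\<lambda>f. \<Sum>v\<in>V. Poly_Mapping.single v (f v)) ` (V \<rightarrow>\<^sub>E {..d})" by blast
  qed
  then show ?thesis by (rule finite_subset) (simp add: finite_PiE assms)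
qed

subsection \<open>The coefficients of the derivatives\<close>

lemma lookup_pdiff:
  "Poly_Mapping.lookup (pdiff v p) m =
     of_nat (Suc (Poly_Mapping.lookup m v)) * Poly_Mapping.lookup p (m + Poly_Mapping.single v 1)"
proof -
  let ?m = "m + Poly_Mapping.single v 1"
  have "Poly_Mapping.lookup (pdiff v p) m =
    (\<Sum>m'\<in>Poly_Mapping.keys p. of_nat (Poly_Mapping.lookup m' v) * Poly_Mapping.lookup p m'
       when m' - Poly_Mapping.single v 1 = m)"
    by (simp add: pdiff_def lookup_sum lookup_single)
  also have "\<dots> = (\<Sum>m'\<in>Poly_Mapping.keys p. of_nat (Poly_Mapping.lookup m' v) * Poly_Mapping.lookup p m'
       when m' = ?m)"
  proof (rule sum.cong)
    fix m'
    have "m' - Poly_Mapping.single v 1 = m \<longleftrightarrow> m' = ?m" if "Poly_Mapping.lookup m' v \<noteq> 0"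
    proof
      assume "m' - Poly_Mapping.single v 1 = m"
      then show "m' = ?m" using minus_single_add[OF that] by simp
    qed simp
    then show "(of_nat (Poly_Mapping.lookup m' v) * Poly_Mapping.lookup p m' when m' - Poly_Mapping.single v 1 = m) =
      (of_nat (Poly_Mapping.lookup m' v) * Poly_Mapping.lookup p m' when m' = ?m)"
      by (cases "Poly_Mapping.lookup m' v = 0") simp_all
  qed simp
  also have "\<dots> = of_nat (Poly_Mapping.lookup ?m v) * Poly_Mapping.lookup p ?m"
    by (cases "?m \<in> Poly_Mapping.keys p") (simp_all add: when_def in_keys_iff)
  finally show ?thesis by (simp add: lookup_add)
qed

lemma lookup_pdiff_power:
  "Poly_Mapping.lookup ((pdiff v ^^ k) p) m =
     fact (Poly_Mapping.lookup m v + k) / fact (Poly_Mapping.lookup m v) *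
     Poly_Mapping.lookup p (m + Poly_Mapping.single v k)"
proof (induction k arbitrary: m)
  case (Suc k)
  have "m + Poly_Mapping.single v 1 + Poly_Mapping.single v k = m + Poly_Mapping.single v (Suc k)"
    by (simp add: add.assoc flip: single_add)
  then show ?case
    by (simp add: lookup_pdiff Suc lookup_add fact_Suc[of "Poly_Mapping.lookup m v"] del: of_nat_Suc)
qed simp

text \<open>
  The coefficient in \<open>(1/b!) \<partial>\<^sup>b x\<^bsup>m + b\<^esup> = mbinom m b \<cdot> x\<^sup>m\<close>.
\<close>

definition mbinom :: "'v monomial \<Rightarrow> 'v monomial \<Rightarrow> complex" where
  "mbinom m b = (\<Prod>v\<in>Poly_Mapping.keys b.
     of_nat ((Poly_Mapping.lookup m v + Poly_Mapping.lookup b v) choose Poly_Mapping.lookup b v))"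

lemma mbinom_superset:
  assumes "finite S" "Poly_Mapping.keys b \<subseteq> S"
  shows "mbinom m b = (\<Prod>v\<in>S.
     of_nat ((Poly_Mapping.lookup m v + Poly_Mapping.lookup b v) choose Poly_Mapping.lookup b v))"
  unfolding mbinom_def
  by (rule prod.mono_neutral_left) (use assms in \<open>auto simp: in_keys_iff\<close>)

lemma mfact_nonzero [simp]: "mfact m \<noteq> 0"
  by (simp add: mfact_def)

text \<open>
  Division by \<open>\<gamma>!\<close> frees the Leibniz rule for a product with a variable from numerical factors, and
  makes these operators dual to the shifted monomials (\<open>eval_taylor_shifted_monomial\<close>).
\<close>

definition taylor :: "nat monomial \<Rightarrow> nat cpoly \<Rightarrow> nat cpoly" where
  "taylor \<gamma> p = smult (1 / mfact \<gamma>) (pdiffs \<gamma> p)"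

lemma lookup_fold_pdiff:
  assumes "distinct vs"
  shows "Poly_Mapping.lookup (fold (\<lambda>i. pdiff i ^^ Poly_Mapping.lookup \<beta> i) vs p) m =
    (\<Prod>i\<in>set vs. fact (Poly_Mapping.lookup m i + Poly_Mapping.lookup \<beta> i) / fact (Poly_Mapping.lookup m i)) *
    Poly_Mapping.lookup p (m + (\<Sum>i\<in>set vs. Poly_Mapping.single i (Poly_Mapping.lookup \<beta> i)))"
  using assms
proof (induction vs arbitrary: p)
  case (Cons v vs)
  let ?s = "\<Sum>i\<in>set vs. Poly_Mapping.single i (Poly_Mapping.lookup \<beta> i)"
  have "Poly_Mapping.lookup ?s v = 0"
    using Cons.prems by (auto simp: lookup_sum lookup_single when_def intro!: sum.neutral)
  then show ?case
    using Cons by (simp add: lookup_pdiff_power lookup_add add_ac)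
qed simp

lemma lookup_taylor:
  "Poly_Mapping.lookup (taylor \<gamma> p) m = mbinom m \<gamma> * Poly_Mapping.lookup p (m + \<gamma>)"
proof -
  let ?K = "Poly_Mapping.keys \<gamma>"
  have "Poly_Mapping.lookup (pdiffs \<gamma> p) m =
    (\<Prod>i\<in>?K. fact (Poly_Mapping.lookup m i + Poly_Mapping.lookup \<gamma> i) / fact (Poly_Mapping.lookup m i)) *
    Poly_Mapping.lookup p (m + \<gamma>)"
    unfolding pdiffs_def
    by (subst lookup_fold_pdiff) (simp_all flip: poly_mapping_sum_single[of ?K \<gamma>, simplified])
  moreover have "mbinom m \<gamma> = (1 / mfact \<gamma>) *
    (\<Prod>i\<in>?K. fact (Poly_Mapping.lookup m i + Poly_Mapping.lookup \<gamma> i) / fact (Poly_Mapping.lookup m i))"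
    unfolding mbinom_def mfact_def
    by (simp add: binomial_fact mult.commute flip: prod_dividef)
  ultimately show ?thesis by (simp add: taylor_def)
qed

lemma taylor_eq_0_iff: "taylor \<gamma> p = 0 \<longleftrightarrow> pdiffs \<gamma> p = 0"
  by (auto simp: taylor_def poly_mapping_eq_iff fun_eq_iff)

lemma taylor_0 [simp]: "taylor 0 p = p"
  by (rule poly_mapping_eqI) (simp add: lookup_taylor mbinom_def)

lemma taylor_add: "taylor \<gamma> (p + q) = taylor \<gamma> p + taylor \<gamma> q"
  by (rule poly_mapping_eqI) (simp add: lookup_taylor lookup_add algebra_simps)

lemma taylor_smult: "taylor \<gamma> (smult c p) = smult c (taylor \<gamma> p)"
  by (rule poly_mapping_eqI) (simp add: lookup_taylor)

lemma taylor_Const: "\<gamma> \<noteq> 0 \<Longrightarrow> taylor \<gamma> (Const c) = 0"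
proof (rule poly_mapping_eqI)
  fix m assume "\<gamma> \<noteq> 0"
  then have "m + \<gamma> \<noteq> 0" by (auto simp: poly_mapping_eq_iff fun_eq_iff lookup_add)
  then show "Poly_Mapping.lookup (taylor \<gamma> (Const c)) m = Poly_Mapping.lookup 0 m"
    by (simp add: lookup_taylor Const_def lookup_single when_def)
qed

lemma lookup_Var_mult:
  "Poly_Mapping.lookup (Var v * p) m =
     (if Poly_Mapping.lookup m v = 0 then 0 else Poly_Mapping.lookup p (m - Poly_Mapping.single v 1))"
proof -
  let ?e = "Poly_Mapping.single v (1::nat)"
  have iff: "m = ?e + m' \<longleftrightarrow> Poly_Mapping.lookup m v \<noteq> 0 \<and> m' = m - ?e" for m'
  proof
    assume "m = ?e + m'"
    then show "Poly_Mapping.lookup m v \<noteq> 0 \<and> m' = m - ?e" by (simp add: lookup_add)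
  next
    assume "Poly_Mapping.lookup m v \<noteq> 0 \<and> m' = m - ?e"
    then show "m = ?e + m'" using minus_single_add[of m v] by (simp add: add.commute)
  qed
  have "Var v * p = (\<Sum>m'\<in>Poly_Mapping.keys p. Poly_Mapping.single (?e + m') (Poly_Mapping.lookup p m'))"
    by (subst poly_mapping_sum_single[of "Poly_Mapping.keys p" p])
       (simp_all add: Var_def sum_distrib_left mult_single)
  then have "Poly_Mapping.lookup (Var v * p) m =
      (\<Sum>m'\<in>Poly_Mapping.keys p. Poly_Mapping.lookup p m' when m = ?e + m')"
    by (simp add: lookup_sum lookup_single when_def eq_commute)
  also have "\<dots> = (\<Sum>m'\<in>Poly_Mapping.keys p. if m' = m - ?e then
      (if Poly_Mapping.lookup m v = 0 then 0 else Poly_Mapping.lookup p m') else 0)"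
    unfolding when_def iff by (intro sum.cong) auto
  also have "\<dots> = (if Poly_Mapping.lookup m v = 0 then 0 else Poly_Mapping.lookup p (m - ?e))"
    by (simp add: sum.delta' in_keys_iff)
  finally show ?thesis .
qed

text \<open>
  The Leibniz rule.  In the coefficient of a monomial \<open>m\<close> it is Pascal's rule for the exponents of
  \<open>i\<close> in \<open>m\<close> and \<open>\<gamma>\<close>, the other variables contributing a common factor \<open>r\<close>.
\<close>

lemma taylor_Var_mult:
  "taylor \<gamma> (Var i * p) = Var i * taylor \<gamma> p +
     (if Poly_Mapping.lookup \<gamma> i = 0 then 0 else taylor (\<gamma> - Poly_Mapping.single i 1) p)"
proof (rule poly_mapping_eqI)
  fix m
  define e where "e = Poly_Mapping.single i (1::nat)"
  have lookup_e: "Poly_Mapping.lookup e j = (if j = i then 1 else 0)" for j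
    by (simp add: e_def lookup_single when_def)
  let ?K = "Poly_Mapping.keys \<gamma> - {i}"
  define b where "b k g j = (of_nat ((Poly_Mapping.lookup k j + Poly_Mapping.lookup g j)
    choose Poly_Mapping.lookup g j) :: complex)" for k g :: "nat monomial" and j
  define r where "r = (\<Prod>j\<in>?K. b m \<gamma> j)"
  have B: "mbinom k g = b k g i * r"
    if k: "\<And>j. j \<noteq> i \<Longrightarrow> Poly_Mapping.lookup k j = Poly_Mapping.lookup m j"
      and g: "\<And>j. j \<noteq> i \<Longrightarrow> Poly_Mapping.lookup g j = Poly_Mapping.lookup \<gamma> j" for k g
  proof -
    have "j \<in> insert i ?K" if "j \<in> Poly_Mapping.keys g" for j
      using that g[of j] by (cases "j = i") (simp_all add: in_keys_iff)
    then have "Poly_Mapping.keys g \<subseteq> insert i ?K" by (rule subsetI)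
    then have "mbinom k g = (\<Prod>j\<in>insert i ?K. b k g j)"
      unfolding b_def by (intro mbinom_superset) simp_all
    also have "\<dots> = b k g i * (\<Prod>j\<in>?K. b k g j)" by (rule prod.insert) simp_all
    also have "(\<Prod>j\<in>?K. b k g j) = r"
      unfolding r_def by (rule prod.cong) (simp_all add: b_def k g)
    finally show ?thesis .
  qed
  define x where "x = Poly_Mapping.lookup m i"
  define y where "y = Poly_Mapping.lookup \<gamma> i"
  define c where "c = Poly_Mapping.lookup p (m + \<gamma> - e)"
  have shift1: "m - e + \<gamma> = m + \<gamma> - e" if "x \<noteq> 0"
    by (rule poly_mapping_eqI) (use that in \<open>simp add: lookup_minus lookup_add lookup_e x_def\<close>)
  have shift2: "m + (\<gamma> - e) = m + \<gamma> - e" if "y \<noteq> 0"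
    by (rule poly_mapping_eqI) (use that in \<open>simp add: lookup_minus lookup_add lookup_e y_def\<close>)
  have L: "Poly_Mapping.lookup (taylor \<gamma> (Var i * p)) m =
      (if x + y = 0 then 0 else of_nat ((x + y) choose y) * r * c)"
    unfolding lookup_taylor lookup_Var_mult
    by (subst B) (simp_all add: b_def lookup_add x_def y_def c_def e_def)
  have R1: "Poly_Mapping.lookup (Var i * taylor \<gamma> p) m =
      (if x = 0 then 0 else of_nat ((x - 1 + y) choose y) * r * c)"
  proof (cases "x = 0")
    case False
    have "mbinom (m - e) \<gamma> = b (m - e) \<gamma> i * r"
      by (rule B) (simp_all add: lookup_minus lookup_e)
    then have "Poly_Mapping.lookup (taylor \<gamma> p) (m - e) = of_nat ((x - 1 + y) choose y) * r * c"
      by (simp add: lookup_taylor shift1[OF False] b_def lookup_minus lookup_e x_def y_def c_def)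
    then show ?thesis using False unfolding lookup_Var_mult x_def e_def by simp
  qed (simp add: lookup_Var_mult x_def)
  have R2: "Poly_Mapping.lookup (taylor (\<gamma> - e) p) m = of_nat ((x + (y - 1)) choose (y - 1)) * r * c"
    if "y \<noteq> 0"
  proof -
    have "mbinom m (\<gamma> - e) = b m (\<gamma> - e) i * r"
      by (rule B) (simp_all add: lookup_minus lookup_e)
    then show ?thesis
      by (simp add: lookup_taylor shift2[OF that] b_def lookup_minus lookup_e x_def y_def c_def)
  qed
  have pascal: "(x + y) choose y = ((x - 1 + y) choose y) + ((x + (y - 1)) choose (y - 1))"
    if "x \<noteq> 0" "y \<noteq> 0"
    using that by (cases x; cases y) simp_all
  have "Poly_Mapping.lookup (taylor \<gamma> (Var i * p)) m = Poly_Mapping.lookup (Var i * taylor \<gamma> p) m +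
      (if y = 0 then 0 else Poly_Mapping.lookup (taylor (\<gamma> - e) p) m)"
  proof (cases "x = 0 \<or> y = 0")
    case True
    then show ?thesis using L R1 R2 by auto
  next
    case False
    then have nz: "x \<noteq> 0" "y \<noteq> 0" by auto
    then have "of_nat ((x + y) choose y) * r * c = of_nat ((x - 1 + y) choose y) * r * c +
        of_nat ((x + (y - 1)) choose (y - 1)) * r * c"
      unfolding pascal[OF nz] by (simp only: of_nat_add distrib_right)
    then show ?thesis using L R1 R2 False by simp
  qed
  then show "Poly_Mapping.lookup (taylor \<gamma> (Var i * p)) m = Poly_Mapping.lookup (Var i * taylor \<gamma> p +
     (if Poly_Mapping.lookup \<gamma> i = 0 then 0 else taylor (\<gamma> - Poly_Mapping.single i 1) p)) m"
    unfolding y_def e_def lookup_add by (simp split: if_splits)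
qed

lemma taylor_nonzero_bound:
  assumes "taylor \<gamma> p \<noteq> 0" "\<And>m. m \<in> Poly_Mapping.keys p \<Longrightarrow> mdeg m \<le> d"
  shows "mdeg \<gamma> \<le> d"
proof -
  obtain m where "Poly_Mapping.lookup (taylor \<gamma> p) m \<noteq> 0"
    using assms(1) poly_mapping_eqI[of "taylor \<gamma> p" 0] by auto
  then have "m + \<gamma> \<in> Poly_Mapping.keys p" by (auto simp: lookup_taylor in_keys_iff)
  from assms(2)[OF this] show ?thesis by (simp add: mdeg_add)
qed

lemma exists_degree_bound: "\<exists>d. \<forall>m\<in>Poly_Mapping.keys p. mdeg m \<le> d"
  using finite_keys[of p] by (intro exI[of _ "Max (mdeg ` Poly_Mapping.keys p)"]) simp

lemma keys_Var_mult_bound: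
  assumes "\<And>m. m \<in> Poly_Mapping.keys p \<Longrightarrow> mdeg m \<le> d" "m \<in> Poly_Mapping.keys (Var v * p)"
  shows "mdeg m \<le> Suc d"
proof -
  let ?e = "Poly_Mapping.single v (1::nat)"
  have "Poly_Mapping.lookup m v \<noteq> 0" "m - ?e \<in> Poly_Mapping.keys p"
    using assms(2) by (auto simp: in_keys_iff lookup_Var_mult split: if_splits)
  then have "mdeg (m - ?e) \<le> d" "m - ?e + ?e = m"
    using assms(1) minus_single_add[of m v] by simp_all
  then show ?thesis using mdeg_add[of "m - ?e" ?e] by simp
qed

lemma taylor_polys:
  assumes "subring K complex_ring" "p \<in> polys K V"
  shows "taylor \<gamma> p \<in> polys K V"
proof -
  note K = subring_complexD[OF assms(1)]
  have nat: "of_nat k \<in> K" for k by (induction k) (simp_all add: K)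
  have "prod g A \<in> K" if "\<And>x. x \<in> A \<Longrightarrow> g x \<in> K" for g :: "nat \<Rightarrow> complex" and A
    using that by (induction A rule: infinite_finite_induct) (simp_all add: K)
  then have "mbinom m \<gamma> \<in> K" for m by (simp add: mbinom_def nat)
  moreover have "Poly_Mapping.keys m \<subseteq> V" if "Poly_Mapping.lookup (taylor \<gamma> p) m \<noteq> 0" for m
  proof -
    have "m + \<gamma> \<in> Poly_Mapping.keys p" using that by (auto simp: lookup_taylor in_keys_iff)
    then have "m + \<gamma> \<in> monomials V" using assms(2) by (auto simp: polys_def)
    then show ?thesis by (auto simp: monomials_def keys_add_nat)
  qed
  ultimately show ?thesis
    using assms(2) K(4) by (simp add: polys_def lookup_taylor monomials_def subset_iff in_keys_iff)
qed

section \<open>Parametric normal forms over commuting matrices\<close>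

text \<open>
  The ordered product that occurs in the system, over an arbitrary ring: it is needed over the
  polynomials in the parameters, over \<open>\<complex>\<close> and over the dual numbers.
\<close>

definition mat_monomial :: "nat \<Rightarrow> nat \<Rightarrow> (nat \<Rightarrow> 'r::comm_ring_1 mat) \<Rightarrow> nat monomial \<Rightarrow> 'r mat" where
  "mat_monomial n \<delta> M \<gamma> = foldr (\<lambda>i A. (M i ^\<^sub>m Poly_Mapping.lookup \<gamma> i) * A) [0..<n] (1\<^sub>m \<delta>)"

text \<open>
  Values of the parameters in a ring at which the matrices commute.
\<close>

locale commuting_matrices =
  fixes h :: "complex \<Rightarrow> 'r::comm_ring_1" and z :: "nat \<Rightarrow> 'r" and n \<delta> :: nat and M :: "nat \<Rightarrow> 'r mat"
  assumes h: "comm_ring_hom h" and M_carrier [simp]: "\<And>i. M i \<in> carrier_mat \<delta> \<delta>"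
    and commute: "\<And>i j. i < n \<Longrightarrow> j < n \<Longrightarrow> M i * M j = M j * M i"
    and \<delta>_pos: "0 < \<delta>"
begin

interpretation h: comm_ring_hom h by (rule h)
interpretation S: comm_ring_hom "subst h z" by (rule subst_hom[OF h])

lemma pow_carrier [simp]: "M i ^\<^sub>m k \<in> carrier_mat \<delta> \<delta>"
  by (rule pow_carrier_mat) simp

lemma foldr_carrier [simp]:
  "foldr (\<lambda>i A. (M i ^\<^sub>m Poly_Mapping.lookup \<gamma> i) * A) vs (1\<^sub>m \<delta>) \<in> carrier_mat \<delta> \<delta>"
  by (induction vs) (simp_all add: mult_carrier_mat[OF pow_carrier])

lemma commute_pow:
  assumes "i < n" "j < n"
  shows "M i ^\<^sub>m k * M j = M j * M i ^\<^sub>m k"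
proof (induction k)
  case 0
  have "M i ^\<^sub>m 0 = 1\<^sub>m \<delta>" using carrier_matD(1)[OF M_carrier[of i]] by simp
  then show ?case
    using left_mult_one_mat[OF M_carrier[of j]] right_mult_one_mat[OF M_carrier[of j]] by simp
next
  case (Suc k)
  have "M i ^\<^sub>m k * M i * M j = M i ^\<^sub>m k * (M j * M i)"
    using assoc_mult_mat[of "M i ^\<^sub>m k" \<delta> \<delta> "M i" \<delta> "M j" \<delta>] commute[OF assms] by simp
  also have "\<dots> = M j * M i ^\<^sub>m k * M i"
    using assoc_mult_mat[of "M i ^\<^sub>m k" \<delta> \<delta> "M j" \<delta> "M i" \<delta>] Suc by simp
  also have "\<dots> = M j * (M i ^\<^sub>m k * M i)"
    using assoc_mult_mat[of "M j" \<delta> \<delta> "M i ^\<^sub>m k" \<delta> "M i" \<delta>] by simp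
  finally show ?case by simp
qed

lemma foldr_unchanged:
  assumes "i \<notin> set vs"
  shows "foldr (\<lambda>j A. (M j ^\<^sub>m Poly_Mapping.lookup (\<gamma> + Poly_Mapping.single i 1) j) * A) vs (1\<^sub>m \<delta>) =
    foldr (\<lambda>j A. (M j ^\<^sub>m Poly_Mapping.lookup \<gamma> j) * A) vs (1\<^sub>m \<delta>)"
  using assms by (induction vs) (auto simp: lookup_add lookup_single when_def)

lemma foldr_add_single:
  assumes "distinct vs" "set vs \<subseteq> {..<n}" "i \<in> set vs"
  shows "foldr (\<lambda>j A. (M j ^\<^sub>m Poly_Mapping.lookup (\<gamma> + Poly_Mapping.single i 1) j) * A) vs (1\<^sub>m \<delta>) =
    M i * foldr (\<lambda>j A. (M j ^\<^sub>m Poly_Mapping.lookup \<gamma> j) * A) vs (1\<^sub>m \<delta>)"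
  using assms
proof (induction vs)
  case (Cons v vs)
  let ?F = "\<lambda>\<gamma> vs. foldr (\<lambda>j A. (M j ^\<^sub>m Poly_Mapping.lookup \<gamma> j) * A) vs (1\<^sub>m \<delta>)"
  let ?P = "M v ^\<^sub>m Poly_Mapping.lookup \<gamma> v"
  have assoc: "A * B * ?F \<gamma> vs = A * (B * ?F \<gamma> vs)" if "A \<in> carrier_mat \<delta> \<delta>" "B \<in> carrier_mat \<delta> \<delta>" for A B
    using assoc_mult_mat[of A \<delta> \<delta> B \<delta> "?F \<gamma> vs" \<delta>] that by simp
  show ?case
  proof (cases "v = i")
    case True
    then have "i \<notin> set vs" using Cons.prems by simp
    then have "?F (\<gamma> + Poly_Mapping.single i 1) (v # vs) = ?P * M i * ?F \<gamma> vs"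
      using foldr_unchanged[of i vs \<gamma>] True by (simp add: lookup_add)
    also have "?P * M i = M i * ?P"
      by (rule commute_pow) (use Cons.prems True in auto)
    finally show ?thesis by (simp add: assoc)
  next
    case False
    then have "?F (\<gamma> + Poly_Mapping.single i 1) (v # vs) = ?P * (M i * ?F \<gamma> vs)"
      using Cons by (simp add: lookup_add lookup_single when_def)
    also have "\<dots> = ?P * M i * ?F \<gamma> vs" by (simp add: assoc)
    also have "?P * M i = M i * ?P"
      by (rule commute_pow) (use Cons.prems in auto)
    finally show ?thesis by (simp add: assoc)
  qed
qed simp

lemma mat_monomial_carrier [simp]: "mat_monomial n \<delta> M \<gamma> \<in> carrier_mat \<delta> \<delta>"
  by (simp add: mat_monomial_def)

lemma mat_monomial_add_single:
  "i < n \<Longrightarrow> mat_monomial n \<delta> M (\<gamma> + Poly_Mapping.single i 1) = M i * mat_monomial n \<delta> M \<gamma>"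
  unfolding mat_monomial_def by (rule foldr_add_single) auto

lemma mat_monomial_0: "mat_monomial n \<delta> M 0 = 1\<^sub>m \<delta>"
proof -
  have "foldr (\<lambda>i A. (M i ^\<^sub>m Poly_Mapping.lookup 0 i) * A) vs (1\<^sub>m \<delta>) = 1\<^sub>m \<delta>" for vs
  proof (induction vs)
    case (Cons v vs)
    have "M v ^\<^sub>m 0 = 1\<^sub>m \<delta>" using carrier_matD(1)[OF M_carrier[of v]] by simp
    then show ?case using Cons by simp
  qed simp
  then show ?thesis by (simp add: mat_monomial_def)
qed

definition orbit :: "nat monomial \<Rightarrow> nat \<Rightarrow> 'r" where
  "orbit \<gamma> j = (mat_monomial n \<delta> M \<gamma> *\<^sub>v unit_vec \<delta> 0) $ j"

lemma orbit_0: "j < \<delta> \<Longrightarrow> orbit 0 j = (if j = 0 then 1 else 0)"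
  by (simp add: orbit_def mat_monomial_0)

lemma orbit_add_single:
  assumes "i < n" "j < \<delta>"
  shows "orbit (\<gamma> + Poly_Mapping.single i 1) j = (\<Sum>k<\<delta>. M i $$ (j, k) * orbit \<gamma> k)"
proof -
  let ?v = "mat_monomial n \<delta> M \<gamma> *\<^sub>v unit_vec \<delta> 0"
  have v: "?v \<in> carrier_vec \<delta>" by (rule mult_mat_vec_carrier[OF mat_monomial_carrier]) simp
  have "orbit (\<gamma> + Poly_Mapping.single i 1) j = (M i *\<^sub>v ?v) $ j"
    unfolding orbit_def mat_monomial_add_single[OF assms(1)]
    by (subst assoc_mult_mat_vec[OF M_carrier mat_monomial_carrier]) simp_all
  also have "\<dots> = (\<Sum>k<\<delta>. M i $$ (j, k) * ?v $ k)"
    using assms v M_carrier[of i] carrier_matD[OF M_carrier[of i]] carrier_vecD[OF v]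
    by (simp add: scalar_prod_def atLeast0LessThan)
  finally show ?thesis by (simp add: orbit_def)
qed

definition nf :: "nat cpoly \<Rightarrow> nat \<Rightarrow> 'r" where
  "nf p j = (\<Sum>\<gamma> | \<gamma> \<in> monomials {..<n} \<and> pdiffs \<gamma> p \<noteq> 0. subst h z (taylor \<gamma> p) * orbit \<gamma> j)"

lemma nf_bounded:
  assumes "\<And>m. m \<in> Poly_Mapping.keys p \<Longrightarrow> mdeg m \<le> d"
  shows "nf p j = (\<Sum>\<gamma>\<in>bounded_monomials {..<n} d. subst h z (taylor \<gamma> p) * orbit \<gamma> j)"
  unfolding nf_def
proof (rule sum.mono_neutral_left)
  show "{\<gamma> \<in> monomials {..<n}. pdiffs \<gamma> p \<noteq> 0} \<subseteq> bounded_monomials {..<n} d"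
    using taylor_nonzero_bound[OF _ assms] by (auto simp: bounded_monomials_def taylor_eq_0_iff)
  show "\<forall>\<gamma>\<in>bounded_monomials {..<n} d - {\<gamma> \<in> monomials {..<n}. pdiffs \<gamma> p \<noteq> 0}.
      subst h z (taylor \<gamma> p) * orbit \<gamma> j = 0"
    by (auto simp: bounded_monomials_def taylor_def)
qed (simp add: finite_bounded_monomials)

lemma nf_Const: "j < \<delta> \<Longrightarrow> nf (Const c) j = (if j = 0 then h c else 0)"
proof -
  assume j: "j < \<delta>"
  have b: "bounded_monomials {..<n} 0 = {0}"
    by (auto simp: bounded_monomials_def mdeg_def monomials_def in_keys_iff
        intro!: poly_mapping_eqI)
  have "nf (Const c) j = (\<Sum>\<gamma>\<in>bounded_monomials {..<n} 0. subst h z (taylor \<gamma> (Const c)) * orbit \<gamma> j)"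
    by (rule nf_bounded) (auto simp: Const_def mdeg_def split: if_splits)
  then show ?thesis using j by (simp add: b orbit_0 h)
qed

lemma nf_add: "nf (p + q) j = nf p j + nf q j"
proof -
  obtain d where d: "\<forall>m\<in>Poly_Mapping.keys p. mdeg m \<le> d" using exists_degree_bound by blast
  obtain e where e: "\<forall>m\<in>Poly_Mapping.keys q. mdeg m \<le> e" using exists_degree_bound by blast
  have "mdeg m \<le> max d e" if "m \<in> Poly_Mapping.keys (p + q)" for m
    using d e that keys_add[of p q] by (auto simp: le_max_iff_disj)
  moreover have "mdeg m \<le> max d e" if "m \<in> Poly_Mapping.keys p" for m
    using d that by (auto simp: le_max_iff_disj)
  moreover have "mdeg m \<le> max d e" if "m \<in> Poly_Mapping.keys q" for m
    using e that by (auto simp: le_max_iff_disj)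
  ultimately show ?thesis
    by (simp add: nf_bounded[of _ "max d e"] taylor_add S.hom_add distrib_right sum.distrib)
qed

text \<open>
  Multiplication by a variable acts as \<open>z\<^sub>i + M\<^sub>i\<close>.  The Leibniz rule splits the sum into \<open>z\<^sub>i\<close> times the
  normal form and a sum over the \<open>\<gamma>\<close> in which \<open>i\<close> occurs; the substitution \<open>\<gamma> \<mapsto> \<gamma> + e\<^sub>i\<close> turns the
  latter into the sum for \<open>p\<close> with one more factor \<open>M\<^sub>i\<close>.
\<close>

lemma nf_Var_mult:
  assumes i: "i < n" and j: "j < \<delta>"
  shows "nf (Var i * p) j = z i * nf p j + (\<Sum>k<\<delta>. M i $$ (j, k) * nf p k)"
proof -
  let ?e = "Poly_Mapping.single i (1::nat)"
  let ?T = "\<lambda>\<gamma>. subst h z (taylor \<gamma> p)"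
  let ?B = "bounded_monomials {..<n}"
  obtain d where d: "\<forall>m\<in>Poly_Mapping.keys p. mdeg m \<le> d" using exists_degree_bound by blast
  have d': "mdeg m \<le> Suc d" if "m \<in> Poly_Mapping.keys (Var i * p)" for m
    using keys_Var_mult_bound[OF _ that] d by blast
  have fin: "finite (?B k)" for k by (simp add: finite_bounded_monomials)
  have img: "{\<gamma> \<in> ?B (Suc d). Poly_Mapping.lookup \<gamma> i \<noteq> 0} = (\<lambda>\<gamma>. \<gamma> + ?e) ` ?B d"
  proof (intro equalityI subsetI)
    fix \<gamma> assume \<gamma>: "\<gamma> \<in> {\<gamma> \<in> ?B (Suc d). Poly_Mapping.lookup \<gamma> i \<noteq> 0}"
    then have eq: "\<gamma> - ?e + ?e = \<gamma>" by (intro minus_single_add) simp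
    have "mdeg \<gamma> = Suc (mdeg (\<gamma> - ?e))"
      using mdeg_add[of "\<gamma> - ?e" ?e] unfolding eq by simp
    moreover have "Poly_Mapping.keys (\<gamma> - ?e) \<subseteq> Poly_Mapping.keys \<gamma>"
      by (auto simp: in_keys_iff lookup_minus)
    ultimately have "\<gamma> - ?e \<in> ?B d"
      using \<gamma> by (auto simp: bounded_monomials_def monomials_def)
    with eq show "\<gamma> \<in> (\<lambda>\<gamma>. \<gamma> + ?e) ` ?B d" by (intro image_eqI[of _ _ "\<gamma> - ?e"]) simp_all
  next
    fix \<gamma> assume "\<gamma> \<in> (\<lambda>\<gamma>. \<gamma> + ?e) ` ?B d"
    then show "\<gamma> \<in> {\<gamma> \<in> ?B (Suc d). Poly_Mapping.lookup \<gamma> i \<noteq> 0}"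
      using i by (auto simp: bounded_monomials_def monomials_def mdeg_add lookup_add keys_add_nat)
  qed
  have "nf (Var i * p) j = (\<Sum>\<gamma>\<in>?B (Suc d). subst h z (taylor \<gamma> (Var i * p)) * orbit \<gamma> j)"
    using d' by (rule nf_bounded)
  also have "\<dots> = (\<Sum>\<gamma>\<in>?B (Suc d). z i * (?T \<gamma> * orbit \<gamma> j)) +
      (\<Sum>\<gamma>\<in>?B (Suc d). if Poly_Mapping.lookup \<gamma> i = 0 then 0 else ?T (\<gamma> - ?e) * orbit \<gamma> j)"
    unfolding sum.distrib[symmetric]
    by (rule sum.cong) (simp_all add: taylor_Var_mult S.hom_add S.hom_mult h distrib_right mult.assoc)
  also have "(\<Sum>\<gamma>\<in>?B (Suc d). z i * (?T \<gamma> * orbit \<gamma> j)) = z i * nf p j"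
    using d by (subst nf_bounded[of p "Suc d"]) (auto simp: sum_distrib_left intro: le_SucI)
  also have "(\<Sum>\<gamma>\<in>?B (Suc d). if Poly_Mapping.lookup \<gamma> i = 0 then 0 else ?T (\<gamma> - ?e) * orbit \<gamma> j) =
      (\<Sum>\<gamma>\<in>{\<gamma> \<in> ?B (Suc d). Poly_Mapping.lookup \<gamma> i \<noteq> 0}. ?T (\<gamma> - ?e) * orbit \<gamma> j)"
    using fin by (intro sum.mono_neutral_cong_right) auto
  also have "\<dots> = (\<Sum>\<gamma>\<in>?B d. ?T \<gamma> * orbit (\<gamma> + ?e) j)"
    unfolding img by (subst sum.reindex) (auto simp: inj_on_def)
  also have "\<dots> = (\<Sum>\<gamma>\<in>?B d. \<Sum>k<\<delta>. M i $$ (j, k) * (?T \<gamma> * orbit \<gamma> k))"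
    by (simp add: orbit_add_single[OF i j] sum_distrib_left mult_ac del: One_nat_def)
  also have "\<dots> = (\<Sum>k<\<delta>. M i $$ (j, k) * nf p k)"
    using d by (subst sum.swap) (simp add: nf_bounded[of p d] sum_distrib_left)
  finally show ?thesis .
qed

lemma nf_smult: "nf (smult c p) j = h c * nf p j"
proof -
  obtain d where d: "\<forall>m\<in>Poly_Mapping.keys p. mdeg m \<le> d" using exists_degree_bound by blast
  then have "mdeg m \<le> d" if "m \<in> Poly_Mapping.keys (smult c p)" for m
    using that by (simp add: in_keys_iff)
  then show ?thesis
    using d by (simp add: nf_bounded[of _ d] taylor_smult h sum_distrib_left mult.assoc)
qed

lemma nf_diff: "nf (p - q) j = nf p j - nf q j"
proof -
  have "p - q = p + smult (- 1) q"
    by (rule poly_mapping_eqI) (simp add: lookup_add lookup_minus)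
  then show ?thesis by (simp only: nf_add nf_smult) (simp add: h.hom_uminus)
qed

lemma nf_sum: "nf (sum g A) j = (\<Sum>x\<in>A. nf (g x) j)"
proof -
  have "nf 0 j = 0" using nf_smult[of 0 0] by simp
  then show ?thesis
    by (induction A rule: infinite_finite_induct) (simp_all add: nf_add)
qed

lemma nf_shifted_Var_mult:
  assumes "i < n" "j < \<delta>"
  shows "nf ((Var i - Const c) * p) j = (z i - h c) * nf p j + (\<Sum>k<\<delta>. M i $$ (j, k) * nf p k)"
  using nf_Var_mult[OF assms, of p]
  by (simp add: left_diff_distrib nf_diff nf_smult flip: smult_conv_mult)

end


section \<open>Dual bases and multiplication matrices\<close>

lemma shifted_monomial_0 [simp]: "shifted_monomial n \<xi> 0 = 1"
  by (simp add: shifted_monomial_def)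

lemma shifted_monomial_add_single:
  assumes "i < n"
  shows "shifted_monomial n \<xi> (\<beta> + Poly_Mapping.single i 1) =
    (Var i - Const (\<xi> i)) * shifted_monomial n \<xi> \<beta>"
proof -
  have "shifted_monomial n \<xi> (\<beta> + Poly_Mapping.single i 1) =
    (\<Prod>j<n. (Var j - Const (\<xi> j)) ^ Poly_Mapping.lookup \<beta> j * (if j = i then Var j - Const (\<xi> j) else 1))"
    unfolding shifted_monomial_def
    by (rule prod.cong) (auto simp: lookup_add lookup_single when_def power_add)
  also have "\<dots> = shifted_monomial n \<xi> \<beta> * (Var i - Const (\<xi> i))"
    using assms by (simp add: prod.distrib shifted_monomial_def prod.delta)
  finally show ?thesis by (simp add: mult.commute)
qed

lemma shifted_monomial_polys: "shifted_monomial n \<xi> \<beta> \<in> polys UNIV {..<n}"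
  unfolding shifted_monomial_def by (intro cpolys_closed) simp

lemma eval_taylor_shifted_mult:
  "eval \<xi> (taylor \<gamma> ((Var i - Const (\<xi> i)) * p)) =
    (if Poly_Mapping.lookup \<gamma> i = 0 then 0 else eval \<xi> (taylor (\<gamma> - Poly_Mapping.single i 1) p))"
proof -
  have "(Var i - Const (\<xi> i)) * p = Var i * p + smult (- \<xi> i) p"
    by (simp add: smult_conv_mult Const.hom_uminus algebra_simps)
  then have "taylor \<gamma> ((Var i - Const (\<xi> i)) * p) = taylor \<gamma> (Var i * p) + smult (- \<xi> i) (taylor \<gamma> p)"
    by (simp only: taylor_add taylor_smult)
  then show ?thesis
    by (simp only: taylor_Var_mult eval.hom_add eval.hom_mult eval_Var eval_smult) simp
qed

lemma eval_taylor_shifted_monomial: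
  assumes "\<beta> \<in> monomials {..<n}"
  shows "eval \<xi> (taylor \<gamma> (shifted_monomial n \<xi> \<beta>)) = (if \<gamma> = \<beta> then 1 else 0)"
  using assms
proof (induction arbitrary: \<gamma> rule: monomial_induct)
  case 0
  show ?case
  proof (cases "\<gamma> = 0")
    case False
    then show ?thesis using taylor_Const[of \<gamma> 1] by simp
  qed simp
next
  case (add_single \<beta> i)
  have "\<gamma> = \<beta> + Poly_Mapping.single i 1 \<longleftrightarrow>
      Poly_Mapping.lookup \<gamma> i \<noteq> 0 \<and> \<gamma> - Poly_Mapping.single i 1 = \<beta>"
  proof
    assume "\<gamma> = \<beta> + Poly_Mapping.single i 1"
    then show "Poly_Mapping.lookup \<gamma> i \<noteq> 0 \<and> \<gamma> - Poly_Mapping.single i 1 = \<beta>"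
      by (simp add: lookup_add)
  next
    assume "Poly_Mapping.lookup \<gamma> i \<noteq> 0 \<and> \<gamma> - Poly_Mapping.single i 1 = \<beta>"
    then show "\<gamma> = \<beta> + Poly_Mapping.single i 1" using minus_single_add[of \<gamma> i] by simp
  qed
  then show ?case
    using add_single.hyps(2)
    by (simp only: shifted_monomial_add_single lessThan_iff eval_taylor_shifted_mult add_single.IH) simp
qed

lemma apply_functional_taylor:
  "apply_functional \<xi> \<Lambda> p =
    (\<Sum>\<beta>\<in>Poly_Mapping.keys \<Lambda>. Poly_Mapping.lookup \<Lambda> \<beta> * mfact \<beta> * eval \<xi> (taylor \<beta> p))"
  by (simp add: apply_functional_def taylor_def)

lemma apply_functional_add:
  "apply_functional \<xi> \<Lambda> (p + q) = apply_functional \<xi> \<Lambda> p + apply_functional \<xi> \<Lambda> q"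
  by (simp add: apply_functional_taylor taylor_add eval.hom_add distrib_left sum.distrib)

lemma apply_functional_smult: "apply_functional \<xi> \<Lambda> (smult c p) = c * apply_functional \<xi> \<Lambda> p"
  by (simp add: apply_functional_taylor taylor_smult sum_distrib_left mult_ac)

lemma apply_functional_diff:
  "apply_functional \<xi> \<Lambda> (p - q) = apply_functional \<xi> \<Lambda> p - apply_functional \<xi> \<Lambda> q"
proof -
  have "p - q = p + smult (- 1) q" by (rule poly_mapping_eqI) (simp add: lookup_add lookup_minus)
  then show ?thesis by (simp only: apply_functional_add apply_functional_smult) simp
qed

lemma apply_functional_sum:
  "apply_functional \<xi> \<Lambda> (sum g A) = (\<Sum>x\<in>A. apply_functional \<xi> \<Lambda> (g x))"
proof -
  have "apply_functional \<xi> \<Lambda> 0 = 0" using apply_functional_smult[of \<xi> \<Lambda> 0 0] by simp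
  then show ?thesis
    by (induction A rule: infinite_finite_induct) (simp_all add: apply_functional_add)
qed

lemma apply_functional_shifted_monomial:
  assumes "\<beta> \<in> monomials {..<n}"
  shows "apply_functional \<xi> \<Lambda> (shifted_monomial n \<xi> \<beta>) = mfact \<beta> * Poly_Mapping.lookup \<Lambda> \<beta>"
proof -
  have "apply_functional \<xi> \<Lambda> (shifted_monomial n \<xi> \<beta>) =
      (\<Sum>\<gamma>\<in>Poly_Mapping.keys \<Lambda>. if \<gamma> = \<beta> then Poly_Mapping.lookup \<Lambda> \<gamma> * mfact \<gamma> else 0)"
    unfolding apply_functional_taylor eval_taylor_shifted_monomial[OF assms]
    by (rule sum.cong) auto
  also have "\<dots> = mfact \<beta> * Poly_Mapping.lookup \<Lambda> \<beta>"
    by (simp add: sum.delta in_keys_iff mult.commute)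
  finally show ?thesis .
qed

locale primal_dual_pair =
  fixes n :: nat and \<xi> :: "nat \<Rightarrow> complex" and Q :: "nat cpoly set" and \<delta> :: nat
    and \<alpha> :: "nat \<Rightarrow> nat monomial" and \<Lambda> :: "nat \<Rightarrow> nat cpoly"
    and \<nu> :: "nat monomial \<Rightarrow> nat monomial \<Rightarrow> complex"
  assumes orthogonal: "orthogonal_pair n \<xi> Q \<delta> \<alpha> \<Lambda> \<nu>"
    and ideal_Q: "ideal Q (poly_ring {..<n})"
begin

abbreviation E :: "nat monomial set" where "E \<equiv> \<alpha> ` {..<\<delta>}"
abbreviation b :: "nat \<Rightarrow> nat cpoly" where "b k \<equiv> shifted_monomial n \<xi> (\<alpha> k)"
abbreviation x :: "nat \<Rightarrow> nat cpoly" where "x i \<equiv> Var i - Const (\<xi> i)"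
abbreviation L :: "nat \<Rightarrow> nat cpoly \<Rightarrow> complex" where "L l \<equiv> apply_functional \<xi> (\<Lambda> l)"

lemmas pair = orthogonal[unfolded orthogonal_pair_def Let_def]
lemmas Q = idealD_poly_ring[OF ideal_Q]

lemma \<delta>_pos: "0 < \<delta>" and E_monomials: "E \<subseteq> monomials {..<n}"
  and basis: "quotient_basis {..<n} Q \<delta> b"
  and \<alpha>_0: "\<alpha> 0 = 0" and connected: "connected_to_1 n E"
  and span_\<Lambda>: "cpoly.span (\<Lambda> ` {..<\<delta>}) = dual_space n \<xi> Q"
  and dual_all: "\<forall>i<\<delta>. \<forall>j<\<delta>. L i (b j) = (if i = j then 1 else 0)"
  and \<Lambda>_form: "\<forall>i<\<delta>. \<Lambda> i = Poly_Mapping.single (\<alpha> i) (1 / mfact (\<alpha> i)) +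
          (\<Sum>\<beta> | \<beta> \<in> monomials {..<n} \<and> mdeg \<beta> \<le> mdeg (\<alpha> i) \<and> \<beta> \<notin> E.
             Poly_Mapping.single \<beta> (\<nu> (\<alpha> i) \<beta> / mfact \<beta>))"
  and \<nu>_0: "\<forall>i<\<delta>. \<forall>\<beta>\<in>monomials {..<n}. \<beta> \<notin> E \<and> mdeg \<beta> > mdeg (\<alpha> i) \<longrightarrow> \<nu> (\<alpha> i) \<beta> = 0"
  and ord_sorted: "\<forall>i j. i \<le> j \<and> j < \<delta> \<longrightarrow> ord_functional (\<Lambda> i) \<le> ord_functional (\<Lambda> j)"
  using pair by - (elim conjE, assumption)+

lemma dual: "i < \<delta> \<Longrightarrow> j < \<delta> \<Longrightarrow> L i (b j) = (if i = j then 1 else 0)"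
  using dual_all by simp

lemma \<alpha>_monomials: "k < \<delta> \<Longrightarrow> \<alpha> k \<in> monomials {..<n}"
  using E_monomials by auto

lemma L_vanishes: "l < \<delta> \<Longrightarrow> q \<in> Q \<Longrightarrow> L l q = 0"
proof -
  assume "l < \<delta>" "q \<in> Q"
  have "\<Lambda> l \<in> dual_space n \<xi> Q"
    unfolding span_\<Lambda>[symmetric] using \<open>l < \<delta>\<close> by (intro cpoly.span_base) simp
  then show ?thesis using \<open>q \<in> Q\<close> by (simp add: dual_space_def)
qed

lemma lookup_\<Lambda>:
  assumes "l < \<delta>"
  shows "Poly_Mapping.lookup (\<Lambda> l) \<beta> = (if \<beta> = \<alpha> l then 1 / mfact (\<alpha> l) else 0) +
    (if \<beta> \<in> monomials {..<n} \<and> mdeg \<beta> \<le> mdeg (\<alpha> l) \<and> \<beta> \<notin> E then \<nu> (\<alpha> l) \<beta> / mfact \<beta> else 0)"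
proof -
  let ?S = "{\<beta>. \<beta> \<in> monomials {..<n} \<and> mdeg \<beta> \<le> mdeg (\<alpha> l) \<and> \<beta> \<notin> E}"
  have fin: "finite ?S"
    by (rule finite_subset[OF _ finite_bounded_monomials[of "{..<n}" "mdeg (\<alpha> l)"]])
       (auto simp: bounded_monomials_def)
  have "Poly_Mapping.lookup (\<Lambda> l) \<beta> = Poly_Mapping.lookup (Poly_Mapping.single (\<alpha> l) (1 / mfact (\<alpha> l)) +
          (\<Sum>\<beta>\<in>?S. Poly_Mapping.single \<beta> (\<nu> (\<alpha> l) \<beta> / mfact \<beta>))) \<beta>"
    using \<Lambda>_form[rule_format, OF assms] by (rule arg_cong)
  also have "\<dots> = (if \<beta> = \<alpha> l then 1 / mfact (\<alpha> l) else 0) +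
      (\<Sum>\<gamma>\<in>?S. if \<gamma> = \<beta> then \<nu> (\<alpha> l) \<gamma> / mfact \<gamma> else 0)"
    by (simp add: lookup_add lookup_sum lookup_single when_def eq_commute)
  also have "(\<Sum>\<gamma>\<in>?S. if \<gamma> = \<beta> then \<nu> (\<alpha> l) \<gamma> / mfact \<gamma> else 0) = (if \<beta> \<in> ?S then \<nu> (\<alpha> l) \<beta> / mfact \<beta> else 0)"
    by (rule sum.delta[OF fin])
  finally show ?thesis by simp
qed

lemma L_shifted_monomial:
  assumes "l < \<delta>" "\<beta> \<in> monomials {..<n}"
  shows "L l (shifted_monomial n \<xi> \<beta>) = (if \<beta> \<in> E then (if \<beta> = \<alpha> l then 1 else 0) else \<nu> (\<alpha> l) \<beta>)"
proof -
  have L: "L l (shifted_monomial n \<xi> \<beta>) = mfact \<beta> * Poly_Mapping.lookup (\<Lambda> l) \<beta>"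
    by (rule apply_functional_shifted_monomial[OF assms(2)])
  have \<alpha>E: "\<alpha> l \<in> E" using assms(1) by simp
  show ?thesis
  proof (cases "\<beta> \<in> E")
    case True
    then show ?thesis by (simp add: L lookup_\<Lambda>[OF assms(1)])
  next
    case False
    then have ne: "\<beta> \<noteq> \<alpha> l" using \<alpha>E by metis
    show ?thesis
    proof (cases "mdeg \<beta> \<le> mdeg (\<alpha> l)")
      case True
      then show ?thesis using False ne assms(2) by (simp add: L lookup_\<Lambda>[OF assms(1)])
    next
      case less: False
      then have "\<nu> (\<alpha> l) \<beta> = 0" using \<nu>_0 assms False by simp
      then show ?thesis using False ne less by (simp add: L lookup_\<Lambda>[OF assms(1)])
    qed
  qed
qed

lemma ord_\<Lambda>:
  assumes "l < \<delta>"
  shows "ord_functional (\<Lambda> l) = mdeg (\<alpha> l)"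
proof -
  have le: "mdeg \<beta> \<le> mdeg (\<alpha> l)" if "\<beta> \<in> Poly_Mapping.keys (\<Lambda> l)" for \<beta>
    using that unfolding in_keys_iff lookup_\<Lambda>[OF assms] by (auto split: if_splits)
  have "\<alpha> l \<in> Poly_Mapping.keys (\<Lambda> l)"
    using assms unfolding in_keys_iff lookup_\<Lambda>[OF assms] by simp
  then show ?thesis
    unfolding ord_functional_def using le by (intro Max_eqI) auto
qed

lemma mdeg_sorted: "i \<le> j \<Longrightarrow> j < \<delta> \<Longrightarrow> mdeg (\<alpha> i) \<le> mdeg (\<alpha> j)"
  using ord_sorted[rule_format, of i j] ord_\<Lambda>[of i] ord_\<Lambda>[of j] by simp

text \<open>
  The matrix of multiplication by \<open>x\<^sub>i - \<xi>\<^sub>i\<close> on \<open>\<complex>[x]/Q\<close>, see \<open>reduce\<close>.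
\<close>

definition A :: "nat \<Rightarrow> nat \<Rightarrow> nat \<Rightarrow> complex" where
  "A i l k = L l (x i * b k)"

text \<open>
  By the shape of the dual basis, \<open>A i l k\<close> is the coefficient in \<open>\<Lambda> l\<close> of
  \<open>(1/\<beta>!) \<partial>\<^sup>\<beta>\<close> for \<open>\<beta> = \<alpha> k + e\<^sub>i\<close>.  The order of \<open>\<Lambda> l\<close> is the degree of \<open>\<alpha> l\<close>, and the orders increase with \<open>l\<close>; for
  \<open>l \<le> k\<close> the degree of \<open>\<beta>\<close> therefore exceeds that order, and the entry is zero.
\<close>

lemma A_eq:
  assumes "i < n" "l < \<delta>" "k < \<delta>"
  shows "A i l k = (let \<beta> = \<alpha> k + Poly_Mapping.single i 1 in
    if l \<le> k then 0 else if \<alpha> l = \<beta> then 1 else if \<beta> \<in> E then 0 else \<nu> (\<alpha> l) \<beta>)"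
proof -
  let ?\<beta> = "\<alpha> k + Poly_Mapping.single i 1"
  have \<beta>: "?\<beta> \<in> monomials {..<n}"
    using \<alpha>_monomials[OF assms(3)] assms(1) by (auto simp: monomials_def keys_add_nat)
  have A: "A i l k = (if ?\<beta> \<in> E then (if ?\<beta> = \<alpha> l then 1 else 0) else \<nu> (\<alpha> l) ?\<beta>)"
    unfolding A_def shifted_monomial_add_single[OF assms(1), symmetric]
    by (rule L_shifted_monomial[OF assms(2) \<beta>])
  have deg: "mdeg ?\<beta> = Suc (mdeg (\<alpha> k))" by (simp add: mdeg_add)
  have \<alpha>E: "\<alpha> l \<in> E" using assms by simp
  show ?thesis
  proof (cases "l \<le> k")
    case True
    then have less: "mdeg (\<alpha> l) < mdeg ?\<beta>" using mdeg_sorted[OF True assms(3)] deg by simp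
    then have "?\<beta> \<noteq> \<alpha> l" by auto
    moreover have "\<nu> (\<alpha> l) ?\<beta> = 0" if "?\<beta> \<notin> E" using \<nu>_0 assms(2) \<beta> less that by blast
    ultimately show ?thesis using True A by simp
  next
    case False
    then show ?thesis using A \<alpha>E by (auto simp: Let_def)
  qed
qed

lemma reduce:
  assumes "p \<in> polys UNIV {..<n}"
  shows "p - (\<Sum>k<\<delta>. smult (L k p) (b k)) \<in> Q"
proof -
  obtain c where c: "p - (\<Sum>k<\<delta>. smult (c k) (b k)) \<in> Q"
    using basis assms unfolding quotient_basis_def by blast
  have "c l = L l p" if "l < \<delta>" for l
  proof -
    have "0 = L l (p - (\<Sum>k<\<delta>. smult (c k) (b k)))" using L_vanishes[OF that c] by simp
    also have "\<dots> = L l p - (\<Sum>k<\<delta>. c k * (if l = k then 1 else 0))"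
      using that by (simp add: apply_functional_diff apply_functional_sum apply_functional_smult dual)
    also have "(\<Sum>k<\<delta>. c k * (if l = k then 1 else 0)) = (\<Sum>k<\<delta>. if l = k then c k else 0)"
      by (rule sum.cong) simp_all
    also have "\<dots> = c l" using that by (simp add: sum.delta')
    finally show ?thesis by simp
  qed
  then have "(\<Sum>k<\<delta>. smult (c k) (b k)) = (\<Sum>k<\<delta>. smult (L k p) (b k))"
    by (intro sum.cong) simp_all
  with c show ?thesis by simp
qed

lemma x_polys: "i < n \<Longrightarrow> x i \<in> polys UNIV {..<n}"
  by (intro cpolys_closed) simp_all

lemma L_mult:
  assumes "p \<in> polys UNIV {..<n}" "i < n" "l < \<delta>"
  shows "L l (x i * p) = (\<Sum>k<\<delta>. A i l k * L k p)"
proof -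
  let ?r = "p - (\<Sum>k<\<delta>. smult (L k p) (b k))"
  have "x i * ?r \<in> Q" by (rule Q(4)[OF reduce[OF assms(1)] x_polys[OF assms(2)]])
  then have "0 = L l (x i * ?r)" using L_vanishes[OF assms(3)] by simp
  also have "x i * ?r = x i * p - (\<Sum>k<\<delta>. smult (L k p) (x i * b k))"
    by (simp add: right_diff_distrib sum_distrib_left)
  also have "L l \<dots> = L l (x i * p) - (\<Sum>k<\<delta>. A i l k * L k p)"
    by (simp add: apply_functional_diff apply_functional_sum apply_functional_smult A_def mult.commute)
  finally show ?thesis by simp
qed

text \<open>
  Both sides are the value of \<open>\<Lambda> l\<close> at the product of \<open>b m\<close> with \<open>x i\<close> and \<open>x j\<close>.
\<close>

lemma A_commute:
  assumes "i < n" "j < n" "l < \<delta>" "m < \<delta>"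
  shows "(\<Sum>k<\<delta>. A i l k * A j k m) = (\<Sum>k<\<delta>. A j l k * A i k m)"
proof -
  have "(\<Sum>k<\<delta>. A i l k * A j k m) = L l (x i * (x j * b m))"
    using L_mult[of "x j * b m" i l] assms
    by (simp add: A_def cpolys_closed shifted_monomial_polys)
  also have "\<dots> = L l (x j * (x i * b m))" by (simp only: mult.left_commute)
  also have "\<dots> = (\<Sum>k<\<delta>. A j l k * A i k m)"
    using L_mult[of "x i * b m" j l] assms
    by (simp add: A_def cpolys_closed shifted_monomial_polys)
  finally show ?thesis .
qed

end

section \<open>Isolated primary components\<close>

text \<open>
  The radical of a component other than \<open>Q\<close> is not contained in the maximal ideal of the point, so the
  component has an element that does not vanish there; \<open>s\<close> is the product of such elements.
\<close>

lemma isolated_primary_component_localizes: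
  assumes "isolated_primary_component (poly_ring V) I (max_ideal_at V a) Q"
  shows "ideal Q (poly_ring V)" "I \<subseteq> Q"
    "\<exists>s\<in>polys UNIV V. eval a s \<noteq> 0 \<and> (\<forall>q\<in>Q. s * q \<in> I)"
proof -
  obtain \<Q> where dec: "minimal_primary_decomposition (poly_ring V) I \<Q>" and Q: "Q \<in> \<Q>"
    and iso: "\<forall>Q'\<in>\<Q>. radical (poly_ring V) Q' \<subseteq> max_ideal_at V a \<longrightarrow> Q' = Q"
    using assms unfolding isolated_primary_component_def by blast
  have fin: "finite \<Q>" and id: "\<And>Q. Q \<in> \<Q> \<Longrightarrow> ideal Q (poly_ring V)"
    and I: "I = polys UNIV V \<inter> \<Inter>\<Q>"
    using dec by (auto simp: minimal_primary_decomposition_def primary_ideal_def)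
  show idQ: "ideal Q (poly_ring V)" using id Q .
  show "I \<subseteq> Q" using I Q by auto
  have "\<exists>g. g \<in> Q' \<and> eval a g \<noteq> 0" if Q': "Q' \<in> \<Q> - {Q}" for Q'
  proof -
    obtain y where y: "y \<in> radical (poly_ring V) Q'" "y \<notin> max_ideal_at V a" using iso Q' by auto
    then obtain k where "y ^ k \<in> Q'" "y \<in> polys UNIV V" by (auto simp: radical_def)
    moreover have "eval a (y ^ k) \<noteq> 0"
      using y(2) \<open>y \<in> polys UNIV V\<close> by (simp add: max_ideal_at_def eval.hom_power)
    ultimately show ?thesis by blast
  qed
  then have "\<forall>Q'\<in>\<Q> - {Q}. \<exists>g. g \<in> Q' \<and> eval a g \<noteq> 0" by blast
  from bchoice[OF this] obtain g where g: "\<forall>Q'\<in>\<Q> - {Q}. g Q' \<in> Q' \<and> eval a (g Q') \<noteq> 0" ..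
  have gP: "g Q' \<in> polys UNIV V" if "Q' \<in> \<Q> - {Q}" for Q'
    using that g idealD_poly_ring(1)[OF id] by blast
  define s where "s = prod g (\<Q> - {Q})"
  have sP: "s \<in> polys UNIV V" unfolding s_def by (intro cpolys_closed gP)
  have "s * q \<in> Q'" if q: "q \<in> Q" and Q': "Q' \<in> \<Q>" for q Q'
  proof (cases "Q' = Q")
    case True
    then show ?thesis using idealD_poly_ring(4)[OF idQ q sP] by simp
  next
    case False
    then have Q'': "Q' \<in> \<Q> - {Q}" using Q' by simp
    have "s * q = (prod g (\<Q> - {Q} - {Q'}) * q) * g Q'"
      unfolding s_def using fin by (subst prod.remove[OF _ Q'']) (simp_all add: mult_ac)
    moreover have "prod g (\<Q> - {Q} - {Q'}) * q \<in> polys UNIV V"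
      using idealD_poly_ring(1)[OF idQ q] by (intro cpolys_closed gP) auto
    ultimately show ?thesis using idealD_poly_ring(4)[OF id[OF Q']] g Q'' by simp
  qed
  moreover have "s * q \<in> polys UNIV V" if "q \<in> Q" for q
    using sP idealD_poly_ring(1)[OF idQ that] by (intro cpolys_closed)
  ultimately have "\<forall>q\<in>Q. s * q \<in> I" unfolding I by blast
  moreover have "eval a s \<noteq> 0"
    using g fin by (simp add: s_def eval.hom_prod)
  ultimately show "\<exists>s\<in>polys UNIV V. eval a s \<noteq> 0 \<and> (\<forall>q\<in>Q. s * q \<in> I)" using sP by blast
qed


section \<open>The parametric system\<close>

lemma mult_matrix_carrier [simp]: "mult_matrix \<delta> \<alpha> i \<in> carrier_mat \<delta> \<delta>"
  by (simp add: mult_matrix_def)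

lemma mult_matrix_index:
  "l < \<delta> \<Longrightarrow> k < \<delta> \<Longrightarrow> mult_matrix \<delta> \<alpha> i $$ (l, k) =
    (let \<beta> = \<alpha> k + Poly_Mapping.single i 1 in
     if l \<le> k then 0 else if \<alpha> l = \<beta> then 1 else if \<beta> \<in> \<alpha> ` {..<\<delta>} then 0 else Var (Mu (\<alpha> l) \<beta>))"
  by (simp add: mult_matrix_def)

lemma mult_matrix_power_conv: "mult_matrix_power n \<delta> \<alpha> = mat_monomial n \<delta> (mult_matrix \<delta> \<alpha>)"
  by (simp add: fun_eq_iff mult_matrix_power_def mat_monomial_def)

lemma map_mat_monomial:
  fixes \<phi> :: "'a::comm_ring_1 \<Rightarrow> 'r::comm_ring_1"
  assumes "comm_ring_hom \<phi>" "\<And>i. M i \<in> carrier_mat \<delta> \<delta>"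
  shows "mat_monomial n \<delta> M \<gamma> \<in> carrier_mat \<delta> \<delta>"
    and "map_mat \<phi> (mat_monomial n \<delta> M \<gamma>) = mat_monomial n \<delta> (\<lambda>i. map_mat \<phi> (M i)) \<gamma>"
proof -
  interpret comm_ring_hom \<phi> by fact
  let ?F = "\<lambda>vs. foldr (\<lambda>i A. (M i ^\<^sub>m Poly_Mapping.lookup \<gamma> i) * A) vs (1\<^sub>m \<delta>)"
  have c: "?F vs \<in> carrier_mat \<delta> \<delta>" for vs
    by (induction vs) (simp_all add: mult_carrier_mat[OF pow_carrier_mat[OF assms(2)]])
  then show "mat_monomial n \<delta> M \<gamma> \<in> carrier_mat \<delta> \<delta>" by (simp add: mat_monomial_def)
  have "map_mat \<phi> (?F vs) = foldr (\<lambda>i A. (map_mat \<phi> (M i) ^\<^sub>m Poly_Mapping.lookup \<gamma> i) * A) vs (1\<^sub>m \<delta>)" for vs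
  proof (induction vs)
    case Nil
    show ?case by (simp add: mat_hom_one)
  next
    case (Cons v vs)
    then show ?case
      by (simp add: mat_hom_mult[OF pow_carrier_mat[OF assms(2)] c] mat_hom_pow[OF assms(2)])
  qed
  then show "map_mat \<phi> (mat_monomial n \<delta> M \<gamma>) = mat_monomial n \<delta> (\<lambda>i. map_mat \<phi> (M i)) \<gamma>"
    by (simp add: mat_monomial_def)
qed

subsection \<open>Coefficients and variables of the system\<close>

lemma mat_monomial_polys:
  assumes K: "subring K complex_ring" and M: "\<And>i. i < n \<Longrightarrow> M i \<in> carrier_mat \<delta> \<delta>"
    and MK: "\<And>i r c. i < n \<Longrightarrow> r < \<delta> \<Longrightarrow> c < \<delta> \<Longrightarrow> M i $$ (r, c) \<in> polys K V"
  shows "\<forall>r<\<delta>. \<forall>c<\<delta>. mat_monomial n \<delta> M \<gamma> $$ (r, c) \<in> polys K V"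
proof -
  define ok where "ok A \<longleftrightarrow> A \<in> carrier_mat \<delta> \<delta> \<and> (\<forall>r<\<delta>. \<forall>c<\<delta>. A $$ (r, c) \<in> polys K V)" for A
  have one: "ok (1\<^sub>m \<delta>)" by (simp add: ok_def polys_zero[OF K] polys_one[OF K])
  have mult: "ok (A * B)" if "ok A" "ok B" for A B
  proof -
    have A: "A \<in> carrier_mat \<delta> \<delta>" "\<And>r c. r < \<delta> \<Longrightarrow> c < \<delta> \<Longrightarrow> A $$ (r, c) \<in> polys K V"
      and B: "B \<in> carrier_mat \<delta> \<delta>" "\<And>r c. r < \<delta> \<Longrightarrow> c < \<delta> \<Longrightarrow> B $$ (r, c) \<in> polys K V"
      using that by (simp_all add: ok_def)
    have "(A * B) $$ (r, c) \<in> polys K V" if "r < \<delta>" "c < \<delta>" for r c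
    proof -
      have "(A * B) $$ (r, c) = (\<Sum>k<\<delta>. A $$ (r, k) * B $$ (k, c))"
        using A(1) B(1) that carrier_matD[OF A(1)] carrier_matD[OF B(1)]
        by (simp add: scalar_prod_def atLeast0LessThan)
      also have "\<dots> \<in> polys K V" using that A(2) B(2) by (intro polys_closed[OF K]) simp_all
      finally show ?thesis .
    qed
    then show ?thesis using mult_carrier_mat[OF A(1) B(1)] by (simp add: ok_def)
  qed
  have ok_M: "ok (M i)" if "i < n" for i using M MK that by (simp add: ok_def)
  have pow: "ok (M i ^\<^sub>m k)" if "i < n" for i k
  proof (induction k)
    case 0
    have "M i ^\<^sub>m 0 = 1\<^sub>m \<delta>" using carrier_matD(1)[OF M[OF that]] by simp
    then show ?case using one by simp
  qed (simp add: mult ok_M[OF that])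
  have "ok (foldr (\<lambda>i A. (M i ^\<^sub>m Poly_Mapping.lookup \<gamma> i) * A) vs (1\<^sub>m \<delta>))" if "set vs \<subseteq> {..<n}" for vs
    using that by (induction vs) (simp_all add: one mult pow)
  from this[of "[0..<n]"] show ?thesis
    by (simp add: mat_monomial_def ok_def atLeast0LessThan)
qed

lemma subst_Const_Var_polys:
  assumes K: "subring K complex_ring" and p: "p \<in> polys K U" and g: "\<And>u. u \<in> U \<Longrightarrow> g u \<in> V"
  shows "subst Const (\<lambda>u. Var (g u)) p \<in> polys K V"
  unfolding subst_def
proof (rule polys_sum[OF K])
  fix m assume "m \<in> Poly_Mapping.keys p"
  then have "Poly_Mapping.keys m \<subseteq> U" using p by (auto simp: polys_def monomials_def)
  moreover have "Poly_Mapping.lookup p m \<in> K" using p by (simp add: polys_def)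
  ultimately show "Const (Poly_Mapping.lookup p m) * (\<Prod>u\<in>Poly_Mapping.keys m. Var (g u) ^ Poly_Mapping.lookup m u) \<in> polys K V"
    using g by (intro polys_mult[OF K] polys_Const[OF K] polys_prod[OF K] polys_power[OF K] polys_Var[OF K]) auto
qed

lemma param_normal_form_index:
  assumes "j < \<delta>"
  shows "param_normal_form n \<delta> \<alpha> p $ j =
    (\<Sum>\<gamma> | \<gamma> \<in> monomials {..<n} \<and> pdiffs \<gamma> p \<noteq> 0. subst Const (\<lambda>i. Var (Z i)) (taylor \<gamma> p) *
      (mat_monomial n \<delta> (mult_matrix \<delta> \<alpha>) \<gamma> *\<^sub>v unit_vec \<delta> 0) $ j)"
  using assms
  by (simp add: param_normal_form_def mult_matrix_power_conv taylor_def subst_smult[OF Const_hom]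
      flip: smult_conv_mult)

lemma mat_vec_unit_index:
  fixes A :: "'r::comm_ring_1 mat"
  assumes "A \<in> carrier_mat \<delta> \<delta>" "j < \<delta>"
  shows "(A *\<^sub>v unit_vec \<delta> 0) $ j = A $$ (j, 0)"
proof -
  have "0 < \<delta>" using assms(2) by simp
  then have "Matrix.row A j \<bullet> unit_vec \<delta> 0 = Matrix.row A j $ 0"
    using assms(1) by (intro scalar_prod_right_unit) simp_all
  then show ?thesis using assms \<open>0 < \<delta>\<close> carrier_matD[OF assms(1)] by simp
qed

lemma param_system_polys:
  assumes K: "subring K complex_ring" and f: "\<And>k. k < N \<Longrightarrow> f k \<in> polys K {..<n}" and \<delta>: "0 < \<delta>"
  shows "param_system n \<delta> \<alpha> N f \<subseteq> polys K (param_vars n \<delta> \<alpha>)"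
proof -
  let ?P = "polys K (param_vars n \<delta> \<alpha>)" and ?M = "mult_matrix \<delta> \<alpha>"
  have M: "?M i $$ (l, k) \<in> ?P" if i: "i < n" and lk: "l < \<delta>" "k < \<delta>" for i l k
  proof -
    have "Mu (\<alpha> l) (\<alpha> k + Poly_Mapping.single i 1) \<in> param_vars n \<delta> \<alpha>"
      if "\<not> l \<le> k" "\<alpha> k + Poly_Mapping.single i 1 \<notin> \<alpha> ` {..<\<delta>}"
      using that i lk unfolding param_vars_def by (intro UnI2 CollectI exI[of _ k] exI[of _ l] exI[of _ i]) simp
    then show ?thesis
      unfolding mult_matrix_index[OF lk] Let_def
      by (simp add: polys_zero[OF K] polys_one[OF K] polys_Var[OF K])
  qed
  have monomial: "\<forall>r<\<delta>. \<forall>c<\<delta>. mat_monomial n \<delta> ?M \<gamma> $$ (r, c) \<in> ?P" for \<gamma>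
    by (rule mat_monomial_polys[OF K]) (simp_all add: M)
  have carrier: "mat_monomial n \<delta> ?M \<gamma> \<in> carrier_mat \<delta> \<delta>" for \<gamma>
    by (rule map_mat_monomial(1)[OF comm_ring_hom_id]) simp
  have nf: "param_normal_form n \<delta> \<alpha> (f k) $ j \<in> ?P" if k: "k < N" and j: "j < \<delta>" for k j
    unfolding param_normal_form_index[OF j] mat_vec_unit_index[OF carrier j]
    by (intro polys_sum[OF K] polys_mult[OF K] subst_Const_Var_polys[OF K taylor_polys[OF K f[OF k]]])
       (use monomial j \<delta> in \<open>auto simp: param_vars_def\<close>)
  have comm: "(?M i * ?M j - ?M j * ?M i) $$ (r, c) \<in> ?P"
    if "i < n" "j < n" "r < \<delta>" "c < \<delta>" for i j r c
  proof -
    have prod: "(?M i * ?M j) $$ (r, c) = (\<Sum>k<\<delta>. ?M i $$ (r, k) * ?M j $$ (k, c))" for i j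
      using that carrier_matD[OF mult_matrix_carrier[of \<delta> \<alpha> i]] carrier_matD[OF mult_matrix_carrier[of \<delta> \<alpha> j]]
      by (simp add: scalar_prod_def atLeast0LessThan)
    have "(?M i * ?M j) $$ (r, c) \<in> ?P" if "i < n" "j < n" for i j
      unfolding prod using M that \<open>r < \<delta>\<close> \<open>c < \<delta>\<close> by (intro polys_sum[OF K] polys_mult[OF K]) simp_all
    moreover have "(?M i * ?M j - ?M j * ?M i) $$ (r, c) = (?M i * ?M j) $$ (r, c) - (?M j * ?M i) $$ (r, c)"
      using that carrier_matD[OF mult_matrix_carrier[of \<delta> \<alpha> i]] carrier_matD[OF mult_matrix_carrier[of \<delta> \<alpha> j]]
      by simp
    ultimately show ?thesis using that by (simp add: polys_diff[OF K])
  qed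
  show ?thesis unfolding param_system_def using nf comm by auto
qed

subsection \<open>Specialisations of the system\<close>

text \<open>
  The matrices and the normal form after applying a ring homomorphism to the parameters; below
  \<open>\<phi>\<close> is the evaluation at the point, and then the evaluation at an infinitely near point.
\<close>

locale param_specialization =
  fixes \<phi> :: "pvar cpoly \<Rightarrow> 'r::comm_ring_1" and n \<delta> :: nat and \<alpha> :: "nat \<Rightarrow> nat monomial"
  assumes \<phi>: "comm_ring_hom \<phi>"
begin

definition "h c = \<phi> (Const c)"
definition "z i = \<phi> (Var (Z i))"
definition "M i = map_mat \<phi> (mult_matrix \<delta> \<alpha> i)"

sublocale \<phi>: comm_ring_hom \<phi> by (rule \<phi>)

lemma h_hom: "comm_ring_hom h"
  by unfold_locales (simp_all add: h_def Const.hom_add Const.hom_mult \<phi>.hom_add \<phi>.hom_mult)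

lemma M_carrier: "M i \<in> carrier_mat \<delta> \<delta>"
  by (simp add: M_def)

lemma M_index: "l < \<delta> \<Longrightarrow> k < \<delta> \<Longrightarrow> M i $$ (l, k) = \<phi> (mult_matrix \<delta> \<alpha> i $$ (l, k))"
  using carrier_matD[OF mult_matrix_carrier[of \<delta> \<alpha> i]] by (simp add: M_def)

lemma M_commutator:
  assumes "i < n" "j < n" "r < \<delta>" "c < \<delta>"
  shows "\<phi> ((mult_matrix \<delta> \<alpha> i * mult_matrix \<delta> \<alpha> j - mult_matrix \<delta> \<alpha> j * mult_matrix \<delta> \<alpha> i) $$ (r, c)) =
    (\<Sum>k<\<delta>. M i $$ (r, k) * M j $$ (k, c)) - (\<Sum>k<\<delta>. M j $$ (r, k) * M i $$ (k, c))"
  using assms carrier_matD[OF mult_matrix_carrier[of \<delta> \<alpha> i]] carrier_matD[OF mult_matrix_carrier[of \<delta> \<alpha> j]]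
  by (simp add: scalar_prod_def atLeast0LessThan \<phi>.hom_minus \<phi>.hom_sum \<phi>.hom_mult M_index)

lemma commuting_matricesI:
  assumes "\<And>i j r c. i < n \<Longrightarrow> j < n \<Longrightarrow> r < \<delta> \<Longrightarrow> c < \<delta> \<Longrightarrow>
      (\<Sum>k<\<delta>. M i $$ (r, k) * M j $$ (k, c)) = (\<Sum>k<\<delta>. M j $$ (r, k) * M i $$ (k, c))"
    and "0 < \<delta>"
  shows "commuting_matrices h n \<delta> M"
proof (intro commuting_matrices.intro)
  show "comm_ring_hom h" by (rule h_hom)
  show "M i \<in> carrier_mat \<delta> \<delta>" for i by (rule M_carrier)
  show "0 < \<delta>" by fact
  fix i j assume ij: "i < n" "j < n"
  show "M i * M j = M j * M i"
  proof (rule eq_matI)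
    fix r c assume "r < dim_row (M j * M i)" "c < dim_col (M j * M i)"
    then have rc: "r < \<delta>" "c < \<delta>" using carrier_matD[OF M_carrier[of i]] carrier_matD[OF M_carrier[of j]] by simp_all
    show "(M i * M j) $$ (r, c) = (M j * M i) $$ (r, c)"
      using assms(1)[OF ij rc] rc carrier_matD[OF M_carrier[of i]] carrier_matD[OF M_carrier[of j]]
      by (simp add: scalar_prod_def atLeast0LessThan)
  qed (use carrier_matD[OF M_carrier[of i]] carrier_matD[OF M_carrier[of j]] in simp_all)
qed

lemma specialize_normal_form:
  assumes "commuting_matrices h n \<delta> M" "j < \<delta>"
  shows "\<phi> (param_normal_form n \<delta> \<alpha> p $ j) = commuting_matrices.nf h z n \<delta> M p j"
proof -
  interpret commuting_matrices h z n \<delta> M by fact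
  have "\<phi> ((mat_monomial n \<delta> (mult_matrix \<delta> \<alpha>) \<gamma> *\<^sub>v unit_vec \<delta> 0) $ j) = orbit \<gamma> j" for \<gamma>
  proof -
    have c: "mat_monomial n \<delta> (mult_matrix \<delta> \<alpha>) \<gamma> \<in> carrier_mat \<delta> \<delta>"
      by (rule map_mat_monomial(1)[OF comm_ring_hom_id]) simp
    have "mat_monomial n \<delta> M \<gamma> = map_mat \<phi> (mat_monomial n \<delta> (mult_matrix \<delta> \<alpha>) \<gamma>)"
      unfolding M_def by (rule map_mat_monomial(2)[OF \<phi>, symmetric]) simp
    then show ?thesis
      unfolding orbit_def mat_vec_unit_index[OF c assms(2)] mat_vec_unit_index[OF mat_monomial_carrier assms(2)]
      using carrier_matD[OF c] assms(2) \<delta>_pos by simp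
  qed
  moreover have "\<phi> (subst Const (\<lambda>i. Var (Z i)) q) = subst h z q" for q
    unfolding hom_subst[OF \<phi>] by (simp add: o_def h_def[abs_def] z_def[abs_def])
  ultimately show ?thesis
    unfolding param_normal_form_index[OF assms(2)] nf_def by (simp add: \<phi>.hom_sum \<phi>.hom_mult)
qed

end

lemma finite_param_vars: "finite (param_vars n \<delta> \<alpha>)"
proof -
  have "{Mu (\<alpha> l) (\<alpha> k + Poly_Mapping.single i 1) | k l i.
        k < l \<and> l < \<delta> \<and> i < n \<and> \<alpha> k + Poly_Mapping.single i 1 \<notin> \<alpha> ` {..<\<delta>}} \<subseteq>
      (\<lambda>(k, l, i). Mu (\<alpha> l) (\<alpha> k + Poly_Mapping.single i 1)) ` ({..<\<delta>} \<times> {..<\<delta>} \<times> {..<n})"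
    by (force intro: image_eqI[where x="(k, l, i)" for k l i])
  then have "finite {Mu (\<alpha> l) (\<alpha> k + Poly_Mapping.single i 1) | k l i.
        k < l \<and> l < \<delta> \<and> i < n \<and> \<alpha> k + Poly_Mapping.single i 1 \<notin> \<alpha> ` {..<\<delta>}}"
    by (rule finite_subset) simp
  then show ?thesis unfolding param_vars_def by simp
qed


section \<open>The parametric system at the primal-dual pair\<close>

text \<open>
  The last two assumptions say that \<open>Q\<close> and the ideal of the \<open>f k\<close> agree near \<open>\<xi>\<close>, as they do if \<open>Q\<close>
  is the primary component at \<open>\<xi>\<close>.
\<close>

locale param_system_at_root = primal_dual_pair n \<xi> Q \<delta> \<alpha> \<Lambda> \<nu>
  for n \<xi> Q \<delta> \<alpha> \<Lambda> \<nu> +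
  fixes N :: nat and f :: "nat \<Rightarrow> nat cpoly"
  assumes f_polys: "\<And>k. k < N \<Longrightarrow> f k \<in> polys UNIV {..<n}"
    and I_subset_Q: "Idl\<^bsub>poly_ring {..<n}\<^esub> (f ` {..<N}) \<subseteq> Q"
    and localizes: "\<exists>s\<in>polys UNIV {..<n}. eval \<xi> s \<noteq> 0 \<and>
      (\<forall>q\<in>Q. s * q \<in> Idl\<^bsub>poly_ring {..<n}\<^esub> (f ` {..<N}))"
begin

abbreviation "V \<equiv> param_vars n \<delta> \<alpha>"
abbreviation "F \<equiv> param_system n \<delta> \<alpha> N f"
abbreviation "pt \<equiv> param_point n \<delta> \<alpha> \<xi> \<nu>"
abbreviation "I \<equiv> Idl\<^bsub>poly_ring {..<n}\<^esub> (f ` {..<N})"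

sublocale R: cring "poly_ring {..<n}" by (rule cring_poly_ring)

lemma f_in_I: "k < N \<Longrightarrow> f k \<in> I"
  using R.genideal_self[of "f ` {..<N}"] f_polys by auto

lemma f_in_Q: "k < N \<Longrightarrow> f k \<in> Q"
  using f_in_I I_subset_Q by blast

lemma Z_var: "i < n \<Longrightarrow> Z i \<in> V"
  by (simp add: param_vars_def)

lemma Mu_var:
  assumes "k < l" "l < \<delta>" "i < n" "\<alpha> k + Poly_Mapping.single i 1 \<notin> E"
  shows "Mu (\<alpha> l) (\<alpha> k + Poly_Mapping.single i 1) \<in> V"
  using assms unfolding param_vars_def
  by (intro UnI2 CollectI exI[of _ k] exI[of _ l] exI[of _ i]) simp

lemma pt_Z: "i < n \<Longrightarrow> pt (Z i) = \<xi> i"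
  by (simp add: param_point_def Z_var)

lemma pt_Mu:
  assumes "k < l" "l < \<delta>" "i < n" "\<alpha> k + Poly_Mapping.single i 1 \<notin> E"
  shows "pt (Mu (\<alpha> l) (\<alpha> k + Poly_Mapping.single i 1)) = \<nu> (\<alpha> l) (\<alpha> k + Poly_Mapping.single i 1)"
  using Mu_var[OF assms] by (simp add: param_point_def)

lemma eval_mult_matrix:
  assumes "i < n" "l < \<delta>" "k < \<delta>"
  shows "eval pt (mult_matrix \<delta> \<alpha> i $$ (l, k)) = A i l k"
  unfolding A_eq[OF assms] mult_matrix_index[OF assms(2,3)] Let_def
  using assms pt_Mu[of k l i] by (simp add: not_le)

subsection \<open>The point is a root\<close>

sublocale at_pt: param_specialization "eval pt" n \<delta> \<alpha>
  by unfold_locales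

lemma at_pt_h: "at_pt.h c = c"
  by (simp add: at_pt.h_def)

lemma at_pt_z: "i < n \<Longrightarrow> at_pt.z i = \<xi> i"
  by (simp add: at_pt.z_def pt_Z)

lemma at_pt_M: "i < n \<Longrightarrow> l < \<delta> \<Longrightarrow> k < \<delta> \<Longrightarrow> at_pt.M i $$ (l, k) = A i l k"
  by (simp add: at_pt.M_index eval_mult_matrix)

lemma at_pt_commute:
  assumes "i < n" "j < n" "r < \<delta>" "c < \<delta>"
  shows "(\<Sum>k<\<delta>. at_pt.M i $$ (r, k) * at_pt.M j $$ (k, c)) = (\<Sum>k<\<delta>. at_pt.M j $$ (r, k) * at_pt.M i $$ (k, c))"
  using A_commute[OF assms] assms by (simp add: at_pt_M)

sublocale at_pt: commuting_matrices at_pt.h at_pt.z n \<delta> at_pt.M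
  by (rule at_pt.commuting_matricesI[OF at_pt_commute \<delta>_pos])

text \<open>
  Both sides obey the same rule for the multiplication by a variable, \<open>nf_Var_mult\<close> and \<open>L_mult\<close>.
\<close>

lemma normal_form_at_pt:
  assumes "p \<in> polys UNIV {..<n}" "l < \<delta>"
  shows "at_pt.nf p l = L l p"
  using assms
proof (induction arbitrary: l rule: polys_induct)
  case (Const c)
  have eq: "Const c = smult c (b 0)" by (simp add: \<alpha>_0 smult_conv_mult)
  have L: "L l (Const c) = (if l = 0 then c else 0)"
    unfolding eq using Const dual[of l 0] \<delta>_pos by (simp add: apply_functional_smult)
  show ?case unfolding at_pt.nf_Const[OF Const] L by (simp add: at_pt_h)
next
  case (add p q)
  then show ?case by (simp add: at_pt.nf_add apply_functional_add)
next
  case (Var i p)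
  then have i: "i < n" by simp
  have "Var i * p = x i * p + smult (\<xi> i) p" by (simp add: smult_conv_mult algebra_simps)
  then have "L l (Var i * p) = L l (x i * p) + \<xi> i * L l p"
    by (simp only: apply_functional_add apply_functional_smult)
  then show ?case
    using Var.IH Var.prems i Var.hyps
    by (simp add: at_pt.nf_Var_mult at_pt_z at_pt_M L_mult)
qed

lemma pt_root:
  assumes "p \<in> F"
  shows "eval pt p = 0"
proof -
  consider k j where "p = param_normal_form n \<delta> \<alpha> (f k) $ j" "k < N" "j < \<delta>"
    | i j r c where "p = (mult_matrix \<delta> \<alpha> i * mult_matrix \<delta> \<alpha> j - mult_matrix \<delta> \<alpha> j * mult_matrix \<delta> \<alpha> i) $$ (r, c)"
      "i < n" "j < n" "r < \<delta>" "c < \<delta>"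
    using assms unfolding param_system_def by auto
  then show ?thesis
  proof cases
    case 1
    then show ?thesis
      using at_pt.specialize_normal_form[OF at_pt.commuting_matrices_axioms, of j "f k"]
      by (simp add: normal_form_at_pt f_polys L_vanishes f_in_Q)
  next
    case 2
    then show ?thesis using at_pt_commute by (simp add: at_pt.M_commutator)
  qed
qed

subsection \<open>There are no tangent vectors\<close>

text \<open>
  In this context \<open>pt + \<epsilon> t\<close> is a root of the system over the dual numbers.  The matrices there have
  the standard parts \<open>A i\<close>, the \<open>\<epsilon>\<close>-parts \<open>A' i\<close>, and the normal form is \<open>tg.nf\<close>.
\<close>

context
  fixes t :: "pvar \<Rightarrow> complex"
  assumes tangent: "\<And>p. p \<in> F \<Longrightarrow> tangent_eval pt t p = 0"
begin

interpretation tg: param_specialization "tangent_eval pt t" n \<delta> \<alpha>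
  by (rule param_specialization.intro) (rule tangent_eval_hom)

lemma tg_commute:
  assumes "i < n" "j < n" "r < \<delta>" "c < \<delta>"
  shows "(\<Sum>k<\<delta>. tg.M i $$ (r, k) * tg.M j $$ (k, c)) = (\<Sum>k<\<delta>. tg.M j $$ (r, k) * tg.M i $$ (k, c))"
proof -
  have "(mult_matrix \<delta> \<alpha> i * mult_matrix \<delta> \<alpha> j - mult_matrix \<delta> \<alpha> j * mult_matrix \<delta> \<alpha> i) $$ (r, c) \<in> F"
    using assms unfolding param_system_def
    by (intro UnI2 CollectI exI[of _ i] exI[of _ j] exI[of _ r] exI[of _ c]) simp
  from tangent[OF this] show ?thesis using tg.M_commutator[OF assms] by simp
qed

interpretation tg: commuting_matrices tg.h tg.z n \<delta> tg.M
  by (rule tg.commuting_matricesI[OF tg_commute \<delta>_pos])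

lemma tg_h: "tg.h c = const_dual c"
  by (simp add: tg.h_def)

definition A' :: "nat \<Rightarrow> nat \<Rightarrow> nat \<Rightarrow> complex" where
  "A' i l k = eps (tg.M i $$ (l, k))"

lemma tg_M:
  assumes "i < n" "l < \<delta>" "k < \<delta>"
  shows "tg.M i $$ (l, k) = Dual (A i l k) (A' i l k)"
  using eval_mult_matrix[OF assms] assms
  by (intro dual.expand) (simp add: A'_def tg.M_index)

lemma A'_upper:
  assumes "l \<le> k" "k < \<delta>"
  shows "A' i l k = 0"
  using assms by (simp add: A'_def tg.M_index mult_matrix_index tg.\<phi>.hom_zero)

lemma A'_inside:
  assumes "l < \<delta>" "k < \<delta>" "\<alpha> k + Poly_Mapping.single i 1 \<in> E"
  shows "A' i l k = 0"
  using assms by (simp add: A'_def tg.M_index mult_matrix_index Let_def tg.\<phi>.hom_zero tg.\<phi>.hom_one)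

lemma A'_outside:
  assumes "k < l" "l < \<delta>" "\<alpha> k + Poly_Mapping.single i 1 \<notin> E"
  shows "A' i l k = t (Mu (\<alpha> l) (\<alpha> k + Poly_Mapping.single i 1))"
proof -
  have "\<alpha> l \<noteq> \<alpha> k + Poly_Mapping.single i 1" using assms by (metis imageI lessThan_iff)
  then show ?thesis
    using assms by (simp add: A'_def tg.M_index mult_matrix_index Let_def)
qed

lemma tg_z: "i < n \<Longrightarrow> tg.z i = Dual (\<xi> i) (t (Z i))"
  by (simp add: tg.z_def pt_Z)

lemma std_tg_nf:
  assumes "p \<in> polys UNIV {..<n}" "l < \<delta>"
  shows "std (tg.nf p l) = L l p"
  using tg.specialize_normal_form[OF tg.commuting_matrices_axioms assms(2), of p]
    at_pt.specialize_normal_form[OF at_pt.commuting_matrices_axioms assms(2), of p]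
    normal_form_at_pt[OF assms] by (metis std_tangent_eval)

text \<open>
  With \<open>nf_add\<close> this makes the kernel of the normal form an ideal.
\<close>

lemma tg_nf_mult:
  assumes "r \<in> polys UNIV {..<n}" "\<And>l. l < \<delta> \<Longrightarrow> tg.nf p l = 0" "l < \<delta>"
  shows "tg.nf (r * p) l = 0"
  using assms(1,3)
proof (induction arbitrary: l rule: polys_induct)
  case (Const c)
  then show ?case using assms(2) by (simp add: tg.nf_smult flip: smult_conv_mult)
next
  case (add q r)
  then show ?case by (simp add: distrib_right tg.nf_add)
next
  case (Var i q)
  then show ?case by (simp add: mult.assoc tg.nf_Var_mult)
qed

lemma tg_nf_I:
  assumes "p \<in> I" "l < \<delta>"
  shows "tg.nf p l = 0"
proof -
  let ?J = "{p \<in> polys UNIV {..<n}. \<forall>l<\<delta>. tg.nf p l = 0}"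
  have zero: "tg.nf 0 l = 0" for l using tg.nf_smult[of 0 0] by (simp add: tg_h const_dual_def zero_dual_def[symmetric])
  have "ideal ?J (poly_ring {..<n})"
    unfolding ideal_poly_ring_iff
    using zero by (auto simp: cpolys_closed tg.nf_add tg_nf_mult)
  moreover have "f ` {..<N} \<subseteq> ?J"
  proof (rule image_subsetI)
    fix k assume "k \<in> {..<N}"
    then have k: "k < N" by simp
    have "tg.nf (f k) l = 0" if "l < \<delta>" for l
    proof -
      have "param_normal_form n \<delta> \<alpha> (f k) $ l \<in> F"
        unfolding param_system_def using k that by (intro UnI1 CollectI exI[of _ k] exI[of _ l]) simp
      then show ?thesis
        using tangent tg.specialize_normal_form[OF tg.commuting_matrices_axioms that, of "f k"] by simp
    qed
    then show "f k \<in> ?J" using f_polys[OF k] by simp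
  qed
  ultimately have "I \<subseteq> ?J" by (rule R.genideal_minimal)
  then show ?thesis using assms by blast
qed

text \<open>
  Row by row.  If the rows above row \<open>l\<close> vanish on \<open>Q\<close>, the strictly triangular matrices contribute
  nothing to row \<open>l\<close>, on which \<open>x\<^sub>i\<close> then acts as the scalar \<open>\<xi> i + \<epsilon> t\<^sub>i\<close>.  The standard part of the row
  vanishes on \<open>Q\<close>, so its \<open>\<epsilon>\<close>-part sees only \<open>\<xi> i\<close>, and a polynomial \<open>r\<close> acts on it as \<open>r(\<xi>)\<close>.  Taking for
  \<open>r\<close> the polynomial \<open>s\<close> with \<open>s(\<xi>) \<noteq> 0\<close> and \<open>s Q \<subseteq> I\<close> finishes the step.
\<close>

lemma tg_nf_Q:
  assumes "q \<in> Q" "l < \<delta>"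
  shows "tg.nf q l = 0"
  using assms
proof (induction l arbitrary: q rule: less_induct)
  case (less l)
  have std0: "std (tg.nf p l) = 0" if "p \<in> Q" for p
    using std_tg_nf[OF Q(1)[OF that] less.prems(2)] L_vanishes[OF less.prems(2) that] by simp
  have step: "eps (tg.nf (Var i * p) l) = \<xi> i * eps (tg.nf p l)" if i: "i < n" and p: "p \<in> Q" for i p
  proof -
    have "tg.M i $$ (l, k) * tg.nf p k = 0" if "k < \<delta>" for k
    proof (cases "k < l")
      case True
      then show ?thesis using less.IH[of k p] p that by simp
    next
      case False
      then have "tg.M i $$ (l, k) = 0"
        using less.prems(2) that by (simp add: tg.M_index mult_matrix_index tg.\<phi>.hom_zero)
      then show ?thesis by simp
    qed
    then have "tg.nf (Var i * p) l = tg.z i * tg.nf p l"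
      using tg.nf_Var_mult[OF i less.prems(2), of p] by simp
    then show ?thesis using std0[OF p] i by (simp add: tg_z)
  qed
  have mult: "eps (tg.nf (r * p) l) = eval \<xi> r * eps (tg.nf p l)" if "r \<in> polys UNIV {..<n}" "p \<in> Q" for r p
    using that
  proof (induction rule: polys_induct)
    case (Const c)
    show ?case unfolding smult_conv_mult[symmetric] tg.nf_smult by (simp add: tg_h[of c])
  next
    case (add r s)
    then show ?case by (simp add: distrib_right tg.nf_add eval.hom_add)
  next
    case (Var i r)
    then have "r * p \<in> Q" by (intro Q(4))
    then show ?case using Var step[of i "r * p"] by (simp add: mult.assoc eval.hom_mult)
  qed
  obtain s where s: "s \<in> polys UNIV {..<n}" "eval \<xi> s \<noteq> 0" "\<forall>q\<in>Q. s * q \<in> I"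
    using localizes by blast
  have "eval \<xi> s * eps (tg.nf q l) = 0"
    using mult[OF s(1) less.prems(1)] tg_nf_I[of "s * q" l] s(3) less.prems by simp
  then have "eps (tg.nf q l) = 0" using s(2) by simp
  then show ?case using std0[OF less.prems(1)] by (intro dual.expand) simp
qed

text \<open>
  As the normal form vanishes on \<open>Q\<close>, its \<open>\<epsilon>\<close>-part is determined by its values at the basis; they form
  the columns of \<open>T\<close>.
\<close>

definition T :: "nat \<Rightarrow> nat \<Rightarrow> complex" where
  "T l k = eps (tg.nf (b k) l)"

text \<open>
  The matrix identity \<open>T A\<^sub>i = t\<^sub>i + A\<^sub>i T + A'\<^sub>i\<close>.  The left-hand side is the \<open>\<epsilon>\<close>-part of the normal form of
  \<open>x i * b k\<close> computed after reduction modulo \<open>Q\<close>, the right-hand side is the same by the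
  multiplication rule.
\<close>

lemma T_equation:
  assumes i: "i < n" and l: "l < \<delta>" and k: "k < \<delta>"
  shows "(\<Sum>j<\<delta>. T l j * A i j k) = (if l = k then t (Z i) else 0) + (\<Sum>j<\<delta>. A i l j * T j k) + A' i l k"
proof -
  have bP: "b k \<in> polys UNIV {..<n}" for k by (rule shifted_monomial_polys)
  have std: "std (tg.nf (b k) j) = (if j = k then 1 else 0)" if "j < \<delta>" for j
    using std_tg_nf[OF bP that] dual[OF that k] by simp
  have "x i * b k - (\<Sum>j<\<delta>. smult (A i j k) (b j)) \<in> Q"
    unfolding A_def by (rule reduce) (intro cpolys_closed bP; simp add: i)
  from tg_nf_Q[OF this l] have "tg.nf (x i * b k) l = (\<Sum>j<\<delta>. tg.h (A i j k) * tg.nf (b j) l)"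
    by (simp add: tg.nf_diff tg.nf_sum tg.nf_smult)
  then have "(\<Sum>j<\<delta>. T l j * A i j k) = eps (tg.nf (x i * b k) l)"
    by (simp add: tg_h T_def mult.commute)
  also have "tg.nf (x i * b k) l = (tg.z i - tg.h (\<xi> i)) * tg.nf (b k) l + (\<Sum>j<\<delta>. tg.M i $$ (l, j) * tg.nf (b k) j)"
    by (rule tg.nf_shifted_Var_mult[OF i l])
  also have "eps \<dots> = t (Z i) * std (tg.nf (b k) l) + (\<Sum>j<\<delta>. A i l j * T j k + A' i l j * std (tg.nf (b k) j))"
    using i l by (simp add: tg_z tg_h tg_M T_def)
  also have "(\<Sum>j<\<delta>. A i l j * T j k + A' i l j * std (tg.nf (b k) j)) =
      (\<Sum>j<\<delta>. A i l j * T j k) + (\<Sum>j<\<delta>. if j = k then A' i l j else 0)"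
    unfolding sum.distrib[symmetric] by (rule sum.cong) (simp_all add: std)
  finally show ?thesis using k l by (simp add: std)
qed

text \<open>
  The trace of \<open>T_equation\<close>: the trace of \<open>T A\<^sub>i - A\<^sub>i T\<close> is zero, and so is that of the strictly
  triangular matrix \<open>A'\<^sub>i\<close>.
\<close>

lemma t_Z:
  assumes i: "i < n"
  shows "t (Z i) = 0"
proof -
  have "(\<Sum>k<\<delta>. \<Sum>j<\<delta>. T k j * A i j k) = (\<Sum>k<\<delta>. t (Z i) + (\<Sum>j<\<delta>. A i k j * T j k))"
    by (rule sum.cong) (simp_all add: T_equation i A'_upper)
  also have "\<dots> = of_nat \<delta> * t (Z i) + (\<Sum>k<\<delta>. \<Sum>j<\<delta>. A i k j * T j k)"
    by (simp add: sum.distrib)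
  also have "(\<Sum>k<\<delta>. \<Sum>j<\<delta>. A i k j * T j k) = (\<Sum>k<\<delta>. \<Sum>j<\<delta>. T k j * A i j k)"
    by (subst sum.swap) (simp add: mult.commute)
  finally show ?thesis using \<delta>_pos by simp
qed

text \<open>
  If \<open>\<alpha> k = \<alpha> m + e\<^sub>i\<close>, the \<open>m\<close>-th column of \<open>A\<^sub>i\<close> is the \<open>k\<close>-th unit vector and that of \<open>A'\<^sub>i\<close> is zero,
  so \<open>T_equation\<close> expresses column \<open>k\<close> of \<open>T\<close> through column \<open>m\<close>.  Connectedness to \<open>1\<close> provides
  \<open>m\<close> and \<open>i\<close> for every \<open>\<alpha> k \<noteq> 0\<close>.
\<close>

lemma T_0: "k < \<delta> \<Longrightarrow> l < \<delta> \<Longrightarrow> T l k = 0"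
proof (induction "mdeg (\<alpha> k)" arbitrary: k l rule: less_induct)
  case less
  show ?case
  proof (cases "\<alpha> k = 0")
    case True
    then have "b k = Const 1" by simp
    then show ?thesis
      unfolding T_def using tg.nf_Const[of l 1] less.prems by (simp add: tg_h)
  next
    case False
    then obtain \<alpha>' i where "\<alpha>' \<in> E" and i: "i < n" and \<alpha>k: "\<alpha> k = \<alpha>' + Poly_Mapping.single i 1"
      using connected less.prems(1) unfolding connected_to_1_def by blast
    then obtain m where m: "m < \<delta>" "\<alpha>' = \<alpha> m" by blast
    have deg: "mdeg (\<alpha> m) < mdeg (\<alpha> k)" unfolding \<alpha>k m(2) by (simp add: mdeg_add)
    have IH: "T j m = 0" if "j < \<delta>" for j using less.hyps[OF deg m(1) that] .
    have col: "A i j m = (if j = k then 1 else 0)" if "j < \<delta>" for j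
      using dual[OF that less.prems(1)]
      unfolding A_def shifted_monomial_add_single[OF i, symmetric] \<alpha>k m(2) .
    have "A' i l m = 0"
      using A'_inside[OF less.prems(2) m(1), of i] less.prems(1) unfolding m(2)[symmetric] \<alpha>k[symmetric] by simp
    moreover have "(\<Sum>j<\<delta>. T l j * A i j m) = (\<Sum>j<\<delta>. if j = k then T l j else 0)"
      by (rule sum.cong) (simp_all add: col)
    ultimately show ?thesis
      using T_equation[OF i less.prems(2) m(1)] t_Z[OF i] IH less.prems(1)
      by (cases "l = m") simp_all
  qed
qed

lemma A'_0: "i < n \<Longrightarrow> l < \<delta> \<Longrightarrow> k < \<delta> \<Longrightarrow> A' i l k = 0"
  using T_equation[of i l k] t_Z[of i] T_0 by (cases "l = k") simp_all

lemma tangent_vanishes: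
  assumes "v \<in> V"
  shows "t v = 0"
proof -
  consider i where "v = Z i" "i < n"
    | k l i where "v = Mu (\<alpha> l) (\<alpha> k + Poly_Mapping.single i 1)" "k < l" "l < \<delta>" "i < n"
      "\<alpha> k + Poly_Mapping.single i 1 \<notin> E"
    using assms unfolding param_vars_def by auto
  then show ?thesis
  proof cases
    case 1
    then show ?thesis by (simp add: t_Z)
  next
    case 2
    then show ?thesis using A'_outside[of k l i] A'_0[of i l k] by simp
  qed
qed

end

lemma root_without_tangents: "root_without_tangents V F pt"
proof
  show "finite V" by (rule finite_param_vars)
  show "F \<subseteq> polys UNIV V"
    by (rule param_system_polys[OF subring_complex_UNIV f_polys \<delta>_pos])
  show "pt \<in> V \<rightarrow>\<^sub>E UNIV" by (simp add: param_point_def)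
  show "eval pt p = 0" if "p \<in> F" for p using pt_root[OF that] .
  show "t v = 0" if "\<And>p. p \<in> F \<Longrightarrow> tangent_eval pt t p = 0" "v \<in> V" for t v
    using tangent_vanishes[OF that] .
qed

end

section \<open>Simplicity of the root of the parametric system\<close>

theorem theorem4p11:
  fixes K :: "complex set" and n N \<delta> :: nat
    and f :: "nat \<Rightarrow> nat cpoly" and \<xi> :: "nat \<Rightarrow> complex" and Q :: "nat cpoly set"
    and \<alpha> :: "nat \<Rightarrow> nat monomial" and \<Lambda> :: "nat \<Rightarrow> nat cpoly"
    and \<nu> :: "nat monomial \<Rightarrow> nat monomial \<Rightarrow> complex"
  assumes "subfield K complex_ring"
    and "\<And>k. k < N \<Longrightarrow> f k \<in> polys K {..<n}"
    and "isolated_root {..<n} (f ` {..<N}) \<xi>"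
    and "primary_component_at {..<n} (f ` {..<N}) \<xi> Q"
    and "orthogonal_pair n \<xi> Q \<delta> \<alpha> \<Lambda> \<nu>"
  shows "param_system n \<delta> \<alpha> N f \<subseteq> polys K (param_vars n \<delta> \<alpha>) \<and>
    isolated_root (param_vars n \<delta> \<alpha>) (param_system n \<delta> \<alpha> N f) (param_point n \<delta> \<alpha> \<xi> \<nu>) \<and>
    root_multiplicity (param_vars n \<delta> \<alpha>) (param_system n \<delta> \<alpha> N f) (param_point n \<delta> \<alpha> \<xi> \<nu>) 1"
proof -
  note loc = isolated_primary_component_localizes[OF assms(4)[unfolded primary_component_at_def]]
  have f_polys: "f k \<in> polys UNIV {..<n}" if "k < N" for k
    using assms(2)[OF that] polys_mono[of K UNIV] by blast
  interpret param_system_at_root n \<xi> Q \<delta> \<alpha> \<Lambda> \<nu> N f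
    by (intro param_system_at_root.intro primal_dual_pair.intro param_system_at_root_axioms.intro
        assms(5) loc f_polys)
  have K: "subring K complex_ring"
    using assms(1) by (simp add: subfield_def subdomain_def subcring_def)
  have "F \<subseteq> polys K V"
    by (rule param_system_polys[OF K assms(2) \<delta>_pos])
  then show ?thesis using root_without_tangents.isolated_root[OF root_without_tangents]
      root_without_tangents.root_multiplicity_one[OF root_without_tangents]
    by blast
qed


end
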